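(* Let $X=(X_n)_{n\in\mathbb{Z}}$ be the i.i.d. increments of a skip-free to the left random walk with $0<\mathbb{E}[X_0]<\infty$. Let $[\mathbf{T},\mathbf{o},t]$ be the connected component of $0$, rooted at $\mathbf{o}=0$, in the record graph of $(\mathbb{Z},X)$, ordered by the order of $\mathbb{Z}$ on the children of each vertex, and with vertex marks given by the type function $t=t_X$. Let $[\mathbf{T}',\mathbf{o}',t']$ have the law of $[\mathbf{T},\mathbf{o},t]$ conditioned on the event that $\mathbf{o}$ belongs to the (a.s. unique) bi-infinite directed path of $\mathbf{T}$. Let $S_0=0$, $S_n=\sum_{k=0}^{n-1}X_k$ for $n\ge1$, $c=\mathbb{P}[S_n=-1\text{ for some }n>0]$, and for $k\ge0$ $$\tilde\pi(k)=c^{k-1}\,\mathbb{P}[X_0=k-1],\qquad \bar\pi(k)=c^{k}\,\mathbb{P}[X_0\ge k].$$ Then $[\mathbf{T}',\mathbf{o}',t']$ is a bi-variate ECS ordered marked Eternal Kesten Tree $MEKT(\bar\pi,\tilde\pi)$ whose marked bush of the root $[\hat{\mathbf{T}}_0,\hat{\mathbf{o}}_0,m_0]$ has the following distribution: (i) the number of children $d_1(\hat{\mathbf{o}}_0)$ of $\hat{\mathbf{o}}_0$ in $\hat{\mathbf T}_0$ has distribution $\bar\pi$; the descendant trees of the children of $\hat{\mathbf{o}}_0$ are i.i.d. Galton-Watson trees with offspring distribution $\tilde\pi$, independent of $d_1(\hat{\mathbf{o}}_0)$; (ii) the mark of every vertex other than $\hat{\mathbf{o}}_0$ is $-1$; (iii)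 the mark of $\hat{\mathbf{o}}_0$ is independent of the descendant subtrees of the children of $\hat{\mathbf{o}}_0$, in the sense that the conditional law of $m_0(\hat{\mathbf{o}}_0)$ given $[\hat{\mathbf{T}}_0,\hat{\mathbf{o}}_0]$ equals its conditional law given $d_1(\hat{\mathbf{o}}_0)$; (iv) $\mathbb{P}[m_0(\hat{\mathbf{o}}_0)=n,\,d_1(\hat{\mathbf{o}}_0)=k]=\mathbb{P}[X_0=n+k]\,c^k$ for all $n\ge0$, $k\ge0$.
   Context: **Increments.** "I.i.d. increments of a skip-free to the left random walk" means: $X=(X_n)_{n\in\mathbb{Z}}$ is i.i.d., each $X_n$ takes values in $\{-1,0,1,2,\dots\}$, $\mathbb{P}[X_0=-1]>0$ and $\mathbb{E}[X_0]<\infty$. **Record graph and type.** For an integer-valued sequence $x$ put $y(m,j)=\sum_{l=m}^{j-1}x_l$ for $m\le j$. The record map is $R_x(i)=\inf\{j>i:y(i,j)\ge 0\}$ if the infimum exists and $R_x(i)=i$ otherwise. The record graph of $(\mathbb{Z},x)$ is the directed graph on $\mathbb{Z}$ with edges $(i,R_x(i))$ for all $i$ with $R_x(i)\ne i$. If $x_n\ge-1$ for all $n$, the type of $i\in\mathbb{Z}$ is $t_x(i)=\inf\{n\ge-1: y(m,i)=n\text{ for some }m<i\}$. **Family Trees.** A Family Tree is a locally finite directed tree in which each vertex has out-degree at most $1$ (edges point from child to parent); it is ordered if the children of every vertex are totally ordered. Rooted, ordered, $\mathbb{Z}$-marked Family Trees are considered up to isomorphisms preserving root, order and marks, with the Borel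 $\sigma$-algebra of the local topology. **$MEKT(\alpha,\beta)$.** Let $\alpha,\beta$ be probability distributions on $\{0,1,2,\dots\}$ with means $m(\alpha)<\infty$, $m(\beta)<1$. A bi-variate ECS ordered marked Eternal Kesten Tree $MEKT(\alpha,\beta)$ is a random rooted ordered marked Family Tree $[\mathbf{T}',\mathbf{o}',Z']$ obtained as follows from an i.i.d. sequence $([\mathbf{T}_i,\mathbf{o}_i,Z_i])_{i\in\mathbb{Z}}$ of random finite rooted ordered marked Family Trees, where, forgetting marks, $\mathbf{o}_i$ has no parent, its number of children has law $\alpha$, and the descendant trees of its children are i.i.d. ordered Galton-Watson trees with offspring distribution $\beta$, independent of the number of children of $\mathbf o_i$ (the order among children in each $\mathbf{T}_i$ being uniform): add a directed edge $(\mathbf{o}_i,\mathbf{o}_{i+1})$ for every $i\in\mathbb{Z}$, declare $\mathbf{o}_{i}$ to be the smallest child of $\mathbf{o}_{i+1}$, keep the marks, and set $\mathbf{o}'=\mathbf{o}_0$. The law of the marks $Z_i$ on $\mathbf{T}_i$ may depend on $\mathbf{T}_i$. The tree $[\mathbf{T}_0,\mathbf{o}_0,Z_0]$ is called the marked bush of the root; its law determines the law of $[\mathbf{T}',\mathbf{o}',Z']$. *)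

theory Defs
  imports "HOL-Probability.Probability"
begin

section \<open>Rooted, ordered, marked Family Trees\<close>

text \<open>
  Edges are pairs (child, parent), and \<open>sib\<close> is the strict order on the children of each vertex,
  relating siblings only.
\<close>

record 'v rtree =
  verts :: "'v set"
  edges :: "('v \<times> 'v) set"
  sib :: "('v \<times> 'v) set"
  root :: 'v
  mark :: "'v \<Rightarrow> int"

definition siblings :: "('v \<times> 'v) set \<Rightarrow> 'v \<Rightarrow> 'v \<Rightarrow> bool" where
  "siblings E u v \<longleftrightarrow> (\<exists>w. (u, w) \<in> E \<and> (v, w) \<in> E)"

text \<open>
  With out-degrees at most 1, every cycle of the underlying undirected graph is a directed cycle,
  so a connected graph of this kind is a tree iff its edge relation is acyclic; and local finiteness
  means that every vertex has finitely many children.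
\<close>

definition family_tree :: "'v rtree \<Rightarrow> bool" where
  "family_tree T \<longleftrightarrow>
     root T \<in> verts T \<and>
     edges T \<subseteq> verts T \<times> verts T \<and>
     single_valued (edges T) \<and>
     acyclic (edges T) \<and>
     (\<forall>u\<in>verts T. \<forall>v\<in>verts T. (u, v) \<in> (edges T \<union> (edges T)\<inverse>)\<^sup>*) \<and>
     (\<forall>v\<in>verts T. finite {u. (u, v) \<in> edges T}) \<and>
     (\<forall>(u, v)\<in>sib T. siblings (edges T) u v) \<and>
     (\<forall>w\<in>verts T. strict_linear_order_on {u. (u, w) \<in> edges T}
        (Restr (sib T) {u. (u, w) \<in> edges T}))"

definition rtree_iso :: "'v rtree \<Rightarrow> 'w rtree \<Rightarrow> bool" where
  "rtree_iso S T \<longleftrightarrow> (\<exists>f. bij_betw f (verts S) (verts T) \<and> f (root S) = root T \<and>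
     (\<forall>u\<in>verts S. mark T (f u) = mark S u) \<and>
     (\<forall>u\<in>verts S. \<forall>v\<in>verts S.
        ((u, v) \<in> edges S \<longleftrightarrow> (f u, f v) \<in> edges T) \<and>
        ((u, v) \<in> sib S \<longleftrightarrow> (f u, f v) \<in> sib T)))"

definition tree_ball :: "nat \<Rightarrow> 'v rtree \<Rightarrow> 'v rtree" where
  "tree_ball r T = (let B = {v. \<exists>k\<le>r. (root T, v) \<in> (edges T \<union> (edges T)\<inverse>) ^^ k} in
     T\<lparr>verts := B, edges := Restr (edges T) B, sib := Restr (sib T) B\<rparr>)"

lemma rtree_iso_refl: "rtree_iso T T"
  unfolding rtree_iso_def by (rule exI[of _ id]) auto

lemma rtree_iso_sym:
  assumes "root S \<in> verts S" "rtree_iso S T"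
  shows "rtree_iso T S"
proof -
  from assms(2) obtain f where f: "bij_betw f (verts S) (verts T)" "f (root S) = root T"
      "\<forall>u\<in>verts S. mark T (f u) = mark S u"
      "\<forall>u\<in>verts S. \<forall>v\<in>verts S. ((u, v) \<in> edges S \<longleftrightarrow> (f u, f v) \<in> edges T) \<and>
         ((u, v) \<in> sib S \<longleftrightarrow> (f u, f v) \<in> sib T)"
    unfolding rtree_iso_def by blast
  let ?g = "inv_into (verts S) f"
  have g: "?g v \<in> verts S" "f (?g v) = v" if "v \<in> verts T" for v
    using f(1) that by (auto simp: bij_betw_def inv_into_into f_inv_into_f)
  have "?g (root T) = root S"
    using f(1,2) assms(1) by (metis bij_betw_inv_into_left)
  moreover have "bij_betw ?g (verts T) (verts S)"
    using f(1) by (rule bij_betw_inv_into)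
  ultimately show ?thesis
    unfolding rtree_iso_def using f(3,4) g by (intro exI[of _ ?g]) metis
qed

lemma rtree_iso_trans:
  assumes "rtree_iso S T" "rtree_iso T U"
  shows "rtree_iso S U"
proof -
  from assms(1) obtain f where f: "bij_betw f (verts S) (verts T)" "f (root S) = root T"
      "\<forall>u\<in>verts S. mark T (f u) = mark S u"
      "\<forall>u\<in>verts S. \<forall>v\<in>verts S. ((u, v) \<in> edges S \<longleftrightarrow> (f u, f v) \<in> edges T) \<and>
         ((u, v) \<in> sib S \<longleftrightarrow> (f u, f v) \<in> sib T)"
    unfolding rtree_iso_def by blast
  from assms(2) obtain g where g: "bij_betw g (verts T) (verts U)" "g (root T) = root U"
      "\<forall>u\<in>verts T. mark U (g u) = mark T u"
      "\<forall>u\<in>verts T. \<forall>v\<in>verts T. ((u, v) \<in> edges T \<longleftrightarrow> (g u, g v) \<in> edges U) \<and>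
         ((u, v) \<in> sib T \<longleftrightarrow> (g u, g v) \<in> sib U)"
    unfolding rtree_iso_def by blast
  have fT: "f u \<in> verts T" if "u \<in> verts S" for u
    using f(1) that by (auto simp: bij_betw_def)
  have "bij_betw (g \<circ> f) (verts S) (verts U)"
    using f(1) g(1) by (rule bij_betw_trans)
  then show ?thesis
    unfolding rtree_iso_def using f(2-4) g(2-4) fT by (intro exI[of _ "g \<circ> f"]) simp
qed

text \<open>
  Isomorphism classes. Family Trees are countable, so every class has a representative whose
  vertices are natural numbers.
\<close>

quotient_type ftree = "nat rtree" / partial:
  "\<lambda>S T :: nat rtree. family_tree S \<and> family_tree T \<and> rtree_iso S T"
proof (rule part_equivpI)
  let ?T = "\<lparr>verts = {0}, edges = {}, sib = {}, root = 0, mark = \<lambda>_. 0\<rparr> :: nat rtree"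
  have "family_tree ?T"
    by (auto simp: family_tree_def single_valued_def acyclic_def strict_linear_order_on_def
        trans_def irrefl_def total_on_def)
  then show "\<exists>T :: nat rtree. family_tree T \<and> family_tree T \<and> rtree_iso T T"
    using rtree_iso_refl by blast
  show "symp (\<lambda>S T :: nat rtree. family_tree S \<and> family_tree T \<and> rtree_iso S T)"
    by (auto simp: symp_def family_tree_def intro: rtree_iso_sym)
  show "transp (\<lambda>S T :: nat rtree. family_tree S \<and> family_tree T \<and> rtree_iso S T)"
    by (auto simp: transp_def intro: rtree_iso_trans)
qed

definition ftree_class :: "'v rtree \<Rightarrow> ftree" where
  "ftree_class T = abs_ftree (SOME S. family_tree S \<and> rtree_iso S T)"

text \<open>
  The local topology: the sets of classes sharing a given ball around the root form a base.
  Hence \<open>borel :: ftree measure\<close> is its Borel sigma-algebra.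
\<close>

instantiation ftree :: topological_space
begin

definition open_ftree :: "ftree set \<Rightarrow> bool" where
  "open_ftree = generate_topology (range (\<lambda>(r, t).
     {t'. rtree_iso (tree_ball r (rep_ftree t)) (tree_ball r (rep_ftree t'))}))"

instance
  using topological_space_generate_topology
  by intro_classes (auto simp: open_ftree_def class.topological_space_def)

end

text \<open>The range of a bi-infinite directed path; as edges form no cycles, the path is injective.\<close>

definition bi_infinite_path :: "'v rtree \<Rightarrow> 'v set \<Rightarrow> bool" where
  "bi_infinite_path T P \<longleftrightarrow>
     (\<exists>p :: int \<Rightarrow> 'v. P = range p \<and> (\<forall>n. (p n, p (n + 1)) \<in> edges T))"


section \<open>Record graph and type function\<close>

definition walk_sum :: "(int \<Rightarrow> int) \<Rightarrow> int \<Rightarrow> int \<Rightarrow> int" where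
  "walk_sum x m j = (\<Sum>l\<in>{m..<j}. x l)"

definition record_map :: "(int \<Rightarrow> int) \<Rightarrow> int \<Rightarrow> int" where
  "record_map x i =
     (if \<exists>j>i. walk_sum x i j \<ge> 0 then Inf {j. j > i \<and> walk_sum x i j \<ge> 0} else i)"

definition record_edges :: "(int \<Rightarrow> int) \<Rightarrow> (int \<times> int) set" where
  "record_edges x = {(i, record_map x i) | i. record_map x i \<noteq> i}"

definition type_fun :: "(int \<Rightarrow> int) \<Rightarrow> int \<Rightarrow> int" where
  "type_fun x i = Inf {n. n \<ge> - 1 \<and> (\<exists>m<i. walk_sum x m i = n)}"

definition record_tree :: "(int \<Rightarrow> int) \<Rightarrow> int rtree" where
  "record_tree x = (let V = {i. (0, i) \<in> (record_edges x \<union> (record_edges x)\<inverse>)\<^sup>*} in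
     \<lparr>verts = V,
      edges = Restr (record_edges x) V,
      sib = {(u, v). u \<in> V \<and> v \<in> V \<and> siblings (record_edges x) u v \<and> u < v},
      root = 0,
      mark = type_fun x\<rparr>)"


section \<open>Finite trees and Eternal Kesten Trees\<close>

text \<open>
  Finite rooted ordered marked Family Trees whose root has no parent; children are listed in
  increasing order. These are isolated points of the local topology, and there are countably many of
  them for countably many marks, so their distributions are probability mass functions.
\<close>

datatype 'm ptree = Node (root_mark: 'm) (children: "'m ptree list")

abbreviation unmark :: "'m ptree \<Rightarrow> unit ptree" where
  "unmark \<equiv> map_ptree (\<lambda>_. ())"

abbreviation num_children :: "'m ptree \<Rightarrow> nat" where
  "num_children t \<equiv> length (children t)"

text \<open>
  Vertices of a \<open>ptree\<close> are addressed by Ulam-Harris words: the empty word is the root, and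
  \<open>u @ [i]\<close> is the child of \<open>u\<close> with index \<open>i\<close>.
\<close>

fun subtree_at :: "'m ptree \<Rightarrow> nat list \<Rightarrow> 'm ptree option" where
  "subtree_at t [] = Some t"
| "subtree_at t (i # u) =
     (if i < num_children t then subtree_at (children t ! i) u else None)"

text \<open>
  The ordered Galton-Watson tree is built from i.i.d. offspring numbers \<open>N u\<close> indexed by
  Ulam-Harris words; it equals the finite tree \<open>t\<close> iff each vertex \<open>u\<close> of \<open>t\<close> has \<open>N u\<close> children.
  A law \<open>g\<close> on finite trees exists only if the Galton-Watson tree is a.s. finite.
\<close>

definition galton_watson_law :: "nat pmf \<Rightarrow> unit ptree pmf \<Rightarrow> bool" where
  "galton_watson_law \<beta> g \<longleftrightarrow> (\<forall>t. pmf g t =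
     measure (\<Pi>\<^sub>M u\<in>(UNIV :: nat list set). measure_pmf \<beta>)
       {N. \<forall>u s. subtree_at t u = Some s \<longrightarrow> num_children s = N u})"

definition bush_law :: "nat pmf \<Rightarrow> nat pmf \<Rightarrow> 'm ptree pmf \<Rightarrow> bool" where
  "bush_law \<alpha> \<beta> \<mu> \<longleftrightarrow> (\<exists>g. galton_watson_law \<beta> g \<and>
     map_pmf unmark \<mu> = bind_pmf \<alpha> (\<lambda>k. map_pmf (Node ()) (replicate_pmf k g)))"

text \<open>
  The vertex \<open>(n, u)\<close> is the vertex \<open>u\<close> of the bush \<open>b n\<close>. The root \<open>(n, [])\<close> of each bush becomes
  the smallest child of the root of the next one.
\<close>

definition join_bushes :: "(int \<Rightarrow> int ptree) \<Rightarrow> (int \<times> nat list) rtree" where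
  "join_bushes b = (let V = {(n, u). subtree_at (b n) u \<noteq> None} in
     \<lparr>verts = V,
      edges = {((n, u @ [i]), (n, u)) | n u i. (n, u @ [i]) \<in> V} \<union>
              {((n, []), (n + 1, [])) | n. True},
      sib = {((n, u @ [i]), (n, u @ [j])) | n u i j. (n, u @ [j]) \<in> V \<and> i < j} \<union>
            {((n, []), (n + 1, [i])) | n i. (n + 1, [i]) \<in> V},
      root = (0, []),
      mark = (\<lambda>(n, u). root_mark (the (subtree_at (b n) u)))\<rparr>)"

text \<open>
  \<open>\<nu>\<close> is the distribution of a bi-variate ECS ordered marked Eternal Kesten Tree with parameters
  \<open>\<alpha>\<close>, \<open>\<beta>\<close> whose marked bush of the root has distribution \<open>\<mu>\<close>.
\<close>

definition MEKT :: "nat pmf \<Rightarrow> nat pmf \<Rightarrow> int ptree pmf \<Rightarrow> ftree measure \<Rightarrow> bool" where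
  "MEKT \<alpha> \<beta> \<mu> \<nu> \<longleftrightarrow>
     (\<integral>\<^sup>+k. of_nat k \<partial>measure_pmf \<alpha>) < \<infinity> \<and>
     (\<integral>\<^sup>+k. of_nat k \<partial>measure_pmf \<beta>) < 1 \<and>
     bush_law \<alpha> \<beta> \<mu> \<and>
     (\<lambda>b. ftree_class (join_bushes b)) \<in> (\<Pi>\<^sub>M i\<in>(UNIV :: int set). measure_pmf \<mu>) \<rightarrow>\<^sub>M borel \<and>
     \<nu> = distr (\<Pi>\<^sub>M i\<in>(UNIV :: int set). measure_pmf \<mu>) borel (\<lambda>b. ftree_class (join_bushes b))"

end

theory Submission
  imports Defs
begin

text \<open>
  Call \<open>j\<close> a record if the walk has never been above its level at \<open>j\<close> before time \<open>j\<close>. Almost surely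
  the records are unbounded in both directions; they form the only bi-infinite path, and the record
  map takes each record to the next one. Between consecutive records \<open>i\<close> and \<open>j\<close>, the increments read
  backwards from \<open>j\<close> are the depth-first code of the bush of \<open>j\<close>: the first letter is the type of \<open>j\<close>
  plus the number of children in the bush, and every other vertex with \<open>d\<close> children contributes the
  letter \<open>d - 1\<close>. The probability of a finite window is the product of its letter probabilities, and
  the event that its left end is a record is independent of it. Given that \<open>0\<close> is a record, the bushes
  are therefore i.i.d. with the code weight as probability mass function. The weights of all finite
  trees sum to the probability \<open>c\<close> of ever reaching \<open>- 1\<close>, and dividing by \<open>c\<close> gives the
  Galton-Watson law.
\<close>

section \<open>The local topology and measurability of tree-valued maps\<close>


text \<open>The obstacle is that bushes are numbered from the record at 0 while the sites of the
  other records are random. Prescribing the bushes with indices \<open>1 - r\<close> to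
  \<open>0\<close> fixes the length of their codes, hence the site of the left end: the event
  becomes a statement about one deterministic site and one deterministic word. This also gives
  measurability of the bushes, whose definition uses choice. The constant \<open>c\<close> plays two
  roles because codes are prefix-free, every word up to the first passage to - 1 is a code, and
  reversing a word keeps its weight: so \<open>c\<close> is also the probability that a given site
  is not a record. The positive mean enters through exponential bounds and Borel-Cantelli, which
  yield records in both directions and thereby \<open>c < 1\<close>. Both \<open>c\<close> and 1 are
  then fixed points of the generating function of \<open>X 0 + 1\<close>; this normalises the law of
  a bush and, by strict convexity, makes the mean of the offspring law less than 1. As for tree
  classes, balls around the root are finite, so the generating Borel sets pull back to countable
  combinations of statements about single vertices, edges and marks.\<close>

definition wf_rtree :: "'v rtree \<Rightarrow> bool" where
  "wf_rtree T \<longleftrightarrow> root T \<in> verts T \<and> edges T \<subseteq> verts T \<times> verts T \<and> sib T \<subseteq> verts T \<times> verts T"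

lemma family_tree_wf: "family_tree T \<Longrightarrow> wf_rtree T"
  unfolding family_tree_def wf_rtree_def siblings_def by fastforce

text \<open>\<open>rtree_iso\<close> sees only pairs of vertices, so edges leaving the vertex set
  would be invisible to it; \<open>wf_rtree\<close> excludes them. The relations of \<open>T\<close>
  are then the exact images of those of \<open>S\<close> under an injection, and every clause of
  \<open>family_tree\<close> is transported.\<close>

lemma family_tree_iso:
  assumes S: "family_tree S" and iso: "rtree_iso S T" and T: "wf_rtree T"
  shows "family_tree T"
proof -
  from iso obtain f where bij: "bij_betw f (verts S) (verts T)" and root: "f (root S) = root T"
    and mark: "\<And>u. u \<in> verts S \<Longrightarrow> mark T (f u) = mark S u"
    and ed: "\<And>u v. u \<in> verts S \<Longrightarrow> v \<in> verts S \<Longrightarrow> (f u, f v) \<in> edges T \<longleftrightarrow> (u, v) \<in> edges S"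
    and sb: "\<And>u v. u \<in> verts S \<Longrightarrow> v \<in> verts S \<Longrightarrow> (f u, f v) \<in> sib T \<longleftrightarrow> (u, v) \<in> sib S"
    unfolding rtree_iso_def by metis
  have im: "verts T = f ` verts S" and inj: "inj_on f (verts S)"
    using bij by (auto simp: bij_betw_def)
  have subS: "edges S \<subseteq> verts S \<times> verts S" "sib S \<subseteq> verts S \<times> verts S"
    using family_tree_wf[OF S] by (auto simp: wf_rtree_def)
  have subT: "edges T \<subseteq> verts T \<times> verts T" "sib T \<subseteq> verts T \<times> verts T"
    using T by (auto simp: wf_rtree_def)
  have eT: "edges T = map_prod f f ` edges S"
  proof (intro equalityI subrelI)
    fix a b assume ab: "(a, b) \<in> edges T"
    then obtain u v where "a = f u" "b = f v" "u \<in> verts S" "v \<in> verts S"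
      using subT(1) im by blast
    then show "(a, b) \<in> map_prod f f ` edges S" using ab ed by auto
  qed (use subS(1) ed in auto)
  have sT: "sib T = map_prod f f ` sib S"
  proof (intro equalityI subrelI)
    fix a b assume ab: "(a, b) \<in> sib T"
    then obtain u v where "a = f u" "b = f v" "u \<in> verts S" "v \<in> verts S"
      using subT(2) im by blast
    then show "(a, b) \<in> map_prod f f ` sib S" using ab sb by auto
  qed (use subS(2) sb in auto)
  have inj': "f u = f v \<longleftrightarrow> u = v" if "u \<in> verts S" "v \<in> verts S" for u v
    using inj that by (auto simp: inj_on_def)
  have "root T \<in> verts T" using T by (simp add: wf_rtree_def)
  moreover have "single_valued (edges T)"
  proof (rule single_valuedI)
    fix a b c assume "(a, b) \<in> edges T" "(a, c) \<in> edges T"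
    then obtain u v u' w where *: "a = f u" "b = f v" "a = f u'" "c = f w"
      "(u, v) \<in> edges S" "(u', w) \<in> edges S" unfolding eT by (elim imageE) (auto; metis)
    then have "u = u'" using subS(1) inj' by auto
    moreover have "single_valued (edges S)" using S by (simp add: family_tree_def)
    ultimately show "b = c" using * by (metis single_valuedD)
  qed
  moreover have "acyclic (edges T)"
  proof -
    define g where "g = inv_into (verts S) f"
    have g: "g (f u) = u" if "u \<in> verts S" for u using inj that by (simp add: g_def)
    have "(g a, g b) \<in> (edges S)\<^sup>+" if "(a, b) \<in> (edges T)\<^sup>+" for a b
      using that
    proof induction
      case (base b)
      then show ?case using subS(1) g by (auto simp: eT)
    next
      case (step b c)
      then have "(g b, g c) \<in> edges S" using subS(1) g by (auto simp: eT)
      with step.IH show ?case by (rule trancl_into_trancl)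
    qed
    then show ?thesis using S unfolding family_tree_def acyclic_def by blast
  qed
  moreover have "(a, b) \<in> (edges T \<union> (edges T)\<inverse>)\<^sup>*" if "a \<in> verts T" "b \<in> verts T" for a b
  proof -
    from that obtain u v where uv: "a = f u" "b = f v" "u \<in> verts S" "v \<in> verts S"
      unfolding im by blast
    then have "(u, v) \<in> (edges S \<union> (edges S)\<inverse>)\<^sup>*" using S by (auto simp: family_tree_def)
    then have "(f u, f v) \<in> (edges T \<union> (edges T)\<inverse>)\<^sup>*"
    proof induction
      case (step v w)
      then have "(f v, f w) \<in> edges T \<union> (edges T)\<inverse>" by (auto simp: eT)
      with step.IH show ?case by (rule rtrancl_into_rtrancl)
    qed simp
    then show ?thesis by (simp add: uv)
  qed
  moreover have ch: "{a. (a, f v) \<in> edges T} = f ` {u. (u, v) \<in> edges S}" if "v \<in> verts S" for v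
    using subS(1) inj' that unfolding eT by auto
  then have "finite {a. (a, b) \<in> edges T}" if "b \<in> verts T" for b
    using that S by (auto simp: im family_tree_def)
  moreover have "siblings (edges T) a b" if "(a, b) \<in> sib T" for a b
    using that S unfolding sT eT siblings_def family_tree_def by fastforce
  moreover have "strict_linear_order_on {a. (a, b) \<in> edges T} (Restr (sib T) {a. (a, b) \<in> edges T})"
    if bT: "b \<in> verts T" for b
  proof -
    obtain w where w: "b = f w" "w \<in> verts S" using bT unfolding im by blast
    define C where "C = {u. (u, w) \<in> edges S}"
    have C: "C \<subseteq> verts S" using subS(1) by (auto simp: C_def)
    have lin: "strict_linear_order_on C (Restr (sib S) C)"
      using S w by (auto simp: family_tree_def C_def)
    have R: "Restr (sib T) (f ` C) = map_prod f f ` Restr (sib S) C"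
    proof (intro equalityI subrelI)
      fix a b assume "(a, b) \<in> Restr (sib T) (f ` C)"
      then obtain u v where "a = f u" "b = f v" "u \<in> C" "v \<in> C" "(a, b) \<in> sib T" by blast
      moreover from this have "(u, v) \<in> Restr (sib S) C" using C sb by blast
      ultimately show "(a, b) \<in> map_prod f f ` Restr (sib S) C" by force
    qed (use C sb in auto)
    have "trans (map_prod f f ` Restr (sib S) C)"
    proof (rule transI)
      fix a b c assume "(a, b) \<in> map_prod f f ` Restr (sib S) C" "(b, c) \<in> map_prod f f ` Restr (sib S) C"
      then obtain u v v' w where *: "a = f u" "b = f v" "b = f v'" "c = f w"
        "(u, v) \<in> Restr (sib S) C" "(v', w) \<in> Restr (sib S) C" by (elim imageE) (auto; metis)
      then have "v = v'" using C inj' by auto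
      moreover have "trans (Restr (sib S) C)" using lin by (simp add: strict_linear_order_on_def)
      ultimately have "(u, w) \<in> Restr (sib S) C" using *(5,6) by (auto dest: transD)
      then show "(a, c) \<in> map_prod f f ` Restr (sib S) C" using * by force
    qed
    moreover have "irrefl (map_prod f f ` Restr (sib S) C)"
    proof -
      have "u = v" if "f u = f v" "u \<in> C" "v \<in> C" for u v using inj' C that by blast
      then show ?thesis using lin unfolding strict_linear_order_on_def irrefl_def by fastforce
    qed
    moreover have "total_on (f ` C) (map_prod f f ` Restr (sib S) C)"
      using lin by (auto simp: strict_linear_order_on_def total_on_def) (metis IntI SigmaI map_prod_imageI)
    ultimately have "strict_linear_order_on (f ` C) (Restr (sib T) (f ` C))"
      unfolding R strict_linear_order_on_def by blast
    moreover have "{a. (a, b) \<in> edges T} = f ` C" using ch[OF w(2)] w by (simp add: C_def)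
    ultimately show ?thesis by simp
  qed
  ultimately show ?thesis unfolding family_tree_def using subT(1) by blast
qed

lemma nat_rtree_exists:
  fixes T :: "'v :: countable rtree"
  assumes "wf_rtree T"
  shows "\<exists>S :: nat rtree. wf_rtree S \<and> rtree_iso S T"
proof -
  define S where "S = \<lparr>verts = to_nat ` verts T, edges = map_prod to_nat to_nat ` edges T,
    sib = map_prod to_nat to_nat ` sib T, root = to_nat (root T), mark = \<lambda>n. mark T (from_nat n)\<rparr>"
  have "wf_rtree S" using assms by (auto simp: S_def wf_rtree_def)
  moreover have "bij_betw (from_nat :: nat \<Rightarrow> 'v) (to_nat ` verts T) (verts T)"
    by (rule bij_betw_byWitness[where f' = to_nat]) auto
  then have "rtree_iso S T"
    unfolding rtree_iso_def S_def by (intro exI[of _ from_nat]) (force simp: image_iff)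
  ultimately show ?thesis by blast
qed

lemma family_tree_rep_ftree: "family_tree (rep_ftree t)"
  using Quotient3_rep_reflp[OF Quotient3_ftree] by blast

lemma rep_abs_ftree: "family_tree S \<Longrightarrow> rtree_iso (rep_ftree (abs_ftree S)) S"
  using Quotient3_rep_abs[OF Quotient3_ftree, of S] rtree_iso_refl by blast

text \<open>The choice in \<open>ftree_class\<close> has a witness: a countable vertex type embeds
  into the naturals, and the copy inherits \<open>family_tree\<close>.\<close>

lemma rep_ftree_class:
  fixes T :: "'v :: countable rtree"
  assumes "family_tree T"
  shows "rtree_iso (rep_ftree (ftree_class T)) T"
proof -
  obtain S :: "nat rtree" where S: "wf_rtree S" "rtree_iso S T"
    using nat_rtree_exists[OF family_tree_wf[OF assms]] by blast
  have "rtree_iso T S" using S(1) by (intro rtree_iso_sym[OF _ S(2)]) (simp add: wf_rtree_def)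
  then have "family_tree S" using S(1) by (intro family_tree_iso[OF assms])
  then have "family_tree S \<and> rtree_iso S T" using S(2) by blast
  note * = someI[of "\<lambda>S. family_tree S \<and> rtree_iso S T", OF this]
  show ?thesis unfolding ftree_class_def
    by (rule rtree_iso_trans[OF rep_abs_ftree[OF conjunct1[OF *]] conjunct2[OF *]])
qed

text \<open>Outside the Family Trees \<open>ftree_class\<close> takes one fixed default value, so
  its measurability can be checked by cases.\<close>

lemma ftree_class_junk:
  assumes "wf_rtree T" "\<not> family_tree T"
  shows "ftree_class T = abs_ftree (SOME S. False)"
proof -
  have "\<not> (family_tree S \<and> rtree_iso S T)" for S :: "nat rtree"
    using family_tree_iso assms by blast
  then have "(\<lambda>S :: nat rtree. family_tree S \<and> rtree_iso S T) = (\<lambda>S. False)" by blast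
  then show ?thesis unfolding ftree_class_def by simp
qed

lemma ftree_class_cong:
  assumes "root S \<in> verts S" "rtree_iso S T"
  shows "ftree_class S = ftree_class T"
proof -
  have "rtree_iso U S \<longleftrightarrow> rtree_iso U T" for U :: "nat rtree"
    using rtree_iso_trans[OF _ assms(2), of U] rtree_iso_trans[OF _ rtree_iso_sym[OF assms], of U] by blast
  then have "(\<lambda>U :: nat rtree. family_tree U \<and> rtree_iso U S) = (\<lambda>U. family_tree U \<and> rtree_iso U T)"
    by simp
  then show ?thesis unfolding ftree_class_def by simp
qed

section \<open>Balls around the root and a countable base of the local topology\<close>

lemma tree_ball_simps:
  "verts (tree_ball r T) = {v. \<exists>k\<le>r. (root T, v) \<in> (edges T \<union> (edges T)\<inverse>) ^^ k}"
  "edges (tree_ball r T) = Restr (edges T) (verts (tree_ball r T))"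
  "sib (tree_ball r T) = Restr (sib T) (verts (tree_ball r T))"
  "root (tree_ball r T) = root T"
  "mark (tree_ball r T) = mark T"
  by (simp_all add: tree_ball_def Let_def)

lemma verts_tree_ball_subset:
  assumes "wf_rtree T"
  shows "verts (tree_ball r T) \<subseteq> verts T"
proof -
  have "(root T, v) \<in> (edges T \<union> (edges T)\<inverse>) ^^ k \<Longrightarrow> v \<in> verts T" for k v
    using assms by (induction k arbitrary: v) (auto simp: wf_rtree_def)
  then show ?thesis by (auto simp: tree_ball_simps)
qed

text \<open>Walks of length \<open>k\<close> from the root correspond under the isomorphism, by
  induction on \<open>k\<close>; well-formedness keeps their endpoints among the vertices, where the
  isomorphism is defined.\<close>

lemma tree_ball_iso:
  assumes iso: "rtree_iso S T" and S: "wf_rtree S" and T: "wf_rtree T"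
  shows "rtree_iso (tree_ball r S) (tree_ball r T)"
proof -
  from iso obtain f where bij: "bij_betw f (verts S) (verts T)" and root: "f (root S) = root T"
    and mark: "\<And>u. u \<in> verts S \<Longrightarrow> mark T (f u) = mark S u"
    and ed: "\<And>u v. u \<in> verts S \<Longrightarrow> v \<in> verts S \<Longrightarrow> (f u, f v) \<in> edges T \<longleftrightarrow> (u, v) \<in> edges S"
    and sb: "\<And>u v. u \<in> verts S \<Longrightarrow> v \<in> verts S \<Longrightarrow> (f u, f v) \<in> sib T \<longleftrightarrow> (u, v) \<in> sib S"
    unfolding rtree_iso_def by metis
  have im: "verts T = f ` verts S" and inj: "inj_on f (verts S)"
    using bij by (auto simp: bij_betw_def)
  have k: "{v. (root T, v) \<in> (edges T \<union> (edges T)\<inverse>) ^^ k} =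
      f ` {v. (root S, v) \<in> (edges S \<union> (edges S)\<inverse>) ^^ k} \<and>
      {v. (root S, v) \<in> (edges S \<union> (edges S)\<inverse>) ^^ k} \<subseteq> verts S" for k
  proof (induction k)
    case (Suc k)
    let ?A = "{v. (root S, v) \<in> (edges S \<union> (edges S)\<inverse>) ^^ k}"
    have "{v. (root T, v) \<in> (edges T \<union> (edges T)\<inverse>) ^^ Suc k} =
        (edges T \<union> (edges T)\<inverse>) `` {v. (root T, v) \<in> (edges T \<union> (edges T)\<inverse>) ^^ k}" by auto
    also have "\<dots> = (edges T \<union> (edges T)\<inverse>) `` (f ` ?A)" using Suc by simp
    also have "\<dots> = f ` ((edges S \<union> (edges S)\<inverse>) `` ?A)"
    proof (intro equalityI subsetI)
      fix b assume "b \<in> (edges T \<union> (edges T)\<inverse>) `` (f ` ?A)"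
      then obtain u where u: "u \<in> ?A" "(f u, b) \<in> edges T \<or> (b, f u) \<in> edges T" by auto
      then obtain v where v: "b = f v" "v \<in> verts S" using T im by (auto simp: wf_rtree_def)
      moreover have "u \<in> verts S" using u(1) Suc by blast
      ultimately have "v \<in> (edges S \<union> (edges S)\<inverse>) `` ?A" using u ed by auto
      then show "b \<in> f ` ((edges S \<union> (edges S)\<inverse>) `` ?A)" using v by blast
    next
      fix b assume "b \<in> f ` ((edges S \<union> (edges S)\<inverse>) `` ?A)"
      then show "b \<in> (edges T \<union> (edges T)\<inverse>) `` (f ` ?A)" using S ed by (auto simp: wf_rtree_def)
    qed
    finally show ?case using S by (auto simp: wf_rtree_def)
  qed (use root S in \<open>auto simp: wf_rtree_def\<close>)
  have ball_UN: "verts (tree_ball r U) =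
    (\<Union>k\<in>{..r}. {v. (root U, v) \<in> (edges U \<union> (edges U)\<inverse>) ^^ k})" for U :: "'x rtree"
    by (auto simp: tree_ball_simps)
  have im_ball: "verts (tree_ball r T) = f ` verts (tree_ball r S)"
    unfolding ball_UN image_UN using k by simp
  note sub = verts_tree_ball_subset[OF S, of r]
  have "bij_betw f (verts (tree_ball r S)) (verts (tree_ball r T))"
    using inj_on_subset[OF inj sub] im_ball by (simp add: bij_betw_def)
  moreover have "u \<in> verts S" if "u \<in> verts (tree_ball r S)" for u using sub that by blast
  ultimately show ?thesis
    unfolding rtree_iso_def tree_ball_simps(2-5)
    using root mark ed sb im_ball by (intro exI[of _ f]) auto
qed

text \<open>Each vertex has finitely many children and at most one parent, so finitely many
  neighbours.\<close>

lemma finite_tree_ball: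
  assumes "family_tree T"
  shows "finite (verts (tree_ball r T))"
proof -
  have nb: "finite {u. (v, u) \<in> edges T \<union> (edges T)\<inverse>}" for v
  proof -
    have "{u. (v, u) \<in> edges T} \<subseteq> {THE u. (v, u) \<in> edges T}"
      using assms by (auto simp: family_tree_def single_valued_def intro!: the_equality[symmetric])
    then have "finite {u. (v, u) \<in> edges T}" by (rule finite_subset) simp
    moreover have "finite {u. (u, v) \<in> edges T}"
    proof (cases "v \<in> verts T")
      case False
      then have "{u. (u, v) \<in> edges T} = {}" using assms by (auto simp: family_tree_def)
      then show ?thesis by (metis finite.emptyI)
    qed (use assms in \<open>auto simp: family_tree_def\<close>)
    ultimately show ?thesis by (simp add: Collect_disj_eq)
  qed
  have "finite {v. (root T, v) \<in> (edges T \<union> (edges T)\<inverse>) ^^ k}" for k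
  proof (induction k)
    case (Suc k)
    have "{v. (root T, v) \<in> (edges T \<union> (edges T)\<inverse>) ^^ Suc k} =
      (\<Union>v\<in>{v. (root T, v) \<in> (edges T \<union> (edges T)\<inverse>) ^^ k}. {u. (v, u) \<in> edges T \<union> (edges T)\<inverse>})"
      by auto
    then show ?case using Suc nb by simp
  qed simp
  moreover have "verts (tree_ball r T) =
    (\<Union>k\<in>{..r}. {v. (root T, v) \<in> (edges T \<union> (edges T)\<inverse>) ^^ k})"
    by (auto simp: tree_ball_simps)
  ultimately show ?thesis by simp
qed

text \<open>A base set of the local topology, indexed by an arbitrary natural-number tree instead of
  by a class: this admits the finite descriptions used for countability.\<close>

definition ball_class :: "nat \<Rightarrow> nat rtree \<Rightarrow> ftree set" where
  "ball_class r B = {t. rtree_iso B (tree_ball r (rep_ftree t))}"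

text \<open>A ball is finite, hence described up to isomorphism by finitely many numbers stored in
  lists.\<close>

lemma countable_ball_classes:
  "countable (range (\<lambda>(r, t). ball_class r (tree_ball r (rep_ftree t))))"
proof -
  \<comment> \<open>Marks are stored for the listed vertices only; elsewhere the value is
    unspecified, which \<open>rtree_iso\<close> never inspects.\<close>
  define tree :: "nat list \<times> (nat \<times> nat) list \<times> (nat \<times> nat) list \<times> nat \<times> (nat \<times> int) list \<Rightarrow> nat rtree"
    where "tree = (\<lambda>(vs, es, ss, r, ms). \<lparr>verts = set vs, edges = set es, sib = set ss, root = r,
      mark = \<lambda>v. the (map_of ms v)\<rparr>)"
  have "\<exists>k. ball_class r (tree_ball r (rep_ftree t)) = ball_class r (tree k)" for r t
  proof -
    let ?B = "tree_ball r (rep_ftree t)"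
    have fin: "finite (verts ?B)" by (intro finite_tree_ball family_tree_rep_ftree)
    have "finite (edges ?B)" "finite (sib ?B)"
      unfolding tree_ball_simps(2,3) using fin by auto
    with fin obtain vs es ss where *: "set vs = verts ?B" "set es = edges ?B" "set ss = sib ?B"
      by (metis finite_list)
    define k where "k = (vs, es, ss, root ?B, map (\<lambda>v. (v, mark ?B v)) vs)"
    have "mark (tree k) v = mark ?B v" if "v \<in> verts ?B" for v
      using that * by (simp add: tree_def k_def map_of_map_restrict)
    then have "rtree_iso ?B T \<longleftrightarrow> rtree_iso (tree k) T" for T :: "nat rtree"
      unfolding rtree_iso_def using * by (simp add: tree_def k_def)
    then show ?thesis unfolding ball_class_def by blast
  qed
  then have "range (\<lambda>(r, t). ball_class r (tree_ball r (rep_ftree t))) \<subseteq>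
      range (\<lambda>(r, k). ball_class r (tree k))" by fastforce
  then show ?thesis by (rule countable_subset) simp
qed

lemma open_ftree_eq: "open = generate_topology (range (\<lambda>(r, t). ball_class r (tree_ball r (rep_ftree t))))"
  by (simp add: open_ftree_def ball_class_def)

instance ftree :: second_countable_topology
  using open_ftree_eq countable_ball_classes by intro_classes blast

text \<open>By second countability the ball classes themselves generate the Borel sets, so
  measurability is tested one ball at a time.\<close>

lemma borel_ftree:
  "(borel :: ftree measure) = sigma UNIV (range (\<lambda>(r, t). ball_class r (tree_ball r (rep_ftree t))))"
  by (rule second_countable_borel_measurable[OF open_ftree_eq])

section \<open>Measurability through countable quantifiers\<close>

lemma pred_relpow:
  fixes R :: "'a \<Rightarrow> ('v :: countable \<times> 'v) set"
  assumes [measurable]: "\<And>u v. Measurable.pred N (\<lambda>\<omega>. (u, v) \<in> R \<omega>)"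
  shows "Measurable.pred N (\<lambda>\<omega>. (u, v) \<in> R \<omega> ^^ k)"
proof (induction k arbitrary: v)
  case (Suc k)
  note Suc[measurable]
  have "Measurable.pred N (\<lambda>\<omega>. \<exists>w. (u, w) \<in> R \<omega> ^^ k \<and> (w, v) \<in> R \<omega>)" by measurable
  then show ?case by (simp add: relcomp_unfold)
qed simp

text \<open>Reduces measurability of a tree-valued map to events about single vertices, edges,
  sibling pairs and marks. The values are only asked to be well-formed, since being a Family Tree is
  itself one of the measurable events.\<close>

lemma measurable_ftree_class:
  fixes T :: "'a \<Rightarrow> 'v :: countable rtree"
  assumes v [measurable]: "\<And>v. Measurable.pred N (\<lambda>\<omega>. v \<in> verts (T \<omega>))"
    and e [measurable]: "\<And>u v. Measurable.pred N (\<lambda>\<omega>. (u, v) \<in> edges (T \<omega>))"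
    and s [measurable]: "\<And>u v. Measurable.pred N (\<lambda>\<omega>. (u, v) \<in> sib (T \<omega>))"
    and r [measurable]: "\<And>v. Measurable.pred N (\<lambda>\<omega>. root (T \<omega>) = v)"
    and m [measurable]: "\<And>v n. Measurable.pred N (\<lambda>\<omega>. mark (T \<omega>) v = n)"
    and wf: "\<And>\<omega>. \<omega> \<in> space N \<Longrightarrow> wf_rtree (T \<omega>)"
  shows "(\<lambda>\<omega>. ftree_class (T \<omega>)) \<in> N \<rightarrow>\<^sub>M borel"
proof -
  let ?R = "\<lambda>\<omega>. edges (T \<omega>) \<union> (edges (T \<omega>))\<inverse>"
  have uE [measurable]: "Measurable.pred N (\<lambda>\<omega>. (u, v) \<in> ?R \<omega>)" for u v by simp
  note pred_relpow[where N = N and R = "\<lambda>\<omega>. edges (T \<omega>)", OF e, measurable]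
    pred_relpow[where N = N and R = ?R, OF uE, measurable]
  have ft [measurable]: "Measurable.pred N (\<lambda>\<omega>. family_tree (T \<omega>))"
  proof -
    \<comment> \<open>Only countable quantifiers remain: finiteness becomes a bound by a list,
      acyclicity and connectedness become statements about relation powers.\<close>
    have eq: "family_tree (T \<omega>) \<longleftrightarrow>
      (\<forall>u v w. (u, v) \<in> edges (T \<omega>) \<longrightarrow> (u, w) \<in> edges (T \<omega>) \<longrightarrow> v = w) \<and>
      (\<forall>u k. \<not> (u, u) \<in> edges (T \<omega>) ^^ Suc k) \<and>
      (\<forall>u v. u \<in> verts (T \<omega>) \<longrightarrow> v \<in> verts (T \<omega>) \<longrightarrow> (\<exists>k. (u, v) \<in> ?R \<omega> ^^ k)) \<and>
      (\<forall>v. v \<in> verts (T \<omega>) \<longrightarrow> (\<exists>us. \<forall>u. (u, v) \<in> edges (T \<omega>) \<longrightarrow> u \<in> set us)) \<and>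
      (\<forall>u v. (u, v) \<in> sib (T \<omega>) \<longrightarrow> (\<exists>w. (u, w) \<in> edges (T \<omega>) \<and> (v, w) \<in> edges (T \<omega>))) \<and>
      (\<forall>w. w \<in> verts (T \<omega>) \<longrightarrow>
        (\<forall>a b c. (a, w) \<in> edges (T \<omega>) \<and> (b, w) \<in> edges (T \<omega>) \<and> (c, w) \<in> edges (T \<omega>) \<and>
            (a, b) \<in> sib (T \<omega>) \<and> (b, c) \<in> sib (T \<omega>) \<longrightarrow> (a, c) \<in> sib (T \<omega>)) \<and>
        (\<forall>a. (a, w) \<in> edges (T \<omega>) \<longrightarrow> \<not> (a, a) \<in> sib (T \<omega>)) \<and>
        (\<forall>a b. (a, w) \<in> edges (T \<omega>) \<and> (b, w) \<in> edges (T \<omega>) \<and> a \<noteq> b \<longrightarrow>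
          (a, b) \<in> sib (T \<omega>) \<or> (b, a) \<in> sib (T \<omega>)))"
      if "\<omega> \<in> space N" for \<omega>
    proof -
      have "finite {u. (u, v) \<in> edges (T \<omega>)} \<longleftrightarrow> (\<exists>us. \<forall>u. (u, v) \<in> edges (T \<omega>) \<longrightarrow> u \<in> set us)" for v
      proof
        assume "finite {u. (u, v) \<in> edges (T \<omega>)}"
        then obtain us where "set us = {u. (u, v) \<in> edges (T \<omega>)}" by (metis finite_list)
        then show "\<exists>us. \<forall>u. (u, v) \<in> edges (T \<omega>) \<longrightarrow> u \<in> set us" by blast
      next
        assume "\<exists>us. \<forall>u. (u, v) \<in> edges (T \<omega>) \<longrightarrow> u \<in> set us"
        then obtain us where "{u. (u, v) \<in> edges (T \<omega>)} \<subseteq> set us" by auto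
        then show "finite {u. (u, v) \<in> edges (T \<omega>)}" by (rule finite_subset) simp
      qed
      moreover have "acyclic (edges (T \<omega>)) \<longleftrightarrow> (\<forall>u k. \<not> (u, u) \<in> edges (T \<omega>) ^^ Suc k)"
        unfolding acyclic_def trancl_power by (metis gr0_implies_Suc zero_less_Suc)
      moreover have "trans (Restr (sib (T \<omega>)) {u. (u, w) \<in> edges (T \<omega>)}) \<longleftrightarrow>
        (\<forall>a b c. (a, w) \<in> edges (T \<omega>) \<and> (b, w) \<in> edges (T \<omega>) \<and> (c, w) \<in> edges (T \<omega>) \<and>
            (a, b) \<in> sib (T \<omega>) \<and> (b, c) \<in> sib (T \<omega>) \<longrightarrow> (a, c) \<in> sib (T \<omega>))" for w
        unfolding trans_def by blast
      moreover have "irrefl (Restr (sib (T \<omega>)) {u. (u, w) \<in> edges (T \<omega>)}) \<longleftrightarrow>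
        (\<forall>a. (a, w) \<in> edges (T \<omega>) \<longrightarrow> \<not> (a, a) \<in> sib (T \<omega>))" for w
        unfolding irrefl_def by blast
      moreover have "total_on {u. (u, w) \<in> edges (T \<omega>)} (Restr (sib (T \<omega>)) {u. (u, w) \<in> edges (T \<omega>)}) \<longleftrightarrow>
        (\<forall>a b. (a, w) \<in> edges (T \<omega>) \<and> (b, w) \<in> edges (T \<omega>) \<and> a \<noteq> b \<longrightarrow>
          (a, b) \<in> sib (T \<omega>) \<or> (b, a) \<in> sib (T \<omega>))" for w
        unfolding total_on_def by blast
      ultimately show ?thesis
        using wf[OF that] unfolding family_tree_def strict_linear_order_on_def rtrancl_power
          single_valued_def wf_rtree_def siblings_def by (simp add: Ball_def)
    qed
    show ?thesis by (subst measurable_cong[OF eq]) (simp_all del: relpow.simps)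
  qed
  have ball [measurable]: "Measurable.pred N (\<lambda>\<omega>. v \<in> verts (tree_ball k (T \<omega>)))" for v k
  proof -
    have eq: "v \<in> verts (tree_ball k (T \<omega>)) \<longleftrightarrow> (\<exists>l w. l \<le> k \<and> root (T \<omega>) = w \<and> (w, v) \<in> ?R \<omega> ^^ l)" for \<omega>
      by (auto simp: tree_ball_simps)
    show ?thesis unfolding eq by measurable
  qed
  have iso: "Measurable.pred N (\<lambda>\<omega>. rtree_iso B (tree_ball k (T \<omega>)))"
    if fin: "finite (verts B)" and root: "root B \<in> verts B" for B :: "nat rtree" and k
  proof -
    \<comment> \<open>Functions between the vertex sets form too large a range for a quantifier. The
      finitely many vertices of \<open>B\<close> are natural numbers, so an isomorphism can be given
      by a list \<open>L\<close> that sends \<open>u\<close> to \<open>L ! u\<close>.\<close>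
    have "rtree_iso B (tree_ball k (T \<omega>)) \<longleftrightarrow>
      (\<exists>L :: 'v list. inj_on ((!) L) (verts B) \<and>
        (\<forall>v. v \<in> verts (tree_ball k (T \<omega>)) \<longleftrightarrow> v \<in> (!) L ` verts B) \<and> root (T \<omega>) = L ! root B \<and>
        (\<forall>u\<in>verts B. mark (T \<omega>) (L ! u) = mark B u) \<and>
        (\<forall>u\<in>verts B. \<forall>v\<in>verts B. ((u, v) \<in> edges B \<longleftrightarrow> (L ! u, L ! v) \<in> edges (T \<omega>)) \<and>
          ((u, v) \<in> sib B \<longleftrightarrow> (L ! u, L ! v) \<in> sib (T \<omega>))))" (is "?l = (\<exists>L. ?P L)") for \<omega>
    proof
      assume ?l
      then obtain f where f: "bij_betw f (verts B) (verts (tree_ball k (T \<omega>)))"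
        "f (root B) = root (T \<omega>)" "\<forall>u\<in>verts B. mark (T \<omega>) (f u) = mark B u"
        "\<forall>u\<in>verts B. \<forall>v\<in>verts B. ((u, v) \<in> edges B \<longleftrightarrow> (f u, f v) \<in> edges (tree_ball k (T \<omega>))) \<and>
          ((u, v) \<in> sib B \<longleftrightarrow> (f u, f v) \<in> sib (tree_ball k (T \<omega>)))"
        unfolding rtree_iso_def tree_ball_simps(4,5) by blast
      obtain n where n: "verts B \<subseteq> {..<n}" using fin finite_nat_iff_bounded by blast
      define L where "L = map f [0..<n]"
      have L: "L ! u = f u" if "u \<in> verts B" for u using n that by (auto simp: L_def)
      have f_in: "f u \<in> verts (tree_ball k (T \<omega>))" if "u \<in> verts B" for u
        using f(1) that by (auto simp: bij_betw_def)
      have im: "(!) L ` verts B = f ` verts B" using L by (intro image_cong) auto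
      have inj: "inj_on ((!) L) (verts B) \<longleftrightarrow> inj_on f (verts B)" using L by (intro inj_on_cong) auto
      have "?P L"
        unfolding im inj using f f_in L root by (simp add: bij_betw_def tree_ball_simps(2,3))
      then show "\<exists>L. ?P L" ..
    next
      assume "\<exists>L. ?P L"
      then obtain L where L: "?P L" ..
      then have "bij_betw ((!) L) (verts B) (verts (tree_ball k (T \<omega>)))"
        by (auto simp: bij_betw_def)
      then show ?l unfolding rtree_iso_def tree_ball_simps(2-5) using L
        by (intro exI[of _ "(!) L"]) (auto simp: tree_ball_simps(2-5))
    qed
    then show ?thesis by simp
  qed
  have "Measurable.pred N (\<lambda>\<omega>. ftree_class (T \<omega>) \<in> ball_class k (tree_ball k (rep_ftree t)))" for k t
  proof -
    let ?B = "tree_ball k (rep_ftree t)"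
    let ?t0 = "abs_ftree (SOME S. False)"
    have wfr: "wf_rtree (rep_ftree t')" for t' by (intro family_tree_wf family_tree_rep_ftree)
    have rootB: "root ?B \<in> verts ?B" by (auto simp: tree_ball_simps intro!: exI[of _ 0])
    \<comment> \<open>The ball of the representative may be replaced by the ball of the tree itself,
      which is isomorphic to it; off the Family Trees the answer is constant.\<close>
    have eq: "ftree_class (T \<omega>) \<in> ball_class k ?B \<longleftrightarrow>
      (if family_tree (T \<omega>) then rtree_iso ?B (tree_ball k (T \<omega>)) else ?t0 \<in> ball_class k ?B)"
      if \<omega>: "\<omega> \<in> space N" for \<omega>
    proof (cases "family_tree (T \<omega>)")
      case True
      have iso: "rtree_iso (tree_ball k (rep_ftree (ftree_class (T \<omega>)))) (tree_ball k (T \<omega>))"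
        by (intro tree_ball_iso rep_ftree_class True wfr wf \<omega>)
      then have "rtree_iso (tree_ball k (T \<omega>)) (tree_ball k (rep_ftree (ftree_class (T \<omega>))))"
        by (intro rtree_iso_sym[OF _ iso]) (auto simp: tree_ball_simps intro!: exI[of _ 0])
      with iso True show ?thesis unfolding ball_class_def by (auto intro: rtree_iso_trans)
    next
      case False
      then show ?thesis using ftree_class_junk[OF wf[OF \<omega>]] by simp
    qed
    have [measurable]: "Measurable.pred N (\<lambda>\<omega>. rtree_iso ?B (tree_ball k (T \<omega>)))"
      using rootB by (intro iso finite_tree_ball family_tree_rep_ftree)
    show ?thesis by (subst measurable_cong[OF eq]) simp_all
  qed
  then show ?thesis unfolding borel_ftree
    by (intro measurable_measure_of) (auto simp: pred_def vimage_def Int_def conj_commute)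
qed

section \<open>Records\<close>


lemma walk_sum_empty [simp]: "walk_sum x i i = 0"
  by (simp add: walk_sum_def)

lemma walk_sum_split:
  assumes "i \<le> k" "k \<le> j"
  shows "walk_sum x i j = walk_sum x i k + walk_sum x k j"
proof -
  have "{i..<j} = {i..<k} \<union> {k..<j}" using assms by auto
  then show ?thesis unfolding walk_sum_def by (simp add: sum.union_disjoint ivl_disj_int)
qed

lemma walk_sum_last: "i < j \<Longrightarrow> walk_sum x i j = walk_sum x i (j - 1) + x (j - 1)"
proof -
  assume "i < j"
  moreover have "{j - 1..<j} = {j - 1}" by auto
  then have "walk_sum x (j - 1) j = x (j - 1)" by (simp add: walk_sum_def)
  ultimately show ?thesis by (subst walk_sum_split[of i "j - 1" j]) auto
qed

lemma record_map_eqI: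
  assumes "i < j" "walk_sum x i j \<ge> 0" "\<And>k. i < k \<Longrightarrow> k < j \<Longrightarrow> walk_sum x i k < 0"
  shows "record_map x i = j"
proof -
  have "Inf {j. j > i \<and> walk_sum x i j \<ge> 0} = j"
    using assms by (intro cInf_eq_minimum) (auto simp: not_less[symmetric])
  then show ?thesis using assms unfolding record_map_def by auto
qed

lemma record_map_props:
  assumes "i < j" "walk_sum x i j \<ge> 0"
  shows "i < record_map x i" "record_map x i \<le> j" "walk_sum x i (record_map x i) \<ge> 0"
    "\<And>k. i < k \<Longrightarrow> k < record_map x i \<Longrightarrow> walk_sum x i k < 0"
proof -
  define P where "P n \<longleftrightarrow> walk_sum x i (i + 1 + int n) \<ge> 0" for n :: nat
  define n where "n = (LEAST n. P n)"
  have "P (nat (j - i - 1))" using assms by (simp add: P_def)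
  then have n: "P n" "n \<le> nat (j - i - 1)" "\<And>m. m < n \<Longrightarrow> \<not> P m"
    unfolding n_def by (auto intro: LeastI Least_le dest: not_less_Least)
  have less: "walk_sum x i k < 0" if "i < k" "k < i + 1 + int n" for k
    using n(3)[of "nat (k - i - 1)"] that by (simp add: P_def nat_less_iff)
  have eq: "record_map x i = i + 1 + int n"
    using n(1) less by (intro record_map_eqI) (auto simp: P_def)
  show "i < record_map x i" "record_map x i \<le> j" "walk_sum x i (record_map x i) \<ge> 0"
    "\<And>k. i < k \<Longrightarrow> k < record_map x i \<Longrightarrow> walk_sum x i k < 0"
    using eq n assms less by (auto simp: P_def)
qed

lemma record_map_neq_iff: "record_map x i \<noteq> i \<longleftrightarrow> (\<exists>j>i. walk_sum x i j \<ge> 0)"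
proof
  assume "record_map x i \<noteq> i"
  then show "\<exists>j>i. walk_sum x i j \<ge> 0" unfolding record_map_def by presburger
next
  assume "\<exists>j>i. walk_sum x i j \<ge> 0"
  then show "record_map x i \<noteq> i" using record_map_props(1)[of i _ x] by fastforce
qed

lemma record_edgesI: "record_map x i \<noteq> i \<Longrightarrow> j = record_map x i \<Longrightarrow> (i, j) \<in> record_edges x"
  by (auto simp: record_edges_def)

lemma record_edgesD:
  assumes "(i, j) \<in> record_edges x"
  shows "j = record_map x i" "i < j" "walk_sum x i j \<ge> 0"
    "\<And>k. i < k \<Longrightarrow> k < j \<Longrightarrow> walk_sum x i k < 0"
proof -
  have *: "j = record_map x i" "record_map x i \<noteq> i" using assms by (auto simp: record_edges_def)
  then obtain l where "l > i" "walk_sum x i l \<ge> 0" by (auto simp: record_map_neq_iff)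
  from record_map_props[OF this] * show "j = record_map x i" "i < j" "walk_sum x i j \<ge> 0"
    "\<And>k. i < k \<Longrightarrow> k < j \<Longrightarrow> walk_sum x i k < 0" by auto
qed

section \<open>Records and the bi-infinite path\<close>

definition past_record :: "(int \<Rightarrow> int) \<Rightarrow> int \<Rightarrow> bool" where
  "past_record x j \<longleftrightarrow> (\<forall>m<j. walk_sum x m j \<ge> 0)"

definition two_sided_records :: "(int \<Rightarrow> int) \<Rightarrow> bool" where
  "two_sided_records x \<longleftrightarrow> (\<forall>l. \<exists>j<l. past_record x j) \<and> (\<forall>l. \<exists>j>l. past_record x j)"

text \<open>Starts before \<open>i\<close> are not above the level at \<open>i\<close>, and starts
  strictly between \<open>i\<close> and \<open>j\<close> are below it. Since \<open>j\<close> is at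
  least as high as \<open>i\<close>, neither exceeds the level at \<open>j\<close>.\<close>

lemma past_record_record_edges:
  assumes "(i, j) \<in> record_edges x" "past_record x i"
  shows "past_record x j"
  unfolding past_record_def
proof (intro allI impI)
  fix m assume "m < j"
  note e = record_edgesD[OF assms(1)]
  consider "m < i" | "m = i" | "i < m" by linarith
  then show "0 \<le> walk_sum x m j"
  proof cases
    case 1
    then show ?thesis using e assms(2) walk_sum_split[of m i j x] by (auto simp: past_record_def)
  next
    case 3
    then show ?thesis using e(3) e(4)[of m] \<open>m < j\<close> walk_sum_split[of i m j x] by auto
  qed (use e in auto)
qed

text \<open>A record cannot be jumped over: the sum from \<open>i\<close> to the record
  \<open>j\<close> is already nonnegative.\<close>

lemma record_map_past_record:
  assumes "past_record x j" "i < j"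
  shows "(i, record_map x i) \<in> record_edges x" "record_map x i \<le> j"
proof -
  have "walk_sum x i j \<ge> 0" using assms by (auto simp: past_record_def)
  from record_map_props[OF assms(2) this] show "(i, record_map x i) \<in> record_edges x" "record_map x i \<le> j"
    by (auto intro: record_edgesI)
qed

lemma record_edges_reach_past_record:
  assumes "past_record x j" "i \<le> j"
  shows "(i, j) \<in> (record_edges x)\<^sup>*"
  using assms(2)
proof (induction "nat (j - i)" arbitrary: i rule: less_induct)
  case less
  show ?case
  proof (cases "i = j")
    case False
    with less.prems have "i < j" by simp
    note r = record_map_past_record[OF assms(1) this]
    have "(record_map x i, j) \<in> (record_edges x)\<^sup>*"
      using r record_edgesD(2)[OF r(1)] by (intro less.hyps) auto
    with r(1) show ?thesis by (rule converse_rtrancl_into_rtrancl)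
  qed simp
qed

text \<open>The record map leads every site to each later record, so 0 and \<open>i\<close> meet at
  a common one and the component of 0 is all of the integers.\<close>

lemma verts_record_tree:
  assumes "two_sided_records x"
  shows "verts (record_tree x) = UNIV" "edges (record_tree x) = record_edges x"
    "sib (record_tree x) = {(u, v). siblings (record_edges x) u v \<and> u < v}"
proof -
  have "(0, i) \<in> (record_edges x \<union> (record_edges x)\<inverse>)\<^sup>*" (is "_ \<in> ?S") for i
  proof -
    obtain j where j: "j > max 0 i" "past_record x j"
      using assms unfolding two_sided_records_def by blast
    have "(0, j) \<in> (record_edges x)\<^sup>*" "(i, j) \<in> (record_edges x)\<^sup>*"
      using j by (auto intro: record_edges_reach_past_record)
    then have "(0, j) \<in> ?S" "(j, i) \<in> ((record_edges x)\<inverse>)\<^sup>*"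
      by (auto simp: rtrancl_converse intro: rtrancl_mono[THEN subsetD, rotated])
    then have "(0, j) \<in> ?S" "(j, i) \<in> ?S"
      using rtrancl_mono[of "(record_edges x)\<inverse>" "record_edges x \<union> (record_edges x)\<inverse>"] by auto
    then show ?thesis by (rule rtrancl_trans)
  qed
  then have *: "{i. (0, i) \<in> (record_edges x \<union> (record_edges x)\<inverse>)\<^sup>*} = UNIV" by auto
  show "verts (record_tree x) = UNIV" "edges (record_tree x) = record_edges x"
    "sib (record_tree x) = {(u, v). siblings (record_edges x) u v \<and> u < v}"
    unfolding record_tree_def * by auto
qed

lemma int_step_mono:
  fixes p :: "int \<Rightarrow> int"
  assumes "\<And>n. p n < p (n + 1)"
  shows "strict_mono p" "\<exists>n. p n < l" "\<exists>n. p n > l"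
proof -
  have add: "p n + int k \<le> p (n + int k)" for n k
  proof (induction k)
    case (Suc k)
    then show ?case using assms[of "n + int k"] by (simp add: algebra_simps)
  qed simp
  show "strict_mono p"
  proof (rule strict_monoI)
    fix a b :: int assume "a < b"
    then show "p a < p b" using add[of a "nat (b - a)"] by simp
  qed
  have "p (- int (nat (p 0 - l + 1))) < l \<or> p 0 < l"
    using add[of "- int (nat (p 0 - l + 1))" "nat (p 0 - l + 1)"] by auto
  then show "\<exists>n. p n < l" by blast
  have "p (int (nat (l - p 0 + 1))) > l \<or> p 0 > l" using add[of 0 "nat (l - p 0 + 1)"] by auto
  then show "\<exists>n. p n > l" by blast
qed

lemma int_block:
  fixes p :: "int \<Rightarrow> int"
  assumes "\<And>n. p n < p (n + 1)"
  obtains n where "p (n - 1) < i" "i \<le> p n"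
proof -
  obtain a b where ab: "p a < i" "p b > i"
    using int_step_mono(2)[of p i] int_step_mono(3)[of p i] assms by blast
  then have "a < b" using int_step_mono(1)[of p, OF assms] by (metis less_trans strict_mono_less)
  define k where "k = (LEAST k. i \<le> p (a + int k))"
  have "i \<le> p (a + int (nat (b - a)))" using \<open>a < b\<close> ab by simp
  then have k: "i \<le> p (a + int k)" "\<And>m. m < k \<Longrightarrow> \<not> i \<le> p (a + int m)"
    unfolding k_def by (fact LeastI, auto dest: not_less_Least)
  obtain k' where k': "k = Suc k'" using k(1) ab(1) by (cases k) auto
  have "p (a + int k - 1) < i" using k(2)[of k'] by (simp add: k' not_le)
  then show thesis using k(1) that by blast
qed

text \<open>The path is unbounded in both directions, so each site lies in some jump
  \<open>p (k - 1) < m \<le> p k\<close>. Inside a jump the walk is below the level at its start,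
  and levels along the path do not decrease, so the vertices of the path are records. Conversely a
  record inside a jump can only be its endpoint, as it cannot be jumped over.\<close>

lemma bi_infinite_path_records:
  fixes p :: "int \<Rightarrow> int"
  assumes p: "\<And>n. (p n, p (n + 1)) \<in> record_edges x"
  shows "range p = Collect (past_record x)" "two_sided_records x"
proof -
  have lt: "p n < p (n + 1)" for n using record_edgesD(2)[OF p] .
  have pos: "walk_sum x (p n) (p (n + int k)) \<ge> 0" for n k
  proof (induction k)
    case (Suc k)
    have "p n \<le> p (n + int k)" using int_step_mono(1)[of p, OF lt] by (simp add: strict_mono_less_eq)
    then show ?case using Suc record_edgesD(3)[OF p, of "n + int k"] lt[of "n + int k"]
        walk_sum_split[of "p n" "p (n + int k)" "p (n + int k + 1)" x] by (simp add: algebra_simps)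
  qed simp
  have rec: "past_record x (p n)" for n unfolding past_record_def
  proof (intro allI impI)
    fix m assume m: "m < p n"
    obtain k where k: "p (k - 1) < m" "m \<le> p k" by (rule int_block[of p, OF lt])
    have "k \<le> n"
    proof (rule ccontr)
      assume "\<not> k \<le> n"
      then have "p n \<le> p (k - 1)" using int_step_mono(1)[of p, OF lt] by (simp add: strict_mono_less_eq)
      then show False using m k by simp
    qed
    then have 1: "walk_sum x (p k) (p n) \<ge> 0" "p k \<le> p n"
      using pos[of k "nat (n - k)"] int_step_mono(1)[of p, OF lt] by (simp_all add: strict_mono_less_eq)
    have "walk_sum x m (p k) \<ge> 0"
    proof (cases "m = p k")
      case False
      then show ?thesis using record_edgesD(3,4)[OF p, of "k - 1"] k
          walk_sum_split[of "p (k - 1)" m "p k" x] by fastforce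
    qed simp
    then show "0 \<le> walk_sum x m (p n)" using walk_sum_split[OF k(2) 1(2)] 1(1) by simp
  qed
  show "two_sided_records x" unfolding two_sided_records_def
    using rec int_step_mono(2)[of p] int_step_mono(3)[of p] lt by metis
  have "j \<in> range p" if j: "past_record x j" for j
  proof -
    obtain k where k: "p (k - 1) < j" "j \<le> p k" by (rule int_block[of p, OF lt])
    have "p k \<le> j" using record_map_past_record(2)[OF j k(1)] record_edgesD(1)[OF p, of "k - 1"] by simp
    then show ?thesis using k by auto
  qed
  then show "range p = Collect (past_record x)" using rec by auto
qed

text \<open>Take the last record \<open>i\<close> before \<open>j\<close>: its image is again a
  record, is at most \<open>j\<close>, and cannot lie strictly between, so it is
  \<open>j\<close>.\<close>

lemma prev_past_record:
  assumes "two_sided_records x" "past_record x j"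
  shows "\<exists>i. past_record x i \<and> (i, j) \<in> record_edges x"
proof -
  define P where "P k \<longleftrightarrow> past_record x (j - 1 - int k)" for k :: nat
  define k where "k = (LEAST k. P k)"
  obtain l where "l < j" "past_record x l" using assms(1) unfolding two_sided_records_def by blast
  then have "P (nat (j - 1 - l))" by (simp add: P_def)
  then have k: "P k" "\<And>m. m < k \<Longrightarrow> \<not> P m"
    unfolding k_def by (auto intro: LeastI dest: not_less_Least)
  define i where "i = j - 1 - int k"
  have i: "past_record x i" "i < j" using k by (auto simp: P_def i_def)
  note r = record_map_past_record[OF assms(2) i(2)]
  have "past_record x (record_map x i)" using past_record_record_edges[OF r(1) i(1)] .
  then have "\<not> nat (j - 1 - record_map x i) < k" if "record_map x i < j"
    using k(2)[of "nat (j - 1 - record_map x i)"] that by (auto simp: P_def)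
  moreover have "nat (j - 1 - record_map x i) < k" if "record_map x i < j"
    using record_edgesD(2)[OF r(1)] that by (simp add: nat_less_iff i_def)
  ultimately have "\<not> record_map x i < j" by blast
  with r have "record_map x i = j" by simp
  with r i show ?thesis by auto
qed

text \<open>Enumerates the records, with index 0 at site 0. Backward steps choose a record that is
  mapped to the current one, because the other children of a record must be avoided.\<close>

definition record_seq :: "(int \<Rightarrow> int) \<Rightarrow> int \<Rightarrow> int" where
  "record_seq x n = (if n \<ge> 0 then (record_map x ^^ nat n) 0
     else ((\<lambda>j. SOME i. past_record x i \<and> (i, j) \<in> record_edges x) ^^ nat (- n)) 0)"

lemma record_seq_0 [simp]: "record_seq x 0 = 0"
  by (simp add: record_seq_def)

lemma record_seq:
  assumes "two_sided_records x" "past_record x 0"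
  shows "(record_seq x n, record_seq x (n + 1)) \<in> record_edges x"
proof -
  let ?prev = "\<lambda>j. SOME i. past_record x i \<and> (i, j) \<in> record_edges x"
  have prev: "past_record x (?prev j) \<and> (?prev j, j) \<in> record_edges x" if "past_record x j" for j
    using someI_ex[OF prev_past_record[OF assms(1) that]] .
  have nxt: "(j, record_map x j) \<in> record_edges x" for j
    using assms(1) record_map_past_record(1) unfolding two_sided_records_def by blast
  have pos: "past_record x ((record_map x ^^ k) 0)" for k
    by (induction k) (use assms(2) past_record_record_edges[OF nxt] in auto)
  have neg: "past_record x ((?prev ^^ k) 0)" for k
    by (induction k) (use assms(2) prev in auto)
  show ?thesis
  proof (cases "n \<ge> 0")
    case True
    then have "nat (n + 1) = Suc (nat n)" by simp
    then show ?thesis using True nxt by (simp add: record_seq_def)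
  next
    case False
    then obtain k where n: "n = - int (Suc k)" by (cases n) auto
    have "nat (- n) = Suc k" using n by simp
    then have "record_seq x n = ?prev ((?prev ^^ k) 0)" using n by (simp add: record_seq_def)
    moreover have "record_seq x (n + 1) = (?prev ^^ k) 0"
      using n by (cases k) (simp_all add: record_seq_def nat_add_distrib)
    ultimately show ?thesis using prev[OF neg] by simp
  qed
qed

lemma bi_infinite_path_record_tree:
  assumes "two_sided_records x"
  shows "bi_infinite_path (record_tree x) P \<longleftrightarrow> P = Collect (past_record x)"
proof
  assume "bi_infinite_path (record_tree x) P"
  then obtain p :: "int \<Rightarrow> int" where p: "P = range p" "\<And>n. (p n, p (n + 1)) \<in> record_edges x"
    unfolding bi_infinite_path_def verts_record_tree[OF assms] by auto
  then show "P = Collect (past_record x)" using bi_infinite_path_records(1)[of p x] by simp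
next
  assume P: "P = Collect (past_record x)"
  obtain r where r: "past_record x r" using assms unfolding two_sided_records_def by blast
  \<comment> \<open>\<open>record_seq\<close> starts at site 0, so the walk is shifted to put the
    record \<open>r\<close> there.\<close>
  define y where "y l = x (l + r)" for l
  have ws: "walk_sum y i j = walk_sum x (i + r) (j + r)" for i j
    unfolding walk_sum_def y_def
    by (rule sum.reindex_bij_witness[of _ "\<lambda>l. l - r" "\<lambda>l. l + r"]) auto
  have pr: "past_record y j \<longleftrightarrow> past_record x (j + r)" for j
  proof
    show "past_record x (j + r)" if "past_record y j"
      unfolding past_record_def
    proof (intro allI impI)
      fix m assume "m < j + r"
      then have "walk_sum y (m - r) j \<ge> 0" using that by (auto simp: past_record_def)
      then show "0 \<le> walk_sum x m (j + r)" by (simp add: ws)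
    qed
  qed (auto simp: past_record_def ws)
  have "two_sided_records y"
    unfolding two_sided_records_def pr
  proof (intro conjI allI)
    fix l
    obtain j where "j < l + r" "past_record x j" using assms unfolding two_sided_records_def by blast
    then show "\<exists>j<l. past_record x (j + r)" by (intro exI[of _ "j - r"]) auto
    obtain j where "j > l + r" "past_record x j" using assms unfolding two_sided_records_def by blast
    then show "\<exists>j>l. past_record x (j + r)" by (intro exI[of _ "j - r"]) auto
  qed
  then have p: "(record_seq y n, record_seq y (n + 1)) \<in> record_edges y" for n
    using pr[of 0] r by (intro record_seq) auto
  define q where "q n = record_seq y n + r" for n
  have q: "(q n, q (n + 1)) \<in> record_edges x" for n
  proof -
    note e = record_edgesD[OF p[of n]]
    have "record_map x (q n) = q (n + 1)"
    proof (rule record_map_eqI)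
      fix k assume "q n < k" "k < q (n + 1)"
      then have "walk_sum y (record_seq y n) (k - r) < 0" by (intro e(4)) (auto simp: q_def)
      then show "walk_sum x (q n) k < 0" by (simp add: ws q_def)
    qed (use e in \<open>auto simp: q_def ws\<close>)
    then show ?thesis using e(2) by (intro record_edgesI) (auto simp: q_def)
  qed
  show "bi_infinite_path (record_tree x) P"
    unfolding bi_infinite_path_def verts_record_tree[OF assms] P
    using q bi_infinite_path_records(1)[of q x] by (intro exI[of _ q]) auto
qed

text \<open>Pointwise, with no exceptional set: a bi-infinite path through the root alone forces
  \<open>two_sided_records\<close>. This identifies the conditioning event of the theorem with
  \<open>spine_event\<close>.\<close>

lemma root_in_bi_infinite_path_iff:
  "(\<exists>P. bi_infinite_path (record_tree x) P \<and> root (record_tree x) \<in> P) \<longleftrightarrow>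
     two_sided_records x \<and> past_record x 0"
proof
  have root: "root (record_tree x) = 0" by (simp add: record_tree_def Let_def)
  assume "\<exists>P. bi_infinite_path (record_tree x) P \<and> root (record_tree x) \<in> P"
  then obtain p :: "int \<Rightarrow> int" where p: "\<And>n. (p n, p (n + 1)) \<in> edges (record_tree x)" "0 \<in> range p"
    unfolding bi_infinite_path_def root by auto
  have "edges (record_tree x) \<subseteq> record_edges x" by (auto simp: record_tree_def Let_def)
  then have "(p n, p (n + 1)) \<in> record_edges x" for n using p by blast
  from bi_infinite_path_records[of p x, OF this] p(2)
  show "two_sided_records x \<and> past_record x 0" by auto
next
  have root: "root (record_tree x) = 0" by (simp add: record_tree_def Let_def)
  assume "two_sided_records x \<and> past_record x 0"
  then show "\<exists>P. bi_infinite_path (record_tree x) P \<and> root (record_tree x) \<in> P"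
    using bi_infinite_path_record_tree[of x] root by auto
qed

section \<open>Depth-first codes of trees\<close>


text \<open>The Lukasiewicz word of the tree, with the children visited from last to first: reading
  increments backwards from a vertex meets its largest child first. Marks are forgotten.\<close>

fun code :: "'m ptree \<Rightarrow> int list" where
  "code (Node m ts) = (int (length ts) - 1) # concat (rev (map code ts))"

text \<open>The letter of the root exceeds that of \<open>code\<close> by the mark plus one, so the
  sum of the word is the mark instead of - 1.\<close>

definition bush_code :: "int ptree \<Rightarrow> int list" where
  "bush_code t = (root_mark t + int (num_children t)) # concat (rev (map code (children t)))"

text \<open>Reading the word from right to left with a stack of trees, a letter \<open>a\<close> takes the top \<open>a + 1\<close>
  trees off the stack and joins them below a new vertex.\<close>

fun parse :: "'m \<Rightarrow> int list \<Rightarrow> 'm ptree list" where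
  "parse z [] = []"
| "parse z (a # w) =
     Node z (rev (take (nat (a + 1)) (parse z w))) # drop (nat (a + 1)) (parse z w)"

lemma parse_concat_code:
  assumes "\<And>t w. t \<in> set ss \<Longrightarrow> parse z (code t @ w) = t # parse z w"
  shows "parse z (concat (map code ss) @ w) = ss @ parse z w"
  using assms by (induction ss arbitrary: w) auto

text \<open>The arbitrary suffix \<open>w\<close> expresses unique decodability: a code is
  recognised in front of any further letters. The constant mark \<open>z\<close> replaces what
  \<open>code\<close> forgets.\<close>

lemma parse_code: "set_ptree t \<subseteq> {z} \<Longrightarrow> parse z (code t @ w) = t # parse z w"
proof (induction t arbitrary: w)
  case (Node m ts)
  have "parse z (code t @ w) = t # parse z w" if "t \<in> set (rev ts)" for t w
    using Node.IH[of t] Node.prems that by auto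
  then have "parse z (concat (map code (rev ts)) @ w) = rev ts @ parse z w"
    by (rule parse_concat_code)
  then show ?case using Node.prems by (simp add: rev_map)
qed

lemma parse_forest:
  assumes "\<And>t. t \<in> set ss \<Longrightarrow> set_ptree t \<subseteq> {z}"
  shows "parse z (concat (map code ss)) = ss"
  using parse_concat_code[of ss z "[]"] parse_code assms by force

lemma set_ptree_parse: "t \<in> set (parse z w) \<Longrightarrow> set_ptree t = {z}"
  by (induction w arbitrary: t) (force dest: in_set_takeD in_set_dropD)+

text \<open>The height of the stack is minus the suffix sum. A negative sum after reading
  \<open>a\<close> says that at least \<open>a + 1\<close> trees were on the stack, so
  \<open>take\<close> and \<open>drop\<close> never run short and no letter is lost.\<close>

lemma code_parse:
  assumes "\<And>a. a \<in> set w \<Longrightarrow> a \<ge> - 1" "\<And>k. k < length w \<Longrightarrow> sum_list (drop k w) < 0"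
  shows "concat (map code (parse z w)) = w \<and> int (length (parse z w)) = - sum_list w"
  using assms
proof (induction w)
  case (Cons a w)
  have IH: "concat (map code (parse z w)) = w" "int (length (parse z w)) = - sum_list w"
    using Cons.IH Cons.prems(1) Cons.prems(2)[of "Suc _"] by auto
  have a: "a \<ge> - 1" "a + sum_list w < 0" using Cons.prems(1)[of a] Cons.prems(2)[of 0] by auto
  define d where "d = nat (a + 1)"
  have d: "d \<le> length (parse z w)" "int d = a + 1" using IH(2) a by (auto simp: d_def)
  have "concat (map code (take d (parse z w))) @ concat (map code (drop d (parse z w))) = w"
    using IH(1) by (simp flip: map_append concat_append)
  then show ?case using d IH(2) by (simp add: d_def[symmetric] rev_map min_absorb2 of_nat_diff)
qed simp

lemma sum_list_code: "sum_list (code t) = - 1"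
proof (induction t)
  case (Node m ts)
  have "sum_list (concat (map code ss)) = - int (length ss)" if "set ss \<subseteq> set ts" for ss
    using that Node.IH by (induction ss) auto
  from this[of "rev ts"] show ?case by (simp add: rev_map)
qed

lemma sum_list_forest: "sum_list (concat (map code ss)) = - int (length ss)"
  by (induction ss) (auto simp: sum_list_code)

lemma code_nonempty: "code t \<noteq> []" by (cases t) auto

lemma sum_list_drop_forest_aux:
  assumes "\<And>t k. t \<in> set ss \<Longrightarrow> k < length (code t) \<Longrightarrow> sum_list (drop k (code t)) < 0"
    "k < length (concat (map code ss))"
  shows "sum_list (drop k (concat (map code ss))) < 0"
  using assms
proof (induction ss arbitrary: k)
  case (Cons t ss)
  show ?case
  proof (cases "k < length (code t)")
    case True
    then show ?thesis using Cons.prems(1)[of t k] by (simp add: sum_list_forest)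
  next
    case False
    then have "sum_list (drop (k - length (code t)) (concat (map code ss))) < 0"
      using Cons.prems by (intro Cons.IH) auto
    then show ?thesis using False by simp
  qed
qed simp

lemma sum_list_drop_code: "k < length (code t) \<Longrightarrow> sum_list (drop k (code t)) < 0"
proof (induction t arbitrary: k)
  case (Node m ts)
  show ?case
  proof (cases k)
    case 0
    then show ?thesis using sum_list_code[of "Node m ts"] by simp
  next
    case (Suc k')
    have "sum_list (drop k' (concat (map code (rev ts)))) < 0"
      using Node Suc by (intro sum_list_drop_forest_aux) (auto simp: rev_map)
    then show ?thesis using Suc by (simp add: rev_map)
  qed
qed

lemma sum_list_drop_forest:
  "k < length (concat (map code ss)) \<Longrightarrow> sum_list (drop k (concat (map code ss))) < 0"
  by (intro sum_list_drop_forest_aux sum_list_drop_code)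

lemma length_code: "length (code t) = Suc (\<Sum>s\<leftarrow>children t. length (code s))"
  by (cases t) (simp add: length_concat rev_map[symmetric] comp_def)

lemma length_bush_code: "length (bush_code t) = length (code t)"
  by (cases t) (simp add: bush_code_def)

section \<open>Increments read backwards and the bush between two records\<close>

definition back_word :: "(int \<Rightarrow> int) \<Rightarrow> int \<Rightarrow> nat \<Rightarrow> int list" where
  "back_word x j k = map (\<lambda>l. x (j - 1 - int l)) [0..<k]"

lemma length_back_word [simp]: "length (back_word x j k) = k"
  by (simp add: back_word_def)

lemma back_word_add: "back_word x j (a + b) = back_word x j a @ back_word x (j - int a) b"
  by (rule nth_equalityI) (auto simp: back_word_def nth_append algebra_simps)

lemma back_word_Suc: "back_word x j (Suc k) = x (j - 1) # back_word x (j - 1) k"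
  using back_word_add[of x j 1 k] by (simp add: back_word_def)

lemma drop_back_word: "l \<le> k \<Longrightarrow> drop l (back_word x j k) = back_word x (j - int l) (k - l)"
  using back_word_add[of x j l "k - l"] by simp

lemma sum_list_back_word: "sum_list (back_word x j k) = walk_sum x (j - int k) j"
proof (induction k arbitrary: j)
  case (Suc k)
  then show ?case using walk_sum_last[of "j - int (Suc k)" j x] by (simp add: back_word_Suc algebra_simps)
qed (simp add: back_word_def)

lemma back_word_eq_appendD:
  assumes "back_word x j k = u @ v"
  shows "back_word x j (length u) = u" "back_word x (j - int (length u)) (length v) = v"
proof -
  have "k = length u + length v" using assms by (metis length_append length_back_word)
  then show "back_word x j (length u) = u" "back_word x (j - int (length u)) (length v) = v"
    using assms by (auto simp: back_word_add)
qed

lemma sum_list_drop_back_word: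
  "back_word x j k = w \<Longrightarrow> l \<le> k \<Longrightarrow> sum_list (drop l w) = walk_sum x (j - int k) (j - int l)"
  using drop_back_word[of l k x j] by (auto simp: sum_list_back_word of_nat_diff)

definition spine_bush :: "int ptree \<Rightarrow> bool" where
  "spine_bush t \<longleftrightarrow> root_mark t \<ge> 0 \<and> (\<forall>s\<in>set (children t). set_ptree s = {- 1})"

text \<open>The letter \<open>x (j - 1)\<close> of the root is left out of the parsed word, as it is
  recovered from the mark and the number of children. \<open>rev\<close> restores increasing order,
  since the top of the stack is the largest child.\<close>

definition bush_between :: "(int \<Rightarrow> int) \<Rightarrow> int \<Rightarrow> int \<Rightarrow> int ptree" where
  "bush_between x i j =
     Node (walk_sum x i j) (rev (parse (- 1) (back_word x (j - 1) (nat (j - i - 1)))))"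

text \<open>The sums from \<open>i\<close> to the interior sites of the jump are the suffix sums of
  the backward word; their negativity is the decodability condition of
  \<open>code_parse\<close>.\<close>

lemma bush_between_record_edge:
  assumes x: "\<And>l. x l \<ge> - 1" and e: "(i, j) \<in> record_edges x"
  shows "back_word x j (length (bush_code (bush_between x i j))) = bush_code (bush_between x i j)"
    "spine_bush (bush_between x i j)" "int (length (bush_code (bush_between x i j))) = j - i"
proof -
  note r = record_edgesD[OF e]
  define k where "k = nat (j - i - 1)"
  have k: "int k = j - 1 - i" "nat (j - i) = Suc k" using r(2) by (auto simp: k_def)
  define w where "w = back_word x (j - 1) k"
  have "sum_list (drop l w) < 0" if "l < length w" for l
    using sum_list_drop_back_word[of x "j - 1" k w l] r(4)[of "j - 1 - int l"] that k
    by (simp add: w_def)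
  moreover have "a \<ge> - 1" if "a \<in> set w" for a
    using that x by (auto simp: w_def back_word_def)
  ultimately have c: "concat (map code (parse (- 1 :: int) w)) = w"
      "int (length (parse (- 1 :: int) w)) = - sum_list w"
    using code_parse[of w "- 1 :: int"] by blast+
  have "sum_list w = walk_sum x i (j - 1)" using k by (simp add: w_def sum_list_back_word)
  \<comment> \<open>The number of parsed trees is minus the sum up to \<open>j - 1\<close>, so
    adding it to the sum up to \<open>j\<close> leaves the last letter.\<close>
  then have "walk_sum x i j + int (length (parse (- 1 :: int) w)) = x (j - 1)"
    using c(2) walk_sum_last[OF r(2), of x] by simp
  then have *: "back_word x j (nat (j - i)) = bush_code (bush_between x i j)"
    using c(1) by (simp add: bush_code_def bush_between_def k_def[symmetric] w_def[symmetric]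
        rev_map k(2) back_word_Suc)
  show "spine_bush (bush_between x i j)"
    using r(3) by (auto simp: spine_bush_def bush_between_def dest: set_ptree_parse)
  show "int (length (bush_code (bush_between x i j))) = j - i"
    using r(2) by (simp flip: *)
  show "back_word x j (length (bush_code (bush_between x i j))) = bush_code (bush_between x i j)"
    using * by (metis length_back_word)
qed

text \<open>The converse decoding: interior sums are suffix sums of the code of a forest, hence
  negative, while the total is the mark, which is nonnegative. So jumps and bushes determine each
  other.\<close>

lemma record_edge_bush_code:
  assumes w: "back_word x j (length (bush_code t)) = bush_code t" and t: "spine_bush t"
  defines "i \<equiv> j - int (length (bush_code t))"
  shows "(i, j) \<in> record_edges x" "bush_between x i j = t"
proof -
  define v where "v = concat (map code (rev (children t)))"
  have bc: "bush_code t = (root_mark t + int (num_children t)) # v"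
    by (simp add: bush_code_def v_def rev_map)
  have v: "back_word x (j - 1) (length v) = v" using w by (simp add: bc back_word_Suc)
  have i: "i = j - 1 - int (length v)" by (simp add: i_def bc)
  have "sum_list (bush_code t) = root_mark t"
    unfolding bc by (simp add: v_def sum_list_forest)
  then have ij: "walk_sum x i j = root_mark t"
    using w sum_list_back_word[of x j "length (bush_code t)"] by (simp add: i_def)
  have "walk_sum x i l < 0" if l: "i < l" "l < j" for l
  proof -
    have a: "nat (j - 1 - l) < length v" "int (nat (j - 1 - l)) = j - 1 - l" using l i by auto
    then have "sum_list (drop (nat (j - 1 - l)) v) = walk_sum x i l"
      using sum_list_drop_back_word[OF v, of "nat (j - 1 - l)"] i by simp
    then show ?thesis using sum_list_drop_forest[of "nat (j - 1 - l)" "rev (children t)"] a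
      by (simp add: v_def)
  qed
  moreover have "i < j" by (simp add: i)
  ultimately show "(i, j) \<in> record_edges x"
    using ij t record_map_eqI[of i j x] by (intro record_edgesI) (auto simp: spine_bush_def)
  have "nat (j - i - 1) = length v" by (simp add: i)
  moreover have "parse (- 1) v = rev (children t)"
    unfolding v_def using t by (intro parse_forest) (auto simp: spine_bush_def)
  ultimately show "bush_between x i j = t" using ij v by (simp add: bush_between_def)
qed

lemma type_fun_eqI:
  assumes "n \<ge> - 1" "m < i" "walk_sum x m i = n" "\<And>l. l < i \<Longrightarrow> walk_sum x l i \<ge> - 1 \<Longrightarrow> walk_sum x l i \<ge> n"
  shows "type_fun x i = n"
  unfolding type_fun_def using assms by (intro cInf_eq_minimum) auto

text \<open>The infimum is attained at the previous record \<open>i\<close>: earlier starts are not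
  above the level at \<open>i\<close>, and interior sites are below it, so both give sums at least
  as large.\<close>

lemma type_fun_past_record:
  assumes "past_record x i" "(i, j) \<in> record_edges x"
  shows "type_fun x j = walk_sum x i j"
proof (rule type_fun_eqI[where m = i])
  note r = record_edgesD[OF assms(2)]
  fix l assume "l < j"
  consider "l < i" | "l = i" | "i < l" by linarith
  then show "walk_sum x i j \<le> walk_sum x l j"
  proof cases
    case 1
    then show ?thesis using assms(1) walk_sum_split[of l i j x] r(2) by (auto simp: past_record_def)
  next
    case 3
    then show ?thesis using r(4)[of l] \<open>l < j\<close> walk_sum_split[of i l j x] by simp
  qed simp
qed (use record_edgesD[OF assms(2)] in auto)

text \<open>The index of a vertex in the depth-first order that visits larger children first.\<close>

fun off :: "'m ptree \<Rightarrow> nat list \<Rightarrow> nat" where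
  "off t [] = 0"
| "off t (i # u) = Suc (\<Sum>s\<leftarrow>drop (Suc i) (children t). length (code s)) + off (children t ! i) u"

section \<open>Addresses and their depth-first indices\<close>

lemma subtree_at_append:
  "subtree_at t (u @ v) = Option.bind (subtree_at t u) (\<lambda>s. subtree_at s v)"
  by (induction t u rule: subtree_at.induct) auto

lemma off_append:
  "subtree_at t u = Some s \<Longrightarrow> off t (u @ v) = off t u + off s v"
  by (induction t u rule: subtree_at.induct) (auto split: if_splits)

lemma drop_sum_step:
  "i < length ts \<Longrightarrow> (\<Sum>s\<leftarrow>drop i ts. f s) = f (ts ! i) + (\<Sum>s\<leftarrow>drop (Suc i) ts. (f s :: nat))"
  by (simp flip: Cons_nth_drop_Suc)

lemma drop_sum_mono: "i \<le> j \<Longrightarrow> (\<Sum>s\<leftarrow>drop j ts. (f s :: nat)) \<le> (\<Sum>s\<leftarrow>drop i ts. f s)"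
proof -
  assume "i \<le> j"
  then have "drop i ts = take (j - i) (drop i ts) @ drop j ts"
    using append_take_drop_id[of "j - i" "drop i ts"] by simp
  then have "(\<Sum>s\<leftarrow>drop i ts. f s) = (\<Sum>s\<leftarrow>take (j - i) (drop i ts). f s) + (\<Sum>s\<leftarrow>drop j ts. f s)"
    by (metis map_append sum_list_append)
  then show ?thesis by simp
qed

text \<open>The codes of the children fill consecutive blocks after the letter of the root, the
  block of child \<open>i\<close> coming after those of its larger siblings.\<close>

lemma off_less: "subtree_at t u \<noteq> None \<Longrightarrow> off t u < length (code t)"
proof (induction t u rule: subtree_at.induct)
  case (2 t i u)
  then have i: "i < num_children t" and IH: "off (children t ! i) u < length (code (children t ! i))"
    by (auto split: if_splits)
  show ?case using IH drop_sum_step[OF i, of "\<lambda>s. length (code s)"]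
      drop_sum_mono[of 0 i "\<lambda>s. length (code s)" "children t"]
    by (simp add: length_code[of t])
qed (simp add: code_nonempty)

lemma off_inj:
  "subtree_at t u \<noteq> None \<Longrightarrow> subtree_at t v \<noteq> None \<Longrightarrow> off t u = off t v \<Longrightarrow> u = v"
proof (induction t u arbitrary: v rule: subtree_at.induct)
  case (1 t)
  then show ?case by (cases v) auto
next
  case (2 t i u)
  have less: "off t (k # w) < off t (i' # w')"
    if "i' < k" "k < num_children t" "subtree_at t (k # w) \<noteq> None" for i' k w w'
  proof -
    have "off (children t ! k) w < length (code (children t ! k))"
      using that by (intro off_less) auto
    then show ?thesis using drop_sum_step[OF that(2), of "\<lambda>s. length (code s)"]
      drop_sum_mono[of "Suc i'" k "\<lambda>s. length (code s)" "children t"] that by simp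
  qed
  from 2 obtain j w where v: "v = j # w" by (cases v) auto
  have ij: "i < num_children t" "j < num_children t" using 2 v by (auto split: if_splits)
  have "i = j" using less[of i j w u] less[of j i u w] 2 v ij by (cases i j rule: linorder_cases) auto
  then show ?case using 2 v ij by auto
qed

lemma off_surj: "m < length (code t) \<Longrightarrow> \<exists>u. subtree_at t u \<noteq> None \<and> off t u = m"
proof (induction t arbitrary: m)
  case (Node z ts)
  show ?case
  proof (cases m)
    case 0
    then show ?thesis by (intro exI[of _ "[]"]) simp
  next
    case (Suc k)
    let ?S = "\<lambda>i. \<Sum>s\<leftarrow>drop i ts. length (code s)"
    have k: "k < ?S 0" using Node.prems Suc length_code[of "Node z ts"] by simp
    \<comment> \<open>\<open>d\<close> is the least cut such that the codes of the children from
      \<open>d\<close> on have total length at most \<open>k\<close>; child \<open>d - 1\<close> is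
      then the one whose block contains position \<open>k\<close>.\<close>
    define P where "P d \<longleftrightarrow> ?S d \<le> k" for d
    define d where "d = (LEAST d. P d)"
    have P: "P (length ts)" by (simp add: P_def)
    have d: "?S d \<le> k" using LeastI[of P, OF P] by (simp only: P_def d_def)
    have d2: "d \<le> length ts" using Least_le[of P, OF P] by (simp only: d_def)
    have d3: "\<not> ?S e \<le> k" if "e < d" for e using not_less_Least[of e P] that by (simp only: P_def d_def) simp
    from d k obtain i where i: "d = Suc i" by (cases d) auto
    have it: "i < length ts" using d2 i by simp
    have "k - ?S (Suc i) < length (code (ts ! i))"
      using d d3[of i] drop_sum_step[OF it, of "\<lambda>s. length (code s)"] i by simp
    then obtain u where u: "subtree_at (ts ! i) u \<noteq> None" "off (ts ! i) u = k - ?S (Suc i)"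
      using Node.IH[OF nth_mem[OF it]] by blast
    then show ?thesis using it Suc d i by (intro exI[of _ "i # u"]) auto
  qed
qed

text \<open>\<open>d\<close> exceeds \<open>length ts - 1\<close> when \<open>j\<close> is on the bi-infinite path: then \<open>j\<close> has one more child,
  outside \<open>ts\<close>.\<close>

definition children_at :: "(int \<Rightarrow> int) \<Rightarrow> int \<Rightarrow> int \<Rightarrow> 'm ptree list \<Rightarrow> bool" where
  "children_at x j d ts \<longleftrightarrow> x (j - 1) = d \<and> d \<ge> int (length ts) - 1 \<and>
     (let w = concat (map code (rev ts)) in back_word x (j - 1) (length w) = w)"

lemma children_at_code:
  "back_word x j (length (code t)) = code t \<Longrightarrow> children_at x j (int (num_children t) - 1) (children t)"
  by (cases t) (auto simp: children_at_def back_word_Suc rev_map)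

lemma children_at_bush_code:
  "back_word x j (length (bush_code t)) = bush_code t \<Longrightarrow> root_mark t \<ge> 0 \<Longrightarrow>
     children_at x j (root_mark t + int (num_children t)) (children t)"
  by (cases t) (auto simp: children_at_def back_word_Suc rev_map bush_code_def)

text \<open>\<open>q\<close> skips the letter of the root and the codes of the larger siblings. From
  \<open>q\<close> the walk stays negative through those codes and reaches minus their number at
  \<open>j - 1\<close>; the last letter \<open>d\<close> makes up for this, since there are at most
  \<open>length ts - 1\<close> larger siblings.\<close>

lemma children_at_child:
  assumes c: "children_at x j d ts" and i: "i < length ts"
  defines "q \<equiv> j - 1 - int (\<Sum>s\<leftarrow>drop (Suc i) ts. length (code s))"
  shows "back_word x q (length (code (ts ! i))) = code (ts ! i)" "(q, j) \<in> record_edges x"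
proof -
  define u where "u = concat (map code (rev (drop (Suc i) ts)))"
  have "rev ts = rev (drop (Suc i) ts) @ ts ! i # rev (take i ts)"
    using id_take_nth_drop[OF i] by (metis append_assoc append_Cons append_Nil rev.simps(2) rev_append)
  then have w: "back_word x (j - 1) (length (concat (map code (rev ts)))) =
      u @ code (ts ! i) @ concat (map code (rev (take i ts)))"
    using c unfolding children_at_def Let_def u_def by simp
  note b = back_word_eq_appendD[OF w]
  have q: "q = j - 1 - int (length u)"
    by (simp add: q_def u_def length_concat rev_map[symmetric] comp_def)
  show "back_word x q (length (code (ts ! i))) = code (ts ! i)"
    using back_word_eq_appendD(1)[OF b(2)] by (simp add: q)
  have "walk_sum x q (j - 1) = - int (length ts - Suc i)"
    using sum_list_back_word[of x "j - 1" "length u"] b(1) sum_list_forest[of "rev (drop (Suc i) ts)"]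
    by (simp add: q u_def)
  then have "walk_sum x q j \<ge> 0" "q < j"
    using c i walk_sum_last[of q j x] by (auto simp: children_at_def q of_nat_diff)
  moreover have "walk_sum x q l < 0" if l: "q < l" "l < j" for l
  proof -
    have a: "nat (j - 1 - l) < length u" "int (nat (j - 1 - l)) = j - 1 - l" using l q by auto
    then have "sum_list (drop (nat (j - 1 - l)) u) = walk_sum x q l"
      using sum_list_drop_back_word[OF b(1), of "nat (j - 1 - l)"] q by simp
    then show ?thesis
      using sum_list_drop_forest[of "nat (j - 1 - l)" "rev (drop (Suc i) ts)"] a by (simp add: u_def)
  qed
  ultimately show "(q, j) \<in> record_edges x"
    using record_map_eqI[of q j x] by (intro record_edgesI) auto
qed

text \<open>An excess of \<open>d\<close> can occur at the root only: below it every subtree is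
  spelled by its \<open>code\<close>, and the induction passes through
  \<open>children_at_code\<close>.\<close>

lemma children_at_subtree:
  "children_at x j d (children t) \<Longrightarrow> subtree_at t u = Some s \<Longrightarrow>
     \<exists>d'. children_at x (j - int (off t u)) d' (children s) \<and>
       (u \<noteq> [] \<longrightarrow> back_word x (j - int (off t u)) (length (code s)) = code s)"
proof (induction t u arbitrary: j d rule: subtree_at.induct)
  case (2 t i u)
  then have i: "i < num_children t" and s: "subtree_at (children t ! i) u = Some s"
    by (auto split: if_splits)
  define q where "q = j - 1 - int (\<Sum>s\<leftarrow>drop (Suc i) (children t). length (code s))"
  have q: "back_word x q (length (code (children t ! i))) = code (children t ! i)"
    using children_at_child(1)[OF 2(2) i] by (simp add: q_def)
  have eq: "q - int (off (children t ! i) u) = j - int (off t (i # u))" by (simp add: q_def)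
  have "u = [] \<Longrightarrow> back_word x (j - int (off t (i # u))) (length (code s)) = code s"
    using q s unfolding eq[symmetric] by simp
  then show ?case
    using 2(1)[OF i children_at_code[OF q] s] unfolding eq by blast
qed auto

lemma set_ptree_subtree_at: "subtree_at t u = Some s \<Longrightarrow> set_ptree s \<subseteq> set_ptree t"
proof (induction t u rule: subtree_at.induct)
  case (2 t i u)
  then have "i < num_children t" "set_ptree s \<subseteq> set_ptree (children t ! i)" by (auto split: if_splits)
  then show ?case by (cases t) (force dest: nth_mem)
qed auto

text \<open>The sum over the window of the code is - 1, the least value a type may take.\<close>

lemma type_fun_code:
  assumes "back_word x q (length (code t)) = code t"
  shows "type_fun x q = - 1"
proof (rule type_fun_eqI[where m = "q - int (length (code t))"])
  show "walk_sum x (q - int (length (code t))) q = - 1"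
    using sum_list_back_word[of x q "length (code t)"] assms by (simp add: sum_list_code)
qed (use code_nonempty[of t] in auto)

text \<open>Larger siblings come earlier in the depth-first order, so subtracting \<open>off\<close>
  from the site of the root turns the order of siblings into the order of the integers.\<close>

lemma off_sibling:
  assumes "subtree_at t (u @ [j]) \<noteq> None" "i < j"
  shows "off t (u @ [j]) < off t (u @ [i])"
proof -
  obtain s where s: "subtree_at t u = Some s" "j < num_children s"
    using assms(1) by (auto simp: subtree_at_append split: bind_splits if_splits)
  have "off s [j] < off s [i]"
    using drop_sum_step[OF s(2), of "\<lambda>s. length (code s)"] length_code[of "children s ! j"]
      drop_sum_mono[of "Suc i" j "\<lambda>s. length (code s)" "children s"] assms(2) by simp
  then show ?thesis using s by (simp add: off_append)
qed

section \<open>The record tree as a join of bushes\<close>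

definition bush_seq :: "(int \<Rightarrow> int) \<Rightarrow> int \<Rightarrow> int ptree" where
  "bush_seq x n = bush_between x (record_seq x (n - 1)) (record_seq x n)"

lemma single_valued_record_edges: "single_valued (record_edges x)"
  by (auto simp: single_valued_def record_edges_def)

text \<open>Vertex \<open>u\<close> of bush \<open>n\<close> is placed at the site
  \<open>p n - off (b n) u\<close>. Bush \<open>n\<close> then fills the sites after
  \<open>p (n - 1)\<close> up to \<open>p n\<close>, so this is a bijection. On both sides the edge
  from a vertex leads to \<open>par\<close>, and siblings are ordered by their sites.\<close>

lemma rtree_iso_join_bushes:
  assumes x: "\<And>l. x l \<ge> - 1" and two: "two_sided_records x" and rec0: "past_record x 0"
  shows "rtree_iso (join_bushes (bush_seq x)) (record_tree x)"
proof -
  define p where "p = record_seq x"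
  define b where "b = bush_seq x"
  have e: "(p (n - 1), p n) \<in> record_edges x" for n
    using record_seq[OF two rec0, of "n - 1"] by (simp add: p_def)
  have p_less: "p n < p (n + 1)" for n using record_edgesD(2)[OF e[of "n + 1"]] by simp
  note p_mono = int_step_mono(1)[of p, OF p_less]
  have range_p: "range p = Collect (past_record x)"
    using bi_infinite_path_records(1)[of p x] e[of "_ + 1"] by simp
  have bb: "back_word x (p n) (length (bush_code (b n))) = bush_code (b n)" "spine_bush (b n)"
    "int (length (code (b n))) = p n - p (n - 1)" "root_mark (b n) = walk_sum x (p (n - 1)) (p n)" for n
  proof -
    have b: "b n = bush_between x (p (n - 1)) (p n)" by (simp add: b_def bush_seq_def p_def)
    show "back_word x (p n) (length (bush_code (b n))) = bush_code (b n)" "spine_bush (b n)"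
      "int (length (code (b n))) = p n - p (n - 1)" "root_mark (b n) = walk_sum x (p (n - 1)) (p n)"
      using bush_between_record_edge[OF x e[of n], folded b]
      by (auto simp only: length_bush_code) (simp add: b bush_between_def)
  qed
  have ca: "\<exists>d. children_at x (p n - int (off (b n) u)) d (children s)"
      "u \<noteq> [] \<Longrightarrow> back_word x (p n - int (off (b n) u)) (length (code s)) = code s"
    if "subtree_at (b n) u = Some s" for n u s
    using children_at_subtree[OF children_at_bush_code[OF bb(1)] that] bb(2)[of n]
    by (auto simp: spine_bush_def)
  define V where "V = {(n, u). subtree_at (b n) u \<noteq> None}"
  define f where "f = (\<lambda>(n, u). p n - int (off (b n) u))"
  define par where "par = (\<lambda>(n :: int, u :: nat list). if u = [] then (n + 1, []) else (n, butlast u))"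
  have f_bounds: "p (n - 1) < f (n, u)" "f (n, u) \<le> p n" if "(n, u) \<in> V" for n u
    using off_less[of "b n" u] that bb(3)[of n] by (auto simp: V_def f_def)
  have f_eq: "U = W" if UW: "U \<in> V" "W \<in> V" "f U = f W" for U W
  proof -
    obtain n u m w where eq: "U = (n, u)" "W = (m, w)" by (metis surj_pair)
    have "n = m"
    proof (rule ccontr)
      assume "n \<noteq> m"
      then have "n \<le> m - 1 \<or> m \<le> n - 1" by linarith
      then have "p n \<le> p (m - 1) \<or> p m \<le> p (n - 1)" using p_mono by (simp add: strict_mono_less_eq)
      then show False using f_bounds[of n u] f_bounds[of m w] UW eq by auto
    qed
    then show ?thesis using UW eq off_inj[of "b n" u w] by (auto simp: V_def f_def)
  qed
  have "\<exists>U\<in>V. f U = i" for i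
  proof -
    obtain n where n: "p (n - 1) < i" "i \<le> p n" by (rule int_block[of p, OF p_less])
    then have "nat (p n - i) < length (code (b n))" using bb(3)[of n] by linarith
    then obtain u where "subtree_at (b n) u \<noteq> None" "off (b n) u = nat (p n - i)"
      using off_surj by blast
    then show ?thesis using n by (intro bexI[of _ "(n, u)"]) (auto simp: f_def V_def)
  qed
  then have bij: "bij_betw f V UNIV"
    using f_eq by (auto simp: bij_betw_def inj_on_def surj_def image_iff) metis
  have subV: "subtree_at (b n) u \<noteq> None \<Longrightarrow> (n, u) \<in> V" for n u by (auto simp: V_def)
  have nilV: "(n, []) \<in> V" for n by (simp add: V_def)
  have snocV: "\<exists>s. subtree_at (b n) u = Some s \<and> i < num_children s \<and>
      subtree_at (b n) (u @ [i]) = Some (children s ! i)" if "(n, u @ [i]) \<in> V" for n u i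
    using that by (auto simp: V_def subtree_at_append split: bind_splits if_splits)
  have parV: "par U \<in> V" if "U \<in> V" for U
  proof -
    obtain n u where U: "U = (n, u)" by (cases U)
    show ?thesis
    proof (cases u rule: rev_cases)
      case (snoc v i)
      then show ?thesis using snocV[of n v i] that U by (auto simp: par_def V_def)
    qed (simp add: U par_def nilV)
  qed
  have f_par: "(f U, f (par U)) \<in> record_edges x" if UV: "U \<in> V" for U
  proof -
    obtain n u where U: "U = (n, u)" by (cases U)
    show ?thesis
    proof (cases u rule: rev_cases)
      case Nil
      then show ?thesis using e[of "n + 1"] by (simp add: U par_def f_def)
    next
      case (snoc v i)
      obtain s where s: "subtree_at (b n) v = Some s" "i < num_children s"
        using snocV[of n v i] UV U snoc by auto
      obtain d where d: "children_at x (p n - int (off (b n) v)) d (children s)" using ca(1)[OF s(1)] by auto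
      show ?thesis using children_at_child(2)[OF d s(2)] snoc s
        by (simp add: U par_def f_def off_append algebra_simps)
    qed
  qed
  \<comment> \<open>As each site has at most one parent, preserving the parent in one direction
    already gives the equivalence.\<close>
  have edge_f: "(f U, f W) \<in> record_edges x \<longleftrightarrow> W = par U" if "U \<in> V" "W \<in> V" for U W
    using f_par[OF that(1)] f_eq[OF that(2) parV[OF that(1)]] single_valued_record_edges[of x]
    by (auto simp: single_valued_def)
  have verts: "verts (join_bushes b) = V" by (simp add: join_bushes_def V_def Let_def)
  have edge_join: "(U, W) \<in> edges (join_bushes b) \<longleftrightarrow> W = par U" if "U \<in> V" "W \<in> V" for U W
  proof -
    obtain n u m w where eq: "U = (n, u)" "W = (m, w)" by (metis surj_pair)
    show ?thesis using that unfolding eq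
      by (cases u rule: rev_cases) (auto simp: join_bushes_def Let_def V_def par_def)
  qed
  have siblings_f: "siblings (record_edges x) (f U) (f W) \<longleftrightarrow> par U = par W"
    if "U \<in> V" "W \<in> V" for U W
    using f_par[OF that(1)] f_par[OF that(2)] f_eq[OF parV[OF that(1)] parV[OF that(2)]]
      single_valued_record_edges[of x]
    by (auto simp: siblings_def single_valued_def) metis
  have sib: "(U, W) \<in> sib (join_bushes b) \<longleftrightarrow> par U = par W \<and> f U < f W"
    if UW: "U \<in> V" "W \<in> V" for U W
  proof -
    obtain n u m w where eq: "U = (n, u)" "W = (m, w)" by (metis surj_pair)
    show ?thesis
    proof (cases u rule: rev_cases)
      case Nil
      show ?thesis
      proof (cases w rule: rev_cases)
        case (snoc w' j)
        \<comment> \<open>When the parents agree, the spine child sits at \<open>p (m - 1)\<close>,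
          before every site of bush \<open>m\<close>, so it is the smallest child.\<close>
        then show ?thesis using UW Nil f_bounds(1)[of m w] unfolding eq
          by (auto simp: join_bushes_def Let_def V_def par_def f_def)
      qed (use UW Nil in \<open>auto simp: eq join_bushes_def Let_def V_def par_def f_def\<close>)
    next
      case u: (snoc u' i)
      show ?thesis
      proof (cases w rule: rev_cases)
        case Nil
        then show ?thesis using UW u f_bounds(1)[of n u] unfolding eq
          by (auto simp: join_bushes_def Let_def V_def par_def f_def)
      next
        case w: (snoc w' j)
        have "i < j \<longleftrightarrow> f U < f W" if "n = m" "u' = w'"
          using off_sibling[of "b n" u' j i] off_sibling[of "b n" u' i j] UW that u w
          unfolding eq by (cases i j rule: linorder_cases) (auto simp: f_def V_def)
        then show ?thesis using UW u w unfolding eq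
          by (auto simp: join_bushes_def Let_def V_def par_def)
      qed
    qed
  qed
  have mark: "type_fun x (f U) = mark (join_bushes b) U" if U: "U \<in> V" for U
  proof -
    obtain n u where eq: "U = (n, u)" by (cases U)
    obtain s where s: "subtree_at (b n) u = Some s" using U eq by (auto simp: V_def)
    show ?thesis
    proof (cases u)
      case Nil
      have "past_record x (p (n - 1))" using range_p by auto
      then show ?thesis using type_fun_past_record[OF _ e[of n]] Nil bb(4)[of n]
        by (simp add: eq f_def join_bushes_def Let_def)
    next
      case (Cons i v)
      then have "i < num_children (b n)" "subtree_at (children (b n) ! i) v = Some s"
        using s by (auto split: if_splits)
      then have "set_ptree s \<subseteq> {- 1}"
        using set_ptree_subtree_at[of "children (b n) ! i" v s] bb(2)[of n] by (auto simp: spine_bush_def)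
      then have "root_mark s = - 1" by (cases s) auto
      then show ?thesis using type_fun_code[OF ca(2)[OF s]] Cons s
        by (simp add: eq f_def join_bushes_def Let_def)
    qed
  qed
  note rt = verts_record_tree[OF two]
  have "f (root (join_bushes b)) = root (record_tree x)"
    by (simp add: f_def p_def join_bushes_def record_tree_def Let_def)
  moreover have "mark (record_tree x) = type_fun x" by (simp add: record_tree_def Let_def)
  ultimately have "rtree_iso (join_bushes b) (record_tree x)"
    unfolding rtree_iso_def verts using bij mark edge_join edge_f sib siblings_f
    by (intro exI[of _ f]) (simp add: rt)
  then show ?thesis by (simp add: b_def)
qed

section \<open>Galton-Watson trees and the law of a bush\<close>


text \<open>The probability that i.i.d. increments spell \<open>w\<close>, where \<open>q\<close> is
  the law of an increment plus one. It has this meaning for letters at least - 1, because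
  \<open>nat\<close> truncates.\<close>

definition word_weight :: "nat pmf \<Rightarrow> int list \<Rightarrow> real" where
  "word_weight q w = (\<Prod>a\<leftarrow>w. pmf q (nat (a + 1)))"

lemma word_weight_append: "word_weight q (u @ v) = word_weight q u * word_weight q v"
  by (simp add: word_weight_def)

lemma word_weight_nonneg: "word_weight q w \<ge> 0"
  unfolding word_weight_def by (intro prod_list_nonneg) auto

lemma word_weight_forest:
  "word_weight q (concat (rev (map code ts))) = (\<Prod>t\<leftarrow>ts. word_weight q (code t))"
  by (induction ts) (simp_all add: word_weight_append, simp add: word_weight_def)

lemma word_weight_code:
  "word_weight q (code (Node m ts)) = pmf q (length ts) * (\<Prod>t\<leftarrow>ts. word_weight q (code t))"
  unfolding word_weight_forest[symmetric] by (simp add: word_weight_def)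

lemma pmf_replicate_pmf:
  "pmf (replicate_pmf n p) xs = (if length xs = n then (\<Prod>x\<leftarrow>xs. pmf p x) else 0)"
proof (induction n arbitrary: xs)
  case (Suc n)
  have eq: "replicate_pmf (Suc n) p = map_pmf (\<lambda>(x, xs). x # xs) (pair_pmf p (replicate_pmf n p))"
    by (simp add: pair_pmf_def map_bind_pmf)
  have inj: "inj (\<lambda>(x, xs). x # xs :: 'a list)" by (auto simp: inj_on_def)
  show ?case
  proof (cases xs)
    case Nil
    have "xs \<notin> set_pmf (replicate_pmf (Suc n) p)" using Nil by (simp only: set_replicate_pmf) simp
    then show ?thesis using Nil by (simp add: set_pmf_eq del: replicate_pmf.simps)
  next
    case (Cons y ys)
    then show ?thesis unfolding eq using pmf_map_inj'[OF inj, of "pair_pmf p (replicate_pmf n p)" "(y, ys)"]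
      by (simp add: pmf_pair Suc)
  qed
qed (auto simp: pmf_return)

section \<open>Products over vertices and coordinates for spine bushes\<close>

lemma finite_addresses: "finite {u. subtree_at t u \<noteq> None}"
proof (rule inj_on_finite)
  show "inj_on (off t) {u. subtree_at t u \<noteq> None}" by (rule inj_onI) (rule off_inj, auto)
  show "off t ` {u. subtree_at t u \<noteq> None} \<subseteq> {..<length (code t)}"
    by (rule image_subsetI) (simp only: lessThan_iff off_less mem_Collect_eq not_False_eq_True)
qed simp

lemma prod_addresses:
  "(\<Prod>u | subtree_at (Node m ts) u \<noteq> None. f (the (subtree_at (Node m ts) u))) =
     (f (Node m ts) :: real) * (\<Prod>t\<leftarrow>ts. \<Prod>u | subtree_at t u \<noteq> None. f (the (subtree_at t u)))"
proof -
  let ?U = "\<lambda>t. {u. subtree_at t u \<noteq> None}"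
  have U: "?U (Node m ts) = insert [] (\<Union>i\<in>{..<length ts}. (#) i ` ?U (ts ! i))" (is "_ = insert _ ?W")
  proof (intro set_eqI)
    fix u show "u \<in> ?U (Node m ts) \<longleftrightarrow> u \<in> insert [] ?W"
      by (cases u) (auto split: if_splits)
  qed
  have "(\<Prod>u\<in>?W. f (the (subtree_at (Node m ts) u))) =
      (\<Prod>i<length ts. \<Prod>u\<in>(#) i ` ?U (ts ! i). f (the (subtree_at (Node m ts) u)))"
    by (intro prod.UNION_disjoint ballI finite_imageI finite_addresses) auto
  also have "\<dots> = (\<Prod>i<length ts. \<Prod>u\<in>?U (ts ! i). f (the (subtree_at (ts ! i) u)))"
    by (rule prod.cong[OF refl], subst prod.reindex) auto
  also have "\<dots> = (\<Prod>t\<leftarrow>ts. \<Prod>u\<in>?U t. f (the (subtree_at t u)))"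
    by (simp add: prod.list_conv_set_nth lessThan_atLeast0)
  finally show ?thesis unfolding U by (subst prod.insert) (auto intro!: finite_imageI finite_addresses simp del: not_None_eq)
qed

text \<open>A spine bush is given by the mark of its root and the unmarked subtrees of the children,
  so its law can be built on such pairs and carried over by injectivity.\<close>

definition spine_bush_of :: "nat \<times> unit ptree list \<Rightarrow> int ptree" where
  "spine_bush_of = (\<lambda>(n, ts). Node (int n) (map (map_ptree (\<lambda>_. - 1)) ts))"

lemma unmark_map_ptree: "unmark (map_ptree f (t :: unit ptree)) = t"
proof -
  have "unmark (map_ptree f t) = map_ptree (\<lambda>_. ()) t" by (simp add: ptree.map_comp comp_def)
  also have "\<dots> = map_ptree (\<lambda>x. x) t" by (intro ptree.map_cong0) simp
  finally show ?thesis by (simp only: ptree.map_ident)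
qed

lemma unmark_spine_bush_of: "unmark (spine_bush_of (n, ts)) = Node () ts"
  by (simp add: spine_bush_of_def comp_def unmark_map_ptree)

lemma inj_spine_bush_of: "inj spine_bush_of"
proof (rule injI, clarify)
  fix n ts m ss assume eq: "spine_bush_of (n, ts) = spine_bush_of (m, ss)"
  have "Node () ts = Node () ss" using eq unmark_spine_bush_of by metis
  moreover have "n = m" using eq by (simp add: spine_bush_of_def)
  ultimately show "n = m \<and> ts = ss" by simp
qed

lemma code_map_ptree: "code (map_ptree f t) = code t"
  by (induction t) (simp add: comp_def cong: map_cong)

lemma spine_bush_iff: "spine_bush t \<longleftrightarrow> t \<in> range spine_bush_of"
proof
  assume t: "spine_bush t"
  obtain m ss where eq: "t = Node m ss" by (cases t)
  have "map_ptree (\<lambda>_. - 1) (unmark s) = s" if "s \<in> set ss" for s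
  proof -
    have "map_ptree (\<lambda>_. - 1) s = map_ptree (\<lambda>x. x) s"
      using t that eq by (intro ptree.map_cong0) (auto simp: spine_bush_def)
    then show ?thesis by (simp add: ptree.map_comp comp_def ptree.map_ident)
  qed
  then have "map (map_ptree (\<lambda>_. - 1) \<circ> unmark) ss = ss" by (intro map_idI) simp
  then have "t = spine_bush_of (nat m, map unmark ss)"
    using t eq by (simp add: spine_bush_of_def spine_bush_def)
  then show "t \<in> range spine_bush_of" by blast
next
  have ne: "set_ptree s \<noteq> {}" for s :: "unit ptree" by (cases s) auto
  have "set_ptree (map_ptree (\<lambda>_. - 1 :: int) s) = {- 1}" for s :: "unit ptree"
    using ne[of s] by (auto simp: ptree.set_map)
  then show "t \<in> range spine_bush_of \<Longrightarrow> spine_bush t"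
    by (auto simp: spine_bush_def spine_bush_of_def)
qed

lemma bush_code_spine_bush_of:
  "bush_code (spine_bush_of (n, ts)) = (int n + int (length ts)) # concat (rev (map code ts))"
  by (simp add: bush_code_def spine_bush_of_def comp_def code_map_ptree)

text \<open>\<open>q\<close> is the law of \<open>X\<^sub>0 + 1\<close>: a letter \<open>a\<close> of a code stands for \<open>a + 1\<close> children.\<close>

locale first_passage =
  fixes q :: "nat pmf" and c :: real
  assumes c: "0 < c" "c < 1"
    and total_weight: "(\<integral>\<^sup>+t. ennreal (word_weight q (code t)) \<partial>count_space (UNIV :: unit ptree set)) = ennreal c"
    and q0: "pmf q 0 > 0"
begin

definition gw :: "unit ptree pmf" where
  "gw = embed_pmf (\<lambda>t. word_weight q (code t) / c)"

lemma pmf_gw: "pmf gw t = word_weight q (code t) / c"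
  unfolding gw_def
proof (rule pmf_embed_pmf)
  have "(\<integral>\<^sup>+t. ennreal (word_weight q (code t) / c) \<partial>count_space (UNIV :: unit ptree set)) =
    (\<integral>\<^sup>+t. ennreal (1 / c) * ennreal (word_weight q (code t)) \<partial>count_space (UNIV :: unit ptree set))"
    using c by (intro nn_integral_cong) (simp add: word_weight_nonneg flip: ennreal_mult)
  also have "\<dots> = ennreal (1 / c) * ennreal c" by (subst nn_integral_cmult) (simp_all add: total_weight)
  also have "\<dots> = 1" using c by (simp flip: ennreal_mult)
  finally show "(\<integral>\<^sup>+t. ennreal (word_weight q (code t) / c) \<partial>count_space (UNIV :: unit ptree set)) = 1" .
qed (use c in \<open>simp add: word_weight_nonneg\<close>)

lemma prod_word_weight: "(\<Prod>t\<leftarrow>ts. word_weight q (code t)) = c ^ length ts * (\<Prod>t\<leftarrow>ts. pmf gw t)"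
  using c by (induction ts) (simp_all add: pmf_gw)

text \<open>Normalising the weights of the children brings out one factor \<open>c\<close> for each,
  against a single division for the whole tree: this is the origin of the exponent
  \<open>k - 1\<close> in \<open>\<pi>_tilde\<close>.\<close>

lemma pmf_gw_Node:
  "pmf gw (Node () ts) = (pmf q (length ts) * c ^ length ts / c) * pmf (replicate_pmf (length ts) gw) ts"
  by (simp add: pmf_gw[of "Node () ts"] word_weight_code[of q "()"] prod_word_weight pmf_replicate_pmf
      del: code.simps)

definition offspring :: "nat pmf" where
  "offspring = map_pmf num_children gw"

lemma pmf_offspring: "pmf offspring k = pmf q k * c ^ k / c"
proof -
  have "ennreal (pmf offspring k) = emeasure gw {t. num_children t = k}"
    unfolding offspring_def pmf_map by (simp add: measure_pmf.emeasure_eq_measure vimage_def)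
  also have "\<dots> = (\<integral>\<^sup>+t. pmf gw t \<partial>count_space {t. num_children t = k})"
    by (simp add: nn_integral_pmf)
  also have "\<dots> = (\<integral>\<^sup>+ts. pmf gw (Node () ts) \<partial>count_space {ts. length ts = k})"
  proof (rule nn_integral_bij_count_space[symmetric])
    show "bij_betw (Node ()) {ts. length ts = k} {t. num_children t = k}"
    proof (rule bij_betw_byWitness[where f' = children])
      show "\<forall>t\<in>{t. num_children t = k}. Node () (children t) = t" by (metis old.unit.exhaust ptree.collapse)
    qed auto
  qed
  also have "\<dots> = (\<integral>\<^sup>+ts. ennreal (pmf q k * c ^ k / c) * pmf (replicate_pmf k gw) ts \<partial>count_space {ts. length ts = k})"
    using c by (intro nn_integral_cong) (auto simp: pmf_gw_Node simp flip: ennreal_mult)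
  also have "\<dots> = ennreal (pmf q k * c ^ k / c) * emeasure (replicate_pmf k gw) {ts. length ts = k}"
    by (subst nn_integral_cmult) (simp_all add: nn_integral_pmf)
  also have "emeasure (replicate_pmf k gw) {ts. length ts = k} = 1"
    by (rule measure_pmf.emeasure_eq_1_AE) (auto simp: AE_measure_pmf_iff set_replicate_pmf)
  finally show ?thesis using c by simp
qed

text \<open>The event prescribes the offspring number at the finitely many addresses of
  \<open>t\<close>, so it is a cylinder whose measure is a product over vertices. By
  \<open>pmf_gw_Node\<close> the mass function obeys the same recursion.\<close>

lemma galton_watson_law_gw: "galton_watson_law offspring gw"
  unfolding galton_watson_law_def
proof
  fix t :: "unit ptree"
  let ?U = "\<lambda>t :: unit ptree. {u. subtree_at t u \<noteq> None}"
  let ?d = "\<lambda>u. num_children (the (subtree_at t u))"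
  interpret P: product_prob_space "\<lambda>_. measure_pmf offspring" "UNIV :: nat list set" ..
  have "{N. \<forall>u s. subtree_at t u = Some s \<longrightarrow> num_children s = N u} =
    prod_emb UNIV (\<lambda>_. measure_pmf offspring) (?U t) (PiE (?U t) (\<lambda>u. {?d u}))"
    by (fastforce simp: prod_emb_def space_PiM Pi_iff)
  then have "measure (\<Pi>\<^sub>M u\<in>UNIV. measure_pmf offspring)
      {N. \<forall>u s. subtree_at t u = Some s \<longrightarrow> num_children s = N u} =
    (\<Prod>u\<in>?U t. measure (measure_pmf offspring) {?d u})"
    using P.measure_PiM_emb[of "?U t" "\<lambda>u. {?d u}"] finite_addresses[of t] by simp
  also have "\<dots> = (\<Prod>u\<in>?U t. pmf offspring (?d u))" by (simp add: measure_pmf_single)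
  also have "\<dots> = pmf gw t"
  proof (induction t)
    case (Node m ts)
    have "(\<Prod>u\<in>?U (Node m ts). pmf offspring (num_children (the (subtree_at (Node m ts) u)))) =
      pmf offspring (length ts) * (\<Prod>t\<leftarrow>ts. \<Prod>u\<in>?U t. pmf offspring (num_children (the (subtree_at t u))))"
      by (subst prod_addresses[where f = "\<lambda>s. pmf offspring (num_children s)"]) simp
    also have "(\<Prod>t\<leftarrow>ts. \<Prod>u\<in>?U t. pmf offspring (num_children (the (subtree_at t u)))) = (\<Prod>t\<leftarrow>ts. pmf gw t)"
      using Node by (intro arg_cong[of _ _ prod_list] map_cong) auto
    finally show ?case by (simp add: pmf_offspring pmf_gw_Node pmf_replicate_pmf)
  qed
  finally show "pmf gw t = measure (\<Pi>\<^sub>M u\<in>UNIV. measure_pmf offspring)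
      {N. \<forall>u s. subtree_at t u = Some s \<longrightarrow> num_children s = N u}" by simp
qed

text \<open>That \<open>offspring\<close> has total mass one says precisely that \<open>c\<close> is
  a fixed point of the generating function of \<open>q\<close>.\<close>

lemma expectation_c_power: "measure_pmf.expectation q (\<lambda>k. c ^ k) = c"
proof -
  have "(\<integral>\<^sup>+k. ennreal (c ^ k) \<partial>q) = (\<integral>\<^sup>+k. ennreal c * pmf offspring k \<partial>count_space UNIV)"
    unfolding nn_integral_measure_pmf using c
    by (intro nn_integral_cong) (simp add: pmf_offspring flip: ennreal_mult)
  also have "\<dots> = ennreal c" by (subst nn_integral_cmult) (simp_all add: nn_integral_pmf)
  finally have *: "(\<integral>\<^sup>+k. ennreal (c ^ k) \<partial>q) = ennreal c" .
  show ?thesis using c by (subst integral_eq_nn_integral) (simp_all add: *)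
qed

section \<open>Subcriticality of the offspring law\<close>

lemma integrable_bounded: "(\<And>k. \<bar>f k\<bar> \<le> B) \<Longrightarrow> integrable (measure_pmf q) (f :: nat \<Rightarrow> real)"
  by (rule measure_pmf.integrable_const_bound[where B = B]) auto

lemma c_power: "0 \<le> c ^ k" "c ^ k \<le> 1"
  using c by (simp_all add: power_le_one)

text \<open>If only 0 and 1 were charged, \<open>c ^ k - c\<close> would be nonnegative with mean
  zero, hence would vanish at \<open>k = 0\<close>, where it equals \<open>1 - c\<close>.\<close>

lemma set_pmf_ge_2: "\<exists>k\<in>set_pmf q. k \<ge> 2"
proof (rule ccontr)
  assume "\<not> ?thesis"
  then have le1: "k = 0 \<or> k = 1" if "k \<in> set_pmf q" for k using that by fastforce
  have int: "integrable (measure_pmf q) (\<lambda>k. c ^ k)" using c_power by (intro integrable_bounded[of _ 1]) simp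
  have "measure_pmf.expectation q (\<lambda>k. c ^ k - c) = 0"
    using int by (simp add: expectation_c_power)
  moreover have "AE k in measure_pmf q. 0 \<le> c ^ k - c"
    using c by (auto simp: AE_measure_pmf_iff dest!: le1)
  ultimately have "AE k in measure_pmf q. c ^ k - c = 0"
    using int by (subst (asm) integral_nonneg_eq_0_iff_AE) auto
  moreover have "0 \<in> set_pmf q" using q0 by (simp add: set_pmf_iff)
  ultimately show False using c by (auto simp: AE_measure_pmf_iff)
qed

text \<open>The offspring mean is the derivative of the generating function of \<open>q\<close> at
  \<open>c\<close>. As \<open>c\<close> and 1 are fixed points, the chord between them has slope 1,
  and strict convexity puts the derivative at the left end below it.\<close>

lemma mean_offspring: "(\<integral>\<^sup>+k. of_nat k \<partial>measure_pmf offspring) < 1"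
proof -
  have geo: "(1 - c) * (\<Sum>i<k. c ^ i) = 1 - c ^ k" for k
    using c by (simp add: sum_gp_strict)
  have kc: "real k * c ^ k / c \<le> (\<Sum>i<k. c ^ i)" for k
  proof (cases k)
    case (Suc m)
    have "(\<Sum>i<k. c ^ m) \<le> (\<Sum>i<k. c ^ i)"
      using c Suc by (intro sum_mono power_decreasing) auto
    then show ?thesis using c Suc by simp
  qed simp
  \<comment> \<open>\<open>h k\<close> is the gap at 1 between the function \<open>s ^ k\<close> and
    its tangent at \<open>s = c\<close>: nonnegative, and positive for \<open>k \<ge> 2\<close>. Its
    mean is \<open>(1 - c) * (1 - m)\<close>.\<close>
  define h where "h k = (1 - c ^ k) - (1 - c) * (real k * c ^ k / c)" for k
  have h: "h k = (1 - c) * ((\<Sum>i<k. c ^ i) - real k * c ^ k / c)" for k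
    by (simp add: h_def geo[symmetric] right_diff_distrib)
  have h0: "h k \<ge> 0" for k unfolding h using kc[of k] c by simp
  \<comment> \<open>Nonnegativity of \<open>h\<close> bounds the derivative term uniformly in
    \<open>k\<close>, which gives integrability.\<close>
  have kb: "\<bar>real k * c ^ k / c\<bar> \<le> 1 / (1 - c)" for k
  proof -
    have "(1 - c) * (real k * c ^ k / c) \<le> 1" using h0[of k] c_power[of k] by (simp add: h_def)
    then show ?thesis using c by (simp add: pos_le_divide_eq mult.commute)
  qed
  have int: "integrable (measure_pmf q) (\<lambda>k. c ^ k)" "integrable (measure_pmf q) (\<lambda>k. real k * c ^ k / c)"
    using c_power by (intro integrable_bounded[of _ 1], simp) (rule integrable_bounded[OF kb])
  define m where "m = measure_pmf.expectation q (\<lambda>k. real k * c ^ k / c)"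
  have Eh: "measure_pmf.expectation q h = (1 - c) - (1 - c) * m"
    unfolding h_def m_def using int by (simp add: expectation_c_power del: times_divide_eq_right)
  have "measure_pmf.expectation q h \<noteq> 0"
  proof
    assume "measure_pmf.expectation q h = 0"
    moreover have "integrable (measure_pmf q) h" unfolding h_def
      by (intro Bochner_Integration.integrable_diff integrable_mult_right int) simp
    ultimately have "AE k in measure_pmf q. h k = 0"
      using h0 by (subst (asm) integral_nonneg_eq_0_iff_AE) auto
    moreover obtain k where k: "k \<in> set_pmf q" "k \<ge> 2" using set_pmf_ge_2 by auto
    ultimately have "(\<Sum>i<k. c ^ i) = real k * c ^ k / c" using c by (auto simp: AE_measure_pmf_iff h)
    moreover obtain l where l: "k = Suc (Suc l)" using k(2) by (metis Suc_1 Suc_le_D Suc_le_mono numeral_2_eq_2)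
    have "(\<Sum>i<k. c ^ Suc l) < (\<Sum>i<k. c ^ i)"
    proof (rule sum_strict_mono_ex1)
      show "\<forall>i\<in>{..<k}. c ^ Suc l \<le> c ^ i" using c l by (intro ballI power_decreasing) auto
      have "c ^ Suc l < c ^ 0" using c by (intro power_strict_decreasing) auto
      then show "\<exists>i\<in>{..<k}. c ^ Suc l < c ^ i" using k(2) by (intro bexI[of _ 0]) auto
    qed simp
    ultimately show False using c l by simp
  qed
  moreover have "measure_pmf.expectation q h \<ge> 0" using h0 by simp
  ultimately have "measure_pmf.expectation q h > 0" by simp
  then have "(1 - c) * m < (1 - c) * 1" using Eh by simp
  then have "m < 1" using c by (simp only: mult_less_cancel_left_pos)
  have "(\<integral>\<^sup>+k. of_nat k \<partial>measure_pmf offspring) = (\<integral>\<^sup>+k. ennreal (real k * c ^ k / c) \<partial>measure_pmf q)"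
    unfolding nn_integral_measure_pmf using c
    by (intro nn_integral_cong) (simp add: pmf_offspring ennreal_of_nat_eq_real_of_nat mult_ac flip: ennreal_mult)
  also have "\<dots> = ennreal m"
    unfolding m_def using int(2) c by (intro nn_integral_eq_integral) auto
  finally show ?thesis using \<open>m < 1\<close> by simp
qed

section \<open>The law of the marked bush\<close>

definition type_children :: "(nat \<times> nat) pmf" where
  "type_children = embed_pmf (\<lambda>(n, k). pmf q (n + k + 1) * c ^ k)"

text \<open>With \<open>j = n + k + 1\<close> the total mass is a sum over \<open>k < j\<close>; the
  geometric sums turn it into the mean of \<open>(1 - c ^ j) / (1 - c)\<close> under
  \<open>q\<close>, which is 1 because \<open>c\<close> is a fixed point.\<close>

lemma pmf_type_children: "pmf type_children (n, k) = pmf q (n + k + 1) * c ^ k"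
proof -
  let ?f = "\<lambda>(j, k). pmf q j * c ^ k"
  have geo: "(\<Sum>i<k. c ^ i) = (1 - c ^ k) / (1 - c)" for k
    using c by (simp add: sum_gp_strict)
  have int: "integrable (measure_pmf q) (\<lambda>k. c ^ k)" using c_power by (intro integrable_bounded[of _ 1]) simp
  have "(\<integral>\<^sup>+x. ennreal ((\<lambda>(n, k). pmf q (n + k + 1) * c ^ k) x) \<partial>count_space UNIV) =
      (\<integral>\<^sup>+x. ennreal (?f ((\<lambda>(n, k). (n + k + 1, k)) x)) \<partial>count_space UNIV)"
    by (intro nn_integral_cong) (auto simp: case_prod_unfold)
  also have "\<dots> = (\<integral>\<^sup>+x. ennreal (?f x) \<partial>count_space {(j, k). k < j})"
  proof (rule nn_integral_bij_count_space)
    show "bij_betw (\<lambda>(n, k). (n + k + 1, k)) UNIV {(j, k :: nat). k < j}"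
      by (rule bij_betw_byWitness[where f' = "\<lambda>(j, k). (j - k - 1, k)"]) auto
  qed
  also have "\<dots> = (\<integral>\<^sup>+x. ennreal (?f x) * indicator {(j, k). k < j} x \<partial>count_space UNIV)"
    by (rule nn_integral_count_space_indicator) simp
  also have "\<dots> = (\<integral>\<^sup>+j. \<integral>\<^sup>+k. ennreal (?f (j, k)) * indicator {(j, k). k < j} (j, k) \<partial>count_space UNIV \<partial>count_space UNIV)"
    by (rule nn_integral_fst_count_space[symmetric])
  also have "\<dots> = (\<integral>\<^sup>+j. ennreal (pmf q j) * ennreal ((1 - c ^ j) / (1 - c)) \<partial>count_space UNIV)"
  proof (rule nn_integral_cong)
    fix j
    have "(\<integral>\<^sup>+k. ennreal (?f (j, k)) * indicator {(j, k). k < j} (j, k) \<partial>count_space UNIV) =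
      (\<integral>\<^sup>+k. ennreal (pmf q j * c ^ k) * indicator {..<j} k \<partial>count_space UNIV)"
      by (intro nn_integral_cong) (auto simp: indicator_def)
    also have "\<dots> = (\<integral>\<^sup>+k. ennreal (pmf q j * c ^ k) \<partial>count_space {..<j})"
      by (rule nn_integral_count_space_indicator[symmetric]) simp
    also have "\<dots> = ennreal (\<Sum>k<j. pmf q j * c ^ k)"
      using c by (subst nn_integral_count_space_finite) (auto intro!: sum_ennreal)
    also have "(\<Sum>k<j. pmf q j * c ^ k) = pmf q j * ((1 - c ^ j) / (1 - c))"
      unfolding geo[symmetric] by (simp add: sum_distrib_left)
    finally show "(\<integral>\<^sup>+k. ennreal (?f (j, k)) * indicator {(j, k). k < j} (j, k) \<partial>count_space UNIV) =
      ennreal (pmf q j) * ennreal ((1 - c ^ j) / (1 - c))"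
      using c c_power[of j] by (simp flip: ennreal_mult)
  qed
  also have "\<dots> = (\<integral>\<^sup>+j. ennreal ((1 - c ^ j) / (1 - c)) \<partial>q)"
    by (simp add: nn_integral_measure_pmf)
  also have "\<dots> = ennreal (measure_pmf.expectation q (\<lambda>j. (1 - c ^ j) / (1 - c)))"
    using int c c_power by (intro nn_integral_eq_integral) auto
  also have "measure_pmf.expectation q (\<lambda>j. (1 - c ^ j) / (1 - c)) = 1"
    using int c by (simp add: expectation_c_power)
  finally have "(\<integral>\<^sup>+x. ennreal ((\<lambda>(n, k). pmf q (n + k + 1) * c ^ k) x) \<partial>count_space UNIV) = 1" by simp
  then show ?thesis
    unfolding type_children_def using c by (subst pmf_embed_pmf) auto
qed

text \<open>Mark and number of children are drawn jointly, then the subtrees given the number alone,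
  so the conditional independence of the mark is built in.\<close>

definition marked_children :: "(nat \<times> unit ptree list) pmf" where
  "marked_children = bind_pmf type_children (\<lambda>(n, k). map_pmf (Pair n) (replicate_pmf k gw))"

lemma pmf_marked_children:
  "pmf marked_children (n, ts) = pmf type_children (n, length ts) * pmf (replicate_pmf (length ts) gw) ts"
proof -
  have "pmf (map_pmf (Pair m) (replicate_pmf k gw)) (n, ts) =
      pmf (replicate_pmf (length ts) gw) ts * indicator {(n, length ts)} (m, k)" for m k
  proof (cases "m = n")
    case True
    then show ?thesis
      using pmf_map_inj'[of "Pair n" "replicate_pmf k gw" ts]
      by (auto simp: pmf_replicate_pmf inj_on_def indicator_def)
  next
    case False
    then have "pmf (map_pmf (Pair m) (replicate_pmf k gw)) (n, ts) = 0" by (intro pmf_map_outside) auto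
    then show ?thesis using False by simp
  qed
  then have "pmf marked_children (n, ts) =
      measure_pmf.expectation type_children (\<lambda>x. pmf (replicate_pmf (length ts) gw) ts * indicator {(n, length ts)} x)"
    unfolding marked_children_def pmf_bind by (intro Bochner_Integration.integral_cong) auto
  then show ?thesis by (simp add: measure_pmf_single)
qed

definition bush :: "int ptree pmf" where
  "bush = map_pmf spine_bush_of marked_children"

lemma pmf_bush_of: "pmf bush (spine_bush_of (n, ts)) = pmf marked_children (n, ts)"
  unfolding bush_def by (rule pmf_map_inj'[OF inj_spine_bush_of])

text \<open>Links the sampling description to the walk: the factor \<open>c ^ k\<close> in the joint
  law of mark and number of children cancels the normalisations of the \<open>k\<close> subtrees,
  which leaves the weight of the word.\<close>

lemma pmf_bush: "pmf bush t = (if spine_bush t then word_weight q (bush_code t) else 0)"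
proof (cases "spine_bush t")
  case True
  then obtain n ts where t: "t = spine_bush_of (n, ts)" by (auto simp: spine_bush_iff)
  have "nat (int n + int (length ts) + 1) = n + length ts + 1" by simp
  then have "word_weight q (bush_code t) = pmf q (n + length ts + 1) * (\<Prod>t\<leftarrow>ts. word_weight q (code t))"
    unfolding t bush_code_spine_bush_of word_weight_forest[symmetric] by (simp add: word_weight_def)
  then show ?thesis using True unfolding t pmf_bush_of pmf_marked_children pmf_type_children
    by (simp add: prod_word_weight pmf_replicate_pmf)
next
  case False
  then have "t \<notin> spine_bush_of ` set_pmf marked_children" by (auto simp: spine_bush_iff)
  then show ?thesis using False by (simp add: bush_def pmf_map_outside)
qed

definition spine_offspring :: "nat pmf" where
  "spine_offspring = map_pmf snd type_children"

text \<open>Summing over the mark \<open>n\<close> amounts to summing \<open>q\<close> over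
  \<open>j = n + k + 1\<close>, that is, over all \<open>j > k\<close>.\<close>

lemma pmf_spine_offspring: "pmf spine_offspring k = c ^ k * measure (measure_pmf q) {k + 1..}"
proof -
  have "ennreal (pmf spine_offspring k) = emeasure type_children {x. snd x = k}"
    unfolding spine_offspring_def pmf_map by (simp add: measure_pmf.emeasure_eq_measure vimage_def)
  also have "\<dots> = (\<integral>\<^sup>+x. pmf type_children x \<partial>count_space {x. snd x = k})"
    by (simp add: nn_integral_pmf)
  also have "\<dots> = (\<integral>\<^sup>+j. pmf type_children (j - k - 1, k) \<partial>count_space {k + 1..})"
  proof (rule nn_integral_bij_count_space[symmetric])
    show "bij_betw (\<lambda>j. (j - k - 1, k)) {k + 1..} {x. snd x = k}"
      by (rule bij_betw_byWitness[where f' = "\<lambda>(n, _). n + k + 1"]) auto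
  qed
  also have "\<dots> = (\<integral>\<^sup>+j. ennreal (c ^ k) * pmf q j \<partial>count_space {k + 1..})"
    using c by (intro nn_integral_cong) (auto simp: pmf_type_children mult_ac simp flip: ennreal_mult)
  also have "\<dots> = ennreal (c ^ k) * ennreal (measure (measure_pmf q) {k + 1..})"
    by (subst nn_integral_cmult) (simp_all add: nn_integral_pmf measure_pmf.emeasure_eq_measure)
  finally show ?thesis using c by (simp flip: ennreal_mult)
qed

text \<open>The tail probability is at most 1, so the mean is dominated by the differentiated
  geometric series.\<close>

lemma mean_spine_offspring: "(\<integral>\<^sup>+k. of_nat k \<partial>measure_pmf spine_offspring) < \<infinity>"
proof -
  have "(\<integral>\<^sup>+k. of_nat k \<partial>measure_pmf spine_offspring) =
      (\<integral>\<^sup>+k. ennreal (pmf spine_offspring k * real k) \<partial>count_space UNIV)"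
    unfolding nn_integral_measure_pmf
    by (intro nn_integral_cong) (simp add: ennreal_mult ennreal_of_nat_eq_real_of_nat)
  also have "\<dots> \<le> (\<integral>\<^sup>+k. ennreal (real (Suc k) * c ^ k) \<partial>count_space UNIV)"
  proof (intro nn_integral_mono ennreal_leI)
    fix k
    have "pmf spine_offspring k \<le> c ^ k * 1"
      unfolding pmf_spine_offspring using c by (intro mult_left_mono) auto
    then show "pmf spine_offspring k * real k \<le> real (Suc k) * c ^ k"
      using c mult_mono[of "pmf spine_offspring k" "c ^ k" "real k" "real (Suc k)"] by (simp add: mult.commute)
  qed
  also have "\<dots> = (\<Sum>k. ennreal (real (Suc k) * c ^ k))" by (rule nn_integral_count_space_nat)
  also have "\<dots> = ennreal (1 / (1 - c)\<^sup>2)"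
    using geometric_deriv_sums[of c] c by (intro suminf_ennreal_eq) auto
  finally show ?thesis using ennreal_less_top order_le_less_trans by (metis infinity_ennreal_def)
qed

lemma map_unmark_bush:
  "map_pmf unmark bush = bind_pmf spine_offspring (\<lambda>k. map_pmf (Node ()) (replicate_pmf k gw))"
proof -
  have "unmark \<circ> spine_bush_of = (\<lambda>x. Node () (snd x))" by (auto simp: fun_eq_iff unmark_spine_bush_of)
  then have "map_pmf unmark bush = map_pmf (\<lambda>x. Node () (snd x)) marked_children"
    by (simp add: bush_def pmf.map_comp)
  then show ?thesis
    unfolding marked_children_def spine_offspring_def
    by (simp add: map_bind_pmf bind_map_pmf pmf.map_comp comp_def case_prod_unfold)
qed

lemma bush_law_bush: "bush_law spine_offspring offspring bush"
  unfolding bush_law_def using galton_watson_law_gw map_unmark_bush by blast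

lemma children_bush: "t \<in> set_pmf bush \<Longrightarrow> s \<in> set (children t) \<Longrightarrow> set_ptree s = {- 1}"
  by (auto simp: set_pmf_iff pmf_bush spine_bush_def split: if_splits)

lemma map_marked_children: "map_pmf (\<lambda>(n, ts). (n, length ts)) marked_children = type_children"
proof -
  have "map_pmf (\<lambda>(n, ts). (n, length ts)) marked_children =
      bind_pmf type_children (\<lambda>x. map_pmf (\<lambda>ts. (fst x, length ts)) (replicate_pmf (snd x) gw))"
    unfolding marked_children_def by (simp add: map_bind_pmf pmf.map_comp comp_def case_prod_unfold)
  also have "\<dots> = bind_pmf type_children (\<lambda>x. map_pmf (\<lambda>_. x) (replicate_pmf (snd x) gw))"
    by (intro bind_pmf_cong refl pmf.map_cong) (auto simp: set_replicate_pmf)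
  finally show ?thesis by (simp add: bind_return_pmf')
qed

lemma prob_mark_children:
  "measure bush {t. root_mark t = int n \<and> num_children t = k} = pmf q (n + k + 1) * c ^ k"
proof -
  have "measure bush {t. root_mark t = int n \<and> num_children t = k} =
      measure marked_children ((\<lambda>(n, ts). (n, length ts)) -` {(n, k)})"
    unfolding bush_def measure_map_pmf by (rule arg_cong[of _ _ "measure _"]) (auto simp: spine_bush_of_def)
  also have "\<dots> = pmf type_children (n, k)"
    unfolding pmf_map[symmetric] map_marked_children ..
  finally show ?thesis by (simp add: pmf_type_children)
qed

lemma prob_negative_mark: "n < 0 \<Longrightarrow> measure bush {t. root_mark t = n \<and> Q t} = 0"
proof -
  assume "n < 0"
  then have *: "spine_bush_of -` {t. root_mark t = n \<and> Q t} = {}" by (auto simp: spine_bush_of_def)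
  show ?thesis unfolding bush_def measure_map_pmf * by simp
qed

lemma prob_num_children: "measure bush {t. num_children t = k} = pmf spine_offspring k"
proof -
  have "measure bush {t. num_children t = k} =
      measure marked_children ((snd \<circ> (\<lambda>(n, ts). (n, length ts))) -` {k})"
    unfolding bush_def measure_map_pmf by (rule arg_cong[of _ _ "measure _"]) (auto simp: spine_bush_of_def)
  also have "\<dots> = pmf spine_offspring k"
    unfolding pmf_map[symmetric] pmf.map_comp[symmetric] map_marked_children spine_offspring_def ..
  finally show ?thesis .
qed

lemma prob_unmark:
  "measure bush {t. unmark t = Node () ts} =
     pmf spine_offspring (length ts) * pmf (replicate_pmf (length ts) gw) ts"
proof -
  have "pmf (map_pmf (Node ()) (replicate_pmf k gw)) (Node () ts) =
      pmf (replicate_pmf (length ts) gw) ts * indicator {length ts} k" for k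
    using pmf_map_inj'[of "Node ()" "replicate_pmf k gw" ts]
    by (auto simp: pmf_replicate_pmf inj_on_def indicator_def)
  then have "pmf (map_pmf unmark bush) (Node () ts) =
    pmf spine_offspring (length ts) * pmf (replicate_pmf (length ts) gw) ts"
    unfolding map_unmark_bush pmf_bind by (simp add: measure_pmf_single)
  then show ?thesis by (simp add: pmf_map vimage_def)
qed

lemma prob_mark_unmark:
  "measure bush {t. root_mark t = int n \<and> unmark t = Node () ts} =
     pmf type_children (n, length ts) * pmf (replicate_pmf (length ts) gw) ts"
proof -
  have "measure bush {t. root_mark t = int n \<and> unmark t = Node () ts} = measure marked_children {(n, ts)}"
    unfolding bush_def measure_map_pmf
    by (rule arg_cong[of _ _ "measure _"])
      (auto simp: unmark_spine_bush_of simp flip: ptree.map_comp, auto simp: spine_bush_of_def unmark_map_ptree comp_def)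
  then show ?thesis by (simp add: measure_pmf_single pmf_marked_children)
qed

text \<open>The list of subtrees contributes the same factor to the numerator and the denominator on
  the left; it is nonzero by assumption and cancels.\<close>

lemma conditional_mark:
  assumes "measure bush {t. unmark t = \<tau>} > 0"
  shows "measure bush {t. root_mark t = n \<and> unmark t = \<tau>} / measure bush {t. unmark t = \<tau>} =
    measure bush {t. root_mark t = n \<and> num_children t = num_children \<tau>} /
    measure bush {t. num_children t = num_children \<tau>}"
proof -
  obtain ts where \<tau>: "\<tau> = Node () ts" by (cases \<tau>) auto
  have r: "pmf (replicate_pmf (length ts) gw) ts \<noteq> 0" using assms by (auto simp: \<tau> prob_unmark)
  show ?thesis
  proof (cases "n < 0")
    case True
    then show ?thesis using prob_negative_mark by simp
  next
    case False
    then obtain m where "n = int m" by (metis nonneg_int_cases not_less)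
    then show ?thesis using r
      by (simp add: \<tau> prob_mark_unmark prob_unmark prob_mark_children prob_num_children pmf_type_children)
  qed
qed

end

section \<open>Windows of the walk between records\<close>


definition forward_word :: "(int \<Rightarrow> int) \<Rightarrow> int \<Rightarrow> nat \<Rightarrow> int list" where
  "forward_word x i k = map (\<lambda>l. x (i + int l)) [0..<k]"

lemma length_forward_word [simp]: "length (forward_word x i k) = k"
  by (simp add: forward_word_def)

lemma forward_word_0 [simp]: "forward_word x i 0 = []"
  by (simp add: forward_word_def)

lemma forward_word_add: "forward_word x i (a + b) = forward_word x i a @ forward_word x (i + int a) b"
  by (rule nth_equalityI) (auto simp: forward_word_def nth_append algebra_simps)

lemma rev_back_word: "rev (back_word x j k) = forward_word x (j - int k) k"
  by (rule nth_equalityI) (auto simp: forward_word_def back_word_def rev_nth of_nat_diff algebra_simps)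

lemma forward_word_eq_append_iff:
  "forward_word x i (length u + length v) = u @ v \<longleftrightarrow>
     forward_word x i (length u) = u \<and> forward_word x (i + int (length u)) (length v) = v"
  unfolding forward_word_add by (subst append_eq_append_conv) auto

lemma back_word_eq_iff: "back_word x j (length w) = w \<longleftrightarrow> forward_word x (j - int (length w)) (length w) = rev w"
  using rev_back_word[of x j "length w"] by (metis rev_rev_ident)

lemma forward_word_eq_iff: "forward_word x i (length w) = w \<longleftrightarrow> (\<forall>l<length w. x (i + int l) = w ! l)"
  by (subst list_eq_iff_nth_eq) (simp add: forward_word_def)

text \<open>Steps are at least - 1, so the first negative partial sum is - 1. Earlier partial sums
  are nonnegative, hence the suffix sums of the word up to that time are negative and it parses,
  into exactly one tree.\<close>

lemma prefix_code_iff: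
  fixes y :: "nat \<Rightarrow> int"
  assumes "\<And>l. y l \<ge> - 1"
  shows "(\<exists>k. (\<Sum>l<k. y l) < 0) \<longleftrightarrow> (\<exists>t :: unit ptree. map y [0..<length (code t)] = code t)"
proof
  assume "\<exists>k. (\<Sum>l<k. y l) < 0"
  define k where "k = (LEAST k. (\<Sum>l<k. y l) < 0)"
  have k: "(\<Sum>l<k. y l) < 0" unfolding k_def by (rule LeastI_ex) fact
  have less: "(\<Sum>l<m. y l) \<ge> 0" if "m < k" for m
    using not_less_Least[OF that[unfolded k_def]] by simp
  define w where "w = map y [0..<k]"
  have sum_take: "sum_list (take m w) = (\<Sum>l<m. y l)" if "m \<le> k" for m
    using that by (simp add: w_def take_map sum_set_upt_conv_sum_list_nat[symmetric] atLeast0LessThan[symmetric])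
  have "sum_list (drop m w) < 0" if "m < length w" for m
  proof -
    have "sum_list w = sum_list (take m w) + sum_list (drop m w)" by (metis append_take_drop_id sum_list_append)
    then show ?thesis using less[of m] k sum_take[of m] sum_take[of k] that by (simp add: w_def)
  qed
  then have c: "concat (map code (parse () w)) = w \<and> int (length (parse () w)) = - sum_list w"
    using assms by (intro code_parse) (auto simp: w_def)
  obtain k' where k': "k = Suc k'" using k by (cases k) auto
  have "sum_list w \<ge> - 1"
    using less[of k'] assms[of k'] sum_take[of k] by (simp add: k' w_def)
  moreover have "sum_list w < 0" using k sum_take[of k] by (simp add: w_def)
  ultimately have "length (parse () w) = 1" using c by linarith
  then obtain t where "parse () w = [t]" by (auto simp: length_Suc_conv)
  then have "code t = w" using c by simp
  then show "\<exists>t :: unit ptree. map y [0..<length (code t)] = code t"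
    by (intro exI[of _ t]) (simp add: w_def)
next
  assume "\<exists>t :: unit ptree. map y [0..<length (code t)] = code t"
  then obtain t :: "unit ptree" where t: "map y [0..<length (code t)] = code t" ..
  have "(\<Sum>l<length (code t). y l) = sum_list (map y [0..<length (code t)])"
    by (simp add: sum_set_upt_conv_sum_list_nat[symmetric] atLeast0LessThan[symmetric])
  then show "\<exists>k. (\<Sum>l<k. y l) < 0" unfolding t by (intro exI[of _ "length (code t)"]) (simp add: sum_list_code)
qed

text \<open>Codes are prefix-free: two codes at the start of one sequence are both the first tree of
  a common parse.\<close>

lemma prefix_code_unique:
  fixes s t :: "unit ptree"
  assumes "map y [0..<length (code s)] = code s" "map y [0..<length (code t)] = code t"
  shows "s = t"
proof -
  define n where "n = max (length (code s)) (length (code t))"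
  have "\<exists>v. map y [0..<n] = code u @ v" if "map y [0..<length (code u)] = code u" "length (code u) \<le> n"
    for u :: "unit ptree"
  proof -
    have "[0..<n] = [0..<length (code u)] @ [length (code u)..<n]" using that(2)
      by (metis le0 upt_add_eq_append le_add_diff_inverse)
    then show ?thesis using that(1) by (metis map_append)
  qed
  then obtain v v' where "map y [0..<n] = code s @ v" "map y [0..<n] = code t @ v'"
    using assms unfolding n_def by (metis max.cobounded1 max.cobounded2)
  then have "parse () (code s @ v) = parse () (code t @ v')" by simp
  moreover have "set_ptree u \<subseteq> {()}" for u :: "unit ptree" by auto
  ultimately show ?thesis by (simp add: parse_code)
qed

lemma walk_sum_backward: "(\<Sum>l<k. x (j - 1 - int l)) = walk_sum x (j - int k) j"
  unfolding walk_sum_def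
  by (rule sum.reindex_bij_witness[of _ "\<lambda>l. nat (j - 1 - l)" "\<lambda>l. j - 1 - int l"]) auto

lemma hits_minus_one_iff:
  assumes "\<And>l. x l \<ge> - 1"
  shows "(\<exists>n>0. (\<Sum>k<n. x (int k)) = - 1) \<longleftrightarrow>
    (\<exists>t :: unit ptree. forward_word x 0 (length (code t)) = code t)"
proof -
  have "(\<exists>n>0. (\<Sum>k<n. x (int k)) = - 1) \<longleftrightarrow> (\<exists>n. (\<Sum>k<n. x (int k)) < 0)"
  proof
    assume "\<exists>n. (\<Sum>k<n. x (int k)) < 0"
    then obtain t :: "unit ptree" where t: "map (\<lambda>k. x (int k)) [0..<length (code t)] = code t"
      using prefix_code_iff[of "\<lambda>k. x (int k)"] assms by blast
    have "(\<Sum>k<length (code t). x (int k)) = sum_list (map (\<lambda>k. x (int k)) [0..<length (code t)])"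
      by (simp add: sum_set_upt_conv_sum_list_nat[symmetric] atLeast0LessThan[symmetric])
    then show "\<exists>n>0. (\<Sum>k<n. x (int k)) = - 1"
      unfolding t sum_list_code using code_nonempty[of t] by blast
  qed (metis neg_less_0_iff_less zero_less_one)
  then show ?thesis using prefix_code_iff[of "\<lambda>k. x (int k)"] assms by (simp add: forward_word_def)
qed

text \<open>Read backwards from \<open>j\<close>, failing to be a record is a first passage below
  zero, the same kind of event as the one defining \<open>c\<close>; so it splits along the same
  codes.\<close>

lemma not_past_record_iff:
  assumes "\<And>l. x l \<ge> - 1"
  shows "\<not> past_record x j \<longleftrightarrow> (\<exists>t :: unit ptree. back_word x j (length (code t)) = code t)"
proof -
  have "\<not> past_record x j \<longleftrightarrow> (\<exists>k. (\<Sum>l<k. x (j - 1 - int l)) < 0)"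
  proof
    assume "\<not> past_record x j"
    then obtain m where "m < j" "walk_sum x m j < 0" by (auto simp: past_record_def not_le)
    then show "\<exists>k. (\<Sum>l<k. x (j - 1 - int l)) < 0"
      unfolding walk_sum_backward by (intro exI[of _ "nat (j - m)"]) simp
  next
    assume "\<exists>k. (\<Sum>l<k. x (j - 1 - int l)) < 0"
    then obtain k where k: "walk_sum x (j - int k) j < 0" unfolding walk_sum_backward by blast
    then have "k > 0" by (cases k) auto
    then show "\<not> past_record x j" using k unfolding past_record_def by (auto simp: not_le intro!: exI[of _ "j - int k"])
  qed
  then show ?thesis using prefix_code_iff[of "\<lambda>l. x (j - 1 - int l)"] assms by (simp add: back_word_def)
qed

section \<open>Consecutive bushes as one word\<close>

definition join_code :: "int ptree list \<Rightarrow> int list" where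
  "join_code ts = concat (map (rev \<circ> bush_code) ts)"

lemma join_code_simps [simp]:
  "join_code [] = []" "join_code (t # ts) = rev (bush_code t) @ join_code ts"
  "join_code (ts @ ss) = join_code ts @ join_code ss"
  by (simp_all add: join_code_def)

lemma join_code_Cons_iff:
  "forward_word x i (length (join_code (t # ts))) = join_code (t # ts) \<longleftrightarrow>
     back_word x (i + int (length (bush_code t))) (length (bush_code t)) = bush_code t \<and>
     forward_word x (i + int (length (bush_code t))) (length (join_code ts)) = join_code ts"
  using forward_word_eq_append_iff[of x i "rev (bush_code t)" "join_code ts"]
  by (simp add: back_word_eq_iff)

lemma join_code_past_record:
  assumes "past_record x i" "forward_word x i (length (join_code ts)) = join_code ts"
    "\<And>t. t \<in> set ts \<Longrightarrow> spine_bush t"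
  shows "past_record x (i + int (length (join_code ts)))"
  using assms
proof (induction ts arbitrary: i)
  case (Cons t ts)
  define j where "j = i + int (length (bush_code t))"
  have w: "back_word x j (length (bush_code t)) = bush_code t"
    "forward_word x j (length (join_code ts)) = join_code ts"
    using Cons.prems(2) unfolding join_code_Cons_iff j_def by auto
  have "(i, j) \<in> record_edges x" using record_edge_bush_code(1)[OF w(1)] Cons.prems(3) by (simp add: j_def)
  then have "past_record x j" using Cons.prems(1) by (rule past_record_record_edges)
  then have "past_record x (j + int (length (join_code ts)))" using w(2) Cons.prems(3) by (intro Cons.IH) auto
  then show ?case by (simp add: j_def algebra_simps)
qed simp

text \<open>Each code spelled after a record ends at the image of that record, so it is the next
  bush. The induction moves the index \<open>m\<close> along.\<close>

lemma bush_seq_join_code: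
  assumes two: "two_sided_records x" and rec0: "past_record x 0"
    and "forward_word x (record_seq x m) (length (join_code ts)) = join_code ts"
    "\<And>t. t \<in> set ts \<Longrightarrow> spine_bush t"
  shows "record_seq x (m + int (length ts)) = record_seq x m + int (length (join_code ts)) \<and>
    (\<forall>l<length ts. bush_seq x (m + 1 + int l) = ts ! l)"
  using assms(3,4)
proof (induction ts arbitrary: m)
  case (Cons t ts)
  define j where "j = record_seq x m + int (length (bush_code t))"
  have w: "back_word x j (length (bush_code t)) = bush_code t"
    "forward_word x j (length (join_code ts)) = join_code ts"
    using Cons.prems(1) unfolding join_code_Cons_iff j_def by auto
  have e: "(record_seq x m, j) \<in> record_edges x" "bush_between x (record_seq x m) j = t"
    using record_edge_bush_code[OF w(1)] Cons.prems(2) by (simp_all add: j_def)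
  have j: "record_seq x (m + 1) = j"
    using record_seq[OF two rec0, of m] e(1) by (auto dest: record_edgesD(1))
  have IH: "record_seq x (m + 1 + int (length ts)) = j + int (length (join_code ts))"
    "\<forall>l<length ts. bush_seq x (m + 1 + 1 + int l) = ts ! l"
    using Cons.IH[of "m + 1"] w(2) Cons.prems(2) by (auto simp: j)
  have "bush_seq x (m + 1) = t" using e(2) by (simp add: bush_seq_def j)
  then have "bush_seq x (m + 1 + int l) = (t # ts) ! l" if "l < length (t # ts)" for l
    using IH(2) that by (cases l) (auto simp: algebra_simps)
  then show ?case using IH(1) by (auto simp: j_def algebra_simps)
qed simp

lemma join_code_bush_seq:
  assumes x: "\<And>l. x l \<ge> - 1" and two: "two_sided_records x" and rec0: "past_record x 0"
    and "\<And>l. l < length ts \<Longrightarrow> bush_seq x (m + 1 + int l) = ts ! l"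
  shows "record_seq x (m + int (length ts)) = record_seq x m + int (length (join_code ts)) \<and>
    forward_word x (record_seq x m) (length (join_code ts)) = join_code ts"
  using assms(4)
proof (induction ts arbitrary: m)
  case (Cons t ts)
  have t: "bush_between x (record_seq x m) (record_seq x (m + 1)) = t"
    using Cons.prems[of 0] by (simp add: bush_seq_def)
  note b = bush_between_record_edge[OF x record_seq[OF two rec0, of m], unfolded t]
  have len: "record_seq x (m + 1) = record_seq x m + int (length (bush_code t))" using b(3) by simp
  have IH: "record_seq x (m + 1 + int (length ts)) = record_seq x (m + 1) + int (length (join_code ts)) \<and>
    forward_word x (record_seq x (m + 1)) (length (join_code ts)) = join_code ts"
    using Cons.prems[of "Suc _"] by (intro Cons.IH) (auto simp: algebra_simps)
  then show ?case using b(1) unfolding join_code_Cons_iff len by (auto simp: algebra_simps)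
qed simp

text \<open>The first \<open>r\<close> bushes end at site 0, so the window starts at a site
  \<open>i\<close> determined by \<open>ts\<close> and \<open>r\<close> alone, and the random sites
  of the records disappear from the right-hand side.\<close>

lemma bush_window_iff:
  assumes x: "\<And>l. x l \<ge> - 1" and two: "two_sided_records x"
    and r: "r \<le> length ts" and ts: "\<And>t. t \<in> set ts \<Longrightarrow> spine_bush t"
  defines "i \<equiv> - int (length (join_code (take r ts)))"
  shows "past_record x 0 \<and> (\<forall>l<length ts. bush_seq x (1 - int r + int l) = ts ! l) \<longleftrightarrow>
    past_record x i \<and> forward_word x i (length (join_code ts)) = join_code ts"
proof
  assume l: "past_record x 0 \<and> (\<forall>l<length ts. bush_seq x (1 - int r + int l) = ts ! l)"
  have "record_seq x (- int r + int (length (take r ts))) = record_seq x (- int r) + int (length (join_code (take r ts)))"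
    using l r by (intro conjunct1[OF join_code_bush_seq] x two) (auto simp: algebra_simps)
  then have i: "record_seq x (- int r) = i" using r by (simp add: i_def min_absorb2)
  have "forward_word x (record_seq x (- int r)) (length (join_code ts)) = join_code ts"
    using l by (intro conjunct2[OF join_code_bush_seq] x two) (auto simp: algebra_simps)
  moreover have "past_record x i"
    using bi_infinite_path_records(1)[of "record_seq x" x] record_seq[OF two] l i by auto
  ultimately show "past_record x i \<and> forward_word x i (length (join_code ts)) = join_code ts"
    by (simp add: i)
next
  assume rhs: "past_record x i \<and> forward_word x i (length (join_code ts)) = join_code ts"
  have jc: "join_code ts = join_code (take r ts) @ join_code (drop r ts)"
    by (metis append_take_drop_id join_code_simps(3))
  have w: "forward_word x i (length (join_code (take r ts))) = join_code (take r ts)"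
    using rhs forward_word_eq_append_iff[of x i "join_code (take r ts)" "join_code (drop r ts)"] by (simp add: jc)
  have "past_record x (i + int (length (join_code (take r ts))))"
    using rhs w ts by (intro join_code_past_record) (auto dest: in_set_takeD)
  then have rec0: "past_record x 0" by (simp add: i_def)
  have e: "(record_seq x n, record_seq x (n + 1)) \<in> record_edges x" for n
    by (rule record_seq[OF two rec0])
  \<comment> \<open>Some index \<open>m\<close> belongs to the record at \<open>i\<close>. Decoding
    \<open>r\<close> bushes from there leads to site 0, and injectivity of \<open>record_seq\<close>
    forces \<open>m = - r\<close>.\<close>
  have "i \<in> range (record_seq x)" using bi_infinite_path_records(1)[of "record_seq x" x] e rhs by simp
  then obtain m where m: "record_seq x m = i" by auto
  have "record_seq x (m + int (length (take r ts))) = record_seq x m + int (length (join_code (take r ts)))"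
    using w ts by (intro conjunct1[OF bush_seq_join_code] two rec0) (auto simp: m dest: in_set_takeD)
  then have "record_seq x (m + int r) = record_seq x 0" using r by (simp add: m i_def min_absorb2)
  moreover have "strict_mono (record_seq x)"
    using e record_edgesD(2) by (intro int_step_mono(1)) blast
  ultimately have "m = - int r" by (metis strict_mono_eq add_eq_0_iff2)
  moreover have "\<forall>l<length ts. bush_seq x (m + 1 + int l) = ts ! l"
    using rhs ts by (intro conjunct2[OF bush_seq_join_code] two rec0) (auto simp: m)
  ultimately show "past_record x 0 \<and> (\<forall>l<length ts. bush_seq x (1 - int r + int l) = ts ! l)"
    using rec0 by (simp add: algebra_simps)
qed

lemma spine_bush_bush_seq:
  assumes "\<And>l. x l \<ge> - 1" "two_sided_records x" "past_record x 0"
  shows "spine_bush (bush_seq x n)"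
  using bush_between_record_edge(2)[OF assms(1) record_seq[OF assms(2,3), of "n - 1"]]
  by (simp add: bush_seq_def)

text \<open>A minimiser \<open>n\<close> of the sum from \<open>l - n\<close> to \<open>l\<close>
  marks a highest level of the past; it exists because the sums are eventually positive while the
  sum for \<open>n = 0\<close> is zero. Its site is a record.\<close>

lemma past_record_exists:
  assumes "\<exists>N. \<forall>n\<ge>N. walk_sum x (l - int n) l > 0"
  shows "\<exists>j\<le>l. past_record x j"
proof -
  obtain N where N: "\<And>n. n \<ge> N \<Longrightarrow> walk_sum x (l - int n) l > 0" using assms by blast
  define f where "f n = walk_sum x (l - int n) l" for n
  have "finite (f ` {..N})" "f ` {..N} \<noteq> {}" by auto
  then have "Min (f ` {..N}) \<in> f ` {..N}" by (rule Min_in)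
  then obtain n0 where n0: "f n0 = Min (f ` {..N})" by (metis imageE)
  have le: "f n0 \<le> f n" for n
  proof (cases "n \<le> N")
    case False
    then have "f n > 0" using N[of n] by (simp add: f_def)
    moreover have "f n0 \<le> f 0" unfolding n0 by (intro Min_le) auto
    ultimately show ?thesis by (simp add: f_def)
  qed (auto simp: n0 intro: Min_le)
  have "past_record x (l - int n0)" unfolding past_record_def
  proof (intro allI impI)
    fix m assume m: "m < l - int n0"
    then have "f (nat (l - m)) = walk_sum x m (l - int n0) + f n0"
      unfolding f_def by (subst walk_sum_split[of "l - int (nat (l - m))" "l - int n0" l]) auto
    then show "0 \<le> walk_sum x m (l - int n0)" using le[of "nat (l - m)"] by simp
  qed
  then show ?thesis by (intro exI[of _ "l - int n0"]) auto
qed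

text \<open>To the right, a last record is impossible: from every record the record map leads to a
  later one.\<close>

lemma two_sided_recordsI:
  assumes past: "\<And>l. \<exists>N. \<forall>n\<ge>N. walk_sum x (l - int n) l > 0"
    and forward: "\<And>i. \<exists>j>i. walk_sum x i j \<ge> 0"
  shows "two_sided_records x"
proof -
  have low: "\<exists>j<l. past_record x j" for l
    using past_record_exists[OF past, of "l - 1"] by force
  have "\<exists>j>l. past_record x j" for l
  proof (rule ccontr)
    assume "\<not> ?thesis"
    then have le: "j \<le> l" if "past_record x j" for j using that by (auto simp: not_less)
    have step: "\<exists>j'>j. past_record x j'" if j: "past_record x j" for j
    proof -
      obtain k where "k > j" "walk_sum x j k \<ge> 0" using forward by blast
      then have "(j, record_map x j) \<in> record_edges x"
        using record_map_props(1)[of j k x] by (intro record_edgesI) auto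
      then show ?thesis using past_record_record_edges j record_edgesD(2) by blast
    qed
    obtain j0 where j0: "past_record x j0" using low by blast
    have "\<exists>j. past_record x j \<and> j \<ge> j0 + int n" for n
    proof (induction n)
      case (Suc n)
      then obtain j where "past_record x j" "j \<ge> j0 + int n" by blast
      with step[of j] show ?case by force
    qed (use j0 in auto)
    from this[of "nat (l - j0 + 1)"] obtain j where "past_record x j" "j \<ge> j0 + int (nat (l - j0 + 1))" by blast
    then show False using le[of j] by linarith
  qed
  with low show ?thesis by (auto simp: two_sided_records_def)
qed

section \<open>Probabilities of windows\<close>


instance ptree :: (countable) countable
  by countable_datatype

text \<open>Codes are read backwards in time and windows forwards; the product of the letter weights
  is the same.\<close>

lemma word_weight_rev: "word_weight q (rev w) = word_weight q w"
  by (induction w) (simp_all add: word_weight_append, simp add: word_weight_def)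

lemma code_ge: "a \<in> set (code t) \<Longrightarrow> a \<ge> - 1"
  by (induction t arbitrary: a) auto

lemma bush_code_ge: "spine_bush t \<Longrightarrow> a \<in> set (bush_code t) \<Longrightarrow> a \<ge> - 1"
  by (auto simp: bush_code_def spine_bush_def code_ge)

lemma join_code_ge: "(\<And>t. t \<in> set ts \<Longrightarrow> spine_bush t) \<Longrightarrow> a \<in> set (join_code ts) \<Longrightarrow> a \<ge> - 1"
  by (auto simp: join_code_def dest: bush_code_ge)

lemma word_weight_join_code: "word_weight q (join_code ts) = (\<Prod>t\<leftarrow>ts. word_weight q (bush_code t))"
  by (induction ts) (simp_all add: word_weight_append word_weight_rev, simp add: word_weight_def)

lemma measurable_count_space_sum:
  fixes f :: "'i \<Rightarrow> 'a \<Rightarrow> int"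
  assumes "\<And>i. i \<in> I \<Longrightarrow> f i \<in> measurable M (count_space UNIV)"
  shows "(\<lambda>\<omega>. \<Sum>i\<in>I. f i \<omega>) \<in> measurable M (count_space UNIV)"
  using assms
proof (induction I rule: infinite_finite_induct)
  case (insert i I)
  have "(\<lambda>\<omega>. (f i \<omega>, \<Sum>i\<in>I. f i \<omega>)) \<in> measurable M (count_space UNIV \<Otimes>\<^sub>M count_space UNIV)"
    using insert by (intro measurable_Pair) auto
  then have "(\<lambda>\<omega>. (f i \<omega>, \<Sum>i\<in>I. f i \<omega>)) \<in> measurable M (count_space UNIV)"
    by (simp add: pair_measure_countable)
  then have "(\<lambda>\<omega>. case_prod (+) (f i \<omega>, \<Sum>i\<in>I. f i \<omega>)) \<in> measurable M (count_space UNIV)"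
    by (rule measurable_compose) simp
  then show ?case using insert by simp
qed auto

locale skip_free_walk = prob_space M for M :: "'a measure" +
  fixes X :: "int \<Rightarrow> 'a \<Rightarrow> int"
  assumes indep: "indep_vars (\<lambda>_. count_space UNIV) X UNIV"
    and identical: "\<And>n. distr M (count_space UNIV) (X n) = distr M (count_space UNIV) (X 0)"
    and ge: "\<And>n \<omega>. \<omega> \<in> space M \<Longrightarrow> X n \<omega> \<ge> - 1"
    and down: "prob {\<omega> \<in> space M. X 0 \<omega> = - 1} > 0"
    and integrable_X: "integrable M (\<lambda>\<omega>. real_of_int (X 0 \<omega>))"
    and mean_pos: "0 < expectation (\<lambda>\<omega>. real_of_int (X 0 \<omega>))"
begin

abbreviation path :: "'a \<Rightarrow> int \<Rightarrow> int" where
  "path \<omega> \<equiv> (\<lambda>n. X n \<omega>)"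

lemma rv_X [measurable]: "X n \<in> measurable M (count_space UNIV)"
  using indep by (auto simp: indep_vars_def)

lemma measurable_walk_sum [measurable]: "(\<lambda>\<omega>. walk_sum (path \<omega>) i j) \<in> measurable M (count_space UNIV)"
  unfolding walk_sum_def by (intro measurable_count_space_sum rv_X)

lemma pred_past_record [measurable]: "Measurable.pred M (\<lambda>\<omega>. past_record (path \<omega>) j)"
  unfolding past_record_def by measurable

lemma pred_two_sided_records [measurable]: "Measurable.pred M (\<lambda>\<omega>. two_sided_records (path \<omega>))"
  unfolding two_sided_records_def by measurable

lemma pred_forward_word [measurable]: "Measurable.pred M (\<lambda>\<omega>. forward_word (path \<omega>) i (length w) = w)"
  unfolding forward_word_eq_iff by measurable

lemma pred_back_word [measurable]: "Measurable.pred M (\<lambda>\<omega>. back_word (path \<omega>) i (length w) = w)"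
  using pred_forward_word[of "i - int (length w)" "rev w"] by (simp add: back_word_eq_iff)

definition q :: "nat pmf" where
  "q = embed_pmf (\<lambda>k. prob {\<omega> \<in> space M. X 0 \<omega> = int k - 1})"

lemma pmf_q: "pmf q k = prob {\<omega> \<in> space M. X 0 \<omega> = int k - 1}"
  unfolding q_def
proof (rule pmf_embed_pmf)
  let ?A = "\<lambda>k. {\<omega> \<in> space M. X 0 \<omega> = int k - 1}"
  have "(\<Sum>k. emeasure M (?A k)) = emeasure M (\<Union>k. ?A k)"
    by (intro suminf_emeasure) (auto simp: disjoint_family_on_def)
  also have "(\<Union>k. ?A k) = space M"
  proof -
    have "\<omega> \<in> ?A (nat (X 0 \<omega> + 1))" if "\<omega> \<in> space M" for \<omega> using ge[OF that, of 0] that by simp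
    then show ?thesis by blast
  qed
  finally show "(\<integral>\<^sup>+k. ennreal (prob (?A k)) \<partial>count_space UNIV) = 1"
    by (simp add: nn_integral_count_space_nat emeasure_eq_measure prob_space)
qed simp

lemma prob_X_eq: "a \<ge> - 1 \<Longrightarrow> prob {\<omega> \<in> space M. X n \<omega> = a} = pmf q (nat (a + 1))"
proof -
  assume "a \<ge> - 1"
  have "prob {\<omega> \<in> space M. X n \<omega> = a} = measure (distr M (count_space UNIV) (X n)) {a}" for n
    by (subst measure_distr) (auto intro!: arg_cong[of _ _ prob])
  then show ?thesis using \<open>a \<ge> - 1\<close> identical[of n] by (simp add: pmf_q)
qed

lemma prob_forward_word:
  assumes "\<And>a. a \<in> set w \<Longrightarrow> a \<ge> - 1"
  shows "prob {\<omega> \<in> space M. forward_word (path \<omega>) i (length w) = w} = word_weight q w"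
proof (cases "w = []")
  case False
  define J where "J = (\<lambda>l. i + int l) ` {..<length w}"
  have inj: "inj_on (\<lambda>l. i + int l) {..<length w}" by (auto simp: inj_on_def)
  have "{\<omega> \<in> space M. forward_word (path \<omega>) i (length w) = w} =
      (\<Inter>j\<in>J. X j -` {w ! nat (j - i)} \<inter> space M)"
    using False by (auto simp: forward_word_eq_iff J_def)
  also have "prob \<dots> = (\<Prod>j\<in>J. prob (X j -` {w ! nat (j - i)} \<inter> space M))"
    using False by (intro indep_varsD[OF indep]) (auto simp: J_def)
  also have "\<dots> = (\<Prod>l<length w. prob {\<omega> \<in> space M. X (i + int l) \<omega> = w ! l})"
    unfolding J_def prod.reindex[OF inj]
    by (rule prod.cong) (auto simp: vimage_def Int_def conj_commute)
  also have "\<dots> = (\<Prod>l<length w. pmf q (nat (w ! l + 1)))"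
    using assms by (intro prod.cong refl prob_X_eq) auto
  also have "\<dots> = word_weight q w"
    by (simp add: word_weight_def prod.list_conv_set_nth lessThan_atLeast0)
  finally show ?thesis .
qed (simp add: word_weight_def prob_space)

definition c :: real where
  "c = prob {\<omega> \<in> space M. \<exists>n>0. (\<Sum>k<n. X (int k) \<omega>) = - 1}"

text \<open>The passage event splits into disjoint events, one for each tree whose code the walk
  starts with: codes are complete by \<open>prefix_code_iff\<close> and prefix-free.\<close>

lemma total_weight: "(\<integral>\<^sup>+t. ennreal (word_weight q (code t)) \<partial>count_space (UNIV :: unit ptree set)) = ennreal c"
proof -
  let ?E = "\<lambda>t :: unit ptree. {\<omega> \<in> space M. forward_word (path \<omega>) 0 (length (code t)) = code t}"
  have "{\<omega> \<in> space M. \<exists>n>0. (\<Sum>k<n. X (int k) \<omega>) = - 1} = (\<Union>t\<in>UNIV. ?E t)"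
  proof -
    have "(\<exists>n>0. (\<Sum>k<n. X (int k) \<omega>) = - 1) \<longleftrightarrow>
        (\<exists>t :: unit ptree. forward_word (path \<omega>) 0 (length (code t)) = code t)" if "\<omega> \<in> space M" for \<omega>
      by (rule hits_minus_one_iff) (rule ge[OF that])
    then show ?thesis by auto
  qed
  then have "ennreal c = emeasure M (\<Union>t\<in>UNIV. ?E t)"
    by (simp add: c_def emeasure_eq_measure)
  also have "\<dots> = (\<integral>\<^sup>+t. emeasure M (?E t) \<partial>count_space UNIV)"
  proof (rule emeasure_UN_countable)
    show "disjoint_family_on ?E UNIV"
      using prefix_code_unique by (fastforce simp: disjoint_family_on_def forward_word_def)
  qed auto
  also have "\<dots> = (\<integral>\<^sup>+t. ennreal (word_weight q (code t)) \<partial>count_space (UNIV :: unit ptree set))"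
    by (intro nn_integral_cong) (simp add: emeasure_eq_measure prob_forward_word code_ge)
  finally show ?thesis by simp
qed

text \<open>Each way of failing to be a record is a reversed code ending at \<open>j\<close>.
  Followed by \<open>w\<close> it is a single deterministic word, so independence of past and future
  reduces to multiplicativity of \<open>word_weight\<close>.\<close>

lemma prob_not_past_record_word:
  assumes "\<And>a. a \<in> set w \<Longrightarrow> a \<ge> - 1"
  shows "prob {\<omega> \<in> space M. \<not> past_record (path \<omega>) j \<and> forward_word (path \<omega>) j (length w) = w} =
    c * word_weight q w"
proof -
  let ?E = "\<lambda>t :: unit ptree. {\<omega> \<in> space M. forward_word (path \<omega>) (j - int (length (code t)))
    (length (rev (code t)) + length w) = rev (code t) @ w}"
  have E: "?E t = {\<omega> \<in> space M. back_word (path \<omega>) j (length (code t)) = code t \<and>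
      forward_word (path \<omega>) j (length w) = w}" for t
    by (subst forward_word_eq_append_iff) (simp add: back_word_eq_iff)
  have m: "?E t \<in> sets M" for t unfolding E by measurable
  have "{\<omega> \<in> space M. \<not> past_record (path \<omega>) j \<and> forward_word (path \<omega>) j (length w) = w} = (\<Union>t\<in>UNIV. ?E t)"
  proof -
    have "\<not> past_record (path \<omega>) j \<longleftrightarrow> (\<exists>t :: unit ptree. back_word (path \<omega>) j (length (code t)) = code t)"
      if "\<omega> \<in> space M" for \<omega> by (rule not_past_record_iff) (rule ge[OF that])
    then show ?thesis unfolding E by auto
  qed
  then have "ennreal (prob {\<omega> \<in> space M. \<not> past_record (path \<omega>) j \<and> forward_word (path \<omega>) j (length w) = w}) =
      emeasure M (\<Union>t\<in>UNIV. ?E t)"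
    by (simp only: emeasure_eq_measure)
  also have "\<dots> = (\<integral>\<^sup>+t. emeasure M (?E t) \<partial>count_space UNIV)"
  proof (rule emeasure_UN_countable)
    show "disjoint_family_on ?E UNIV"
      unfolding E using prefix_code_unique by (fastforce simp: disjoint_family_on_def back_word_def)
  qed (use m in auto)
  also have "\<dots> = (\<integral>\<^sup>+t. ennreal (word_weight q (code t)) * ennreal (word_weight q w) \<partial>count_space (UNIV :: unit ptree set))"
  proof (intro nn_integral_cong)
    fix t :: "unit ptree"
    have "prob (?E t) = word_weight q (rev (code t) @ w)"
      using prob_forward_word[of "rev (code t) @ w" "j - int (length (code t))"] assms code_ge by auto
    then show "emeasure M (?E t) = ennreal (word_weight q (code t)) * ennreal (word_weight q w)"
      by (simp add: emeasure_eq_measure word_weight_append word_weight_rev word_weight_nonneg ennreal_mult)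
  qed
  also have "\<dots> = ennreal (c * word_weight q w)"
    by (subst nn_integral_multc) (simp_all add: total_weight ennreal_mult word_weight_nonneg c_def)
  finally show ?thesis by (simp add: word_weight_nonneg c_def)
qed

lemma prob_past_record_word:
  assumes "\<And>a. a \<in> set w \<Longrightarrow> a \<ge> - 1"
  shows "prob {\<omega> \<in> space M. past_record (path \<omega>) j \<and> forward_word (path \<omega>) j (length w) = w} =
    (1 - c) * word_weight q w"
proof -
  let ?W = "{\<omega> \<in> space M. forward_word (path \<omega>) j (length w) = w}"
  let ?N = "{\<omega> \<in> space M. \<not> past_record (path \<omega>) j \<and> forward_word (path \<omega>) j (length w) = w}"
  have "{\<omega> \<in> space M. past_record (path \<omega>) j \<and> forward_word (path \<omega>) j (length w) = w} = ?W - ?N" by auto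
  also have "prob \<dots> = prob ?W - prob ?N" by (intro finite_measure_Diff) auto
  also have "\<dots> = (1 - c) * word_weight q w"
    using prob_forward_word[of w j, OF assms] prob_not_past_record_word[of w j, OF assms]
    by (simp add: algebra_simps)
  finally show ?thesis .
qed

lemma prob_past_record: "prob {\<omega> \<in> space M. past_record (path \<omega>) j} = 1 - c"
  using prob_past_record_word[of "[]" j] by (simp add: word_weight_def)

text \<open>Hoeffding's inequality needs bounded variables; by dominated convergence a high enough
  truncation keeps the mean positive.\<close>

lemma truncated_mean_pos: "\<exists>K :: nat. expectation (\<lambda>\<omega>. min (real_of_int (X 0 \<omega>)) (real K)) > 0"
proof -
  have "(\<lambda>K. expectation (\<lambda>\<omega>. min (real_of_int (X 0 \<omega>)) (real K))) \<longlonglongrightarrow> expectation (\<lambda>\<omega>. real_of_int (X 0 \<omega>))"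
  proof (rule integral_dominated_convergence[where w = "\<lambda>\<omega>. \<bar>real_of_int (X 0 \<omega>)\<bar>"])
    show "AE \<omega> in M. (\<lambda>K. min (real_of_int (X 0 \<omega>)) (real K)) \<longlonglongrightarrow> real_of_int (X 0 \<omega>)"
    proof (intro AE_I2 tendsto_eventually)
      fix \<omega>
      show "\<forall>\<^sub>F K in sequentially. min (real_of_int (X 0 \<omega>)) (real K) = real_of_int (X 0 \<omega>)"
        unfolding eventually_sequentially by (intro exI[of _ "nat (X 0 \<omega>)"]) (auto intro!: min_absorb1)
    qed
  qed (use integrable_X in auto)
  from order_tendstoD(1)[OF this mean_pos] show ?thesis by (auto simp: eventually_sequentially)
qed

text \<open>One rate serves every finite index set, hence both the past and the future. Truncation
  only lowers the sum, so the bound for truncated increments suffices.\<close>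

lemma prob_sum_nonpos:
  "\<exists>r. 0 \<le> r \<and> r < 1 \<and> (\<forall>I. finite I \<longrightarrow> prob {\<omega> \<in> space M. (\<Sum>l\<in>I. X l \<omega>) \<le> 0} \<le> r ^ card I)"
proof -
  obtain K :: nat where K: "expectation (\<lambda>\<omega>. min (real_of_int (X 0 \<omega>)) (real K)) > 0"
    using truncated_mean_pos by blast
  define g where "g a = min (real_of_int a) (real K)" for a
  define \<mu> where "\<mu> = expectation (\<lambda>\<omega>. g (X 0 \<omega>))"
  have \<mu>: "\<mu> > 0" using K by (simp add: \<mu>_def g_def)
  have Eg: "expectation (\<lambda>\<omega>. g (X i \<omega>)) = \<mu>" for i
  proof -
    have "expectation (\<lambda>\<omega>. g (X i \<omega>)) = integral\<^sup>L (distr M (count_space UNIV) (X i)) g" for i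
      by (subst integral_distr) auto
    then show ?thesis unfolding \<mu>_def using identical[of i] by simp
  qed
  \<comment> \<open>The Hoeffding exponent per increment, for a deviation \<open>\<mu>\<close> of
    variables in an interval of length \<open>K + 1\<close>.\<close>
  define r where "r = exp (- 2 * \<mu>\<^sup>2 / (real K + 1)\<^sup>2)"
  have "r < 1" using \<mu> by (simp add: r_def)
  moreover have "prob {\<omega> \<in> space M. (\<Sum>l\<in>I. X l \<omega>) \<le> 0} \<le> r ^ card I" if I: "finite I" for I
  proof (cases "I = {}")
    case False
    define n where "n = card I"
    have n: "n > 0" using I False by (simp add: n_def card_gt_0_iff)
    have "indep_vars (\<lambda>_. borel) (\<lambda>i \<omega>. g (X i \<omega>)) I"
      using indep_vars_compose2[OF indep, of "\<lambda>_. g" "\<lambda>_. borel"] by (auto intro: indep_vars_subset)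
    then interpret Hoeffding_ineq M I "\<lambda>i \<omega>. g (X i \<omega>)" "\<lambda>_. - 1" "\<lambda>_. real K"
        "\<Sum>i\<in>I. expectation (\<lambda>\<omega>. g (X i \<omega>))"
    proof (unfold_locales, goal_cases)
      case (3 i)
      have "- 1 \<le> real_of_int (X i \<omega>)" if "\<omega> \<in> space M" for \<omega> using ge[OF that, of i] by linarith
      then show ?case by (intro AE_I2) (auto simp: g_def min_def)
    qed (use I in auto)
    have "{\<omega> \<in> space M. (\<Sum>l\<in>I. X l \<omega>) \<le> 0} \<subseteq>
      {\<omega> \<in> space M. (\<Sum>i\<in>I. g (X i \<omega>)) \<le> (\<Sum>i\<in>I. expectation (\<lambda>\<omega>. g (X i \<omega>))) - real n * \<mu>}"
    proof safe
      fix \<omega> assume "(\<Sum>l\<in>I. X l \<omega>) \<le> 0"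
      then have "(\<Sum>l\<in>I. real_of_int (X l \<omega>)) \<le> 0" by (simp flip: of_int_sum)
      moreover have "(\<Sum>i\<in>I. g (X i \<omega>)) \<le> (\<Sum>l\<in>I. real_of_int (X l \<omega>))"
        by (intro sum_mono) (simp add: g_def)
      ultimately show "(\<Sum>i\<in>I. g (X i \<omega>)) \<le> (\<Sum>i\<in>I. expectation (\<lambda>\<omega>. g (X i \<omega>))) - real n * \<mu>"
        by (simp add: Eg n_def)
    qed
    then have "prob {\<omega> \<in> space M. (\<Sum>l\<in>I. X l \<omega>) \<le> 0} \<le>
      prob {\<omega> \<in> space M. (\<Sum>i\<in>I. g (X i \<omega>)) \<le> (\<Sum>i\<in>I. expectation (\<lambda>\<omega>. g (X i \<omega>))) - real n * \<mu>}"
      by (intro finite_measure_mono) measurable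
    also have "\<dots> \<le> exp (- 2 * (real n * \<mu>)\<^sup>2 / (\<Sum>i\<in>I. (real K - - 1)\<^sup>2))"
      using \<mu> n by (intro Hoeffding_ineq_le) (auto simp: n_def)
    also have "- 2 * (real n * \<mu>)\<^sup>2 / (\<Sum>i\<in>I. (real K - - 1)\<^sup>2) = real n * (- 2 * \<mu>\<^sup>2 / (real K + 1)\<^sup>2)"
    proof -
      have "- 2 * (real n * \<mu>)\<^sup>2 / (real n * d) = real n * (- 2 * \<mu>\<^sup>2 / d)" if "d > 0" for d
        using n that by (simp add: power2_eq_square field_simps)
      then show ?thesis by (simp add: n_def[symmetric])
    qed
    also have "exp \<dots> = r ^ n" unfolding r_def by (rule exp_of_nat_mult)
    finally show ?thesis by (simp add: n_def)
  qed simp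
  ultimately show ?thesis by (intro exI[of _ r]) (auto simp: r_def)
qed

text \<open>Borel-Cantelli with a geometric bound. The sets \<open>I n\<close> are left open so as
  to cover intervals ending at a site as well as intervals starting there.\<close>

lemma AE_eventually_sum_pos:
  assumes "\<And>n. finite (I n)" "\<And>n. card (I n) = n"
  shows "AE \<omega> in M. \<exists>N. \<forall>n\<ge>N. (\<Sum>l\<in>I n. X l \<omega>) > 0"
proof -
  obtain r where r: "0 \<le> r" "r < 1" "\<And>I. finite I \<Longrightarrow> prob {\<omega> \<in> space M. (\<Sum>l\<in>I. X l \<omega>) \<le> 0} \<le> r ^ card I"
    using prob_sum_nonpos by blast
  define E where "E n = {\<omega> \<in> space M. (\<Sum>l\<in>I n. X l \<omega>) \<le> 0}" for n
  have [measurable]: "(\<lambda>\<omega>. \<Sum>l\<in>I n. X l \<omega>) \<in> measurable M (count_space UNIV)" for n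
    by (intro measurable_count_space_sum rv_X)
  have "AE \<omega> in M. eventually (\<lambda>n. \<omega> \<in> space M - E n) sequentially"
  proof (rule borel_cantelli_AE1)
    show "summable (\<lambda>n. prob (E n))"
    proof (rule summable_comparison_test')
      show "summable (\<lambda>n. r ^ n)" using r by (simp add: summable_geometric)
      show "norm (prob (E n)) \<le> r ^ n" if "n \<ge> 0" for n using r(3)[of "I n"] assms by (simp add: E_def)
    qed
  qed (auto simp: E_def emeasure_eq_measure)
  then show ?thesis by eventually_elim (auto simp: E_def eventually_sequentially not_le)
qed

lemma AE_two_sided_records: "AE \<omega> in M. two_sided_records (path \<omega>)"
proof -
  have "AE \<omega> in M. \<forall>l. \<exists>N. \<forall>n\<ge>N. walk_sum (path \<omega>) (l - int n) l > 0"
    unfolding AE_all_countable walk_sum_def by (intro allI AE_eventually_sum_pos) auto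
  moreover have "AE \<omega> in M. \<forall>i. \<exists>N. \<forall>n\<ge>N. walk_sum (path \<omega>) i (i + int n) > 0"
    unfolding AE_all_countable walk_sum_def by (intro allI AE_eventually_sum_pos) auto
  ultimately show ?thesis
  proof eventually_elim
    case (elim \<omega>)
    have "\<exists>j>i. walk_sum (path \<omega>) i j \<ge> 0" for i
    proof -
      obtain N where "\<forall>n\<ge>N. walk_sum (path \<omega>) i (i + int n) > 0" using elim(2) by blast
      then have "walk_sum (path \<omega>) i (i + int (Suc N)) > 0" by (meson le_SucI order_refl)
      then show ?thesis by (intro exI[of _ "i + int (Suc N)"]) auto
    qed
    then show ?case using elim(1) by (intro two_sided_recordsI) auto
  qed
qed

lemma pmf_q_0: "pmf q 0 > 0"
  using down by (simp add: pmf_q)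

text \<open>The one-vertex tree alone contributes \<open>pmf q 0\<close> to the total
  weight.\<close>

lemma c_pos: "0 < c"
proof -
  have "ennreal (word_weight q (code (Node () []))) \<le> ennreal c"
    unfolding total_weight[symmetric]
    by (rule nn_integral_ge_point[of _ _ "\<lambda>t. ennreal (word_weight q (code t))"]) simp
  moreover have "word_weight q (code (Node () [])) = pmf q 0" by (simp add: word_weight_def)
  ultimately have "ennreal (pmf q 0) \<le> ennreal c" by simp
  moreover have "0 \<le> c" by (simp add: c_def)
  ultimately have "pmf q 0 \<le> c" by (simp only: ennreal_le_iff)
  then show ?thesis using pmf_q_0 by linarith
qed

text \<open>If \<open>c\<close> were 1, almost surely no site would be a record, contrary to the
  existence of records.\<close>

lemma c_less_1: "c < 1"
proof (rule ccontr)
  assume "\<not> c < 1"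
  then have "c = 1" by (simp add: c_def antisym)
  then have "AE \<omega> in M. \<not> past_record (path \<omega>) j" for j
    using prob_past_record[of j] prob_eq_0[of "{\<omega> \<in> space M. past_record (path \<omega>) j}"] by simp
  then have "AE \<omega> in M. \<forall>j. \<not> past_record (path \<omega>) j" by (simp add: AE_all_countable)
  with AE_two_sided_records have "AE \<omega> in M. False"
    by eventually_elim (auto simp: two_sided_records_def)
  then show False by simp
qed

sublocale first_passage q c
  by unfold_locales (use c_pos c_less_1 total_weight pmf_q_0 in auto)

section \<open>Conditioning on a record at the root\<close>

definition spine_event :: "'a set" where
  "spine_event = {\<omega> \<in> space M. two_sided_records (path \<omega>) \<and> past_record (path \<omega>) 0}"

lemma sets_spine_event [measurable]: "spine_event \<in> sets M"
  unfolding spine_event_def by measurable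

lemma prob_spine_event: "prob spine_event = 1 - c"
proof -
  have "prob spine_event = prob {\<omega> \<in> space M. past_record (path \<omega>) 0}"
    using AE_two_sided_records by (intro finite_measure_eq_AE) (auto simp: spine_event_def)
  then show ?thesis by (simp add: prob_past_record)
qed

text \<open>Keeping \<open>two_sided_records\<close> in the event makes the deterministic
  description valid at every point of it; the probability is unchanged.\<close>

lemma spine_event_window:
  assumes "r \<le> length ts" "\<And>t. t \<in> set ts \<Longrightarrow> spine_bush t"
  shows "{\<omega> \<in> spine_event. \<forall>l<length ts. bush_seq (path \<omega>) (1 - int r + int l) = ts ! l} =
    {\<omega> \<in> space M. two_sided_records (path \<omega>) \<and> past_record (path \<omega>) (- int (length (join_code (take r ts)))) \<and>
      forward_word (path \<omega>) (- int (length (join_code (take r ts)))) (length (join_code ts)) = join_code ts}"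
proof -
  have "past_record (path \<omega>) 0 \<and> (\<forall>l<length ts. bush_seq (path \<omega>) (1 - int r + int l) = ts ! l) \<longleftrightarrow>
    past_record (path \<omega>) (- int (length (join_code (take r ts)))) \<and>
      forward_word (path \<omega>) (- int (length (join_code (take r ts)))) (length (join_code ts)) = join_code ts"
    if "\<omega> \<in> space M" "two_sided_records (path \<omega>)" for \<omega>
    by (rule bush_window_iff) (use ge[OF that(1)] that(2) assms in auto)
  then show ?thesis by (auto simp: spine_event_def)
qed

lemma window_empty:
  assumes "t \<in> set ts" "\<not> spine_bush t"
  shows "{\<omega> \<in> spine_event. \<forall>l<length ts. bush_seq (path \<omega>) (1 - int r + int l) = ts ! l} = {}"
proof -
  obtain l where l: "l < length ts" "ts ! l = t" using assms(1) by (auto simp: in_set_conv_nth)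
  have "spine_bush (bush_seq (path \<omega>) (1 - int r + int l))" if "\<omega> \<in> spine_event" for \<omega>
    by (rule spine_bush_bush_seq) (use that ge in \<open>auto simp: spine_event_def\<close>)
  then show ?thesis using l assms(2) by force
qed

text \<open>\<open>bush_seq\<close> involves choice, so measurability is not visible from its
  definition; a window is measurable because it amounts to a record and a word.\<close>

lemma sets_window:
  assumes "r \<le> length ts"
  shows "{\<omega> \<in> spine_event. \<forall>l<length ts. bush_seq (path \<omega>) (1 - int r + int l) = ts ! l} \<in> sets M"
proof (cases "\<forall>t\<in>set ts. spine_bush t")
  case True
  then show ?thesis by (subst spine_event_window[OF assms]) auto
next
  case False
  then obtain t where "t \<in> set ts" "\<not> spine_bush t" by blast
  then show ?thesis by (subst window_empty) auto
qed

text \<open>The left end moves with \<open>ts\<close> and \<open>r\<close>, but a record there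
  always has probability \<open>1 - c\<close>. Bushes that are not spine bushes never occur, and
  \<open>bush\<close> gives them mass zero.\<close>

lemma prob_window:
  assumes "r \<le> length ts"
  shows "prob {\<omega> \<in> spine_event. \<forall>l<length ts. bush_seq (path \<omega>) (1 - int r + int l) = ts ! l} =
    (1 - c) * (\<Prod>t\<leftarrow>ts. pmf bush t)"
proof (cases "\<forall>t\<in>set ts. spine_bush t")
  case True
  define i where "i = - int (length (join_code (take r ts)))"
  have "prob {\<omega> \<in> spine_event. \<forall>l<length ts. bush_seq (path \<omega>) (1 - int r + int l) = ts ! l} =
    prob {\<omega> \<in> space M. past_record (path \<omega>) i \<and> forward_word (path \<omega>) i (length (join_code ts)) = join_code ts}"
    using True AE_two_sided_records
    by (subst spine_event_window[OF assms]) (auto simp: i_def intro!: finite_measure_eq_AE)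
  also have "\<dots> = (1 - c) * word_weight q (join_code ts)"
    using True join_code_ge by (intro prob_past_record_word) blast
  also have "word_weight q (join_code ts) = (\<Prod>t\<leftarrow>ts. pmf bush t)"
    unfolding word_weight_join_code using True
    by (intro arg_cong[of _ _ prod_list] map_cong) (auto simp: pmf_bush)
  finally show ?thesis .
next
  case False
  then obtain t where t: "t \<in> set ts" "\<not> spine_bush t" by blast
  then have "(\<Prod>t\<leftarrow>ts. pmf bush t) = 0" by (force simp: prod_list_zero_iff pmf_bush)
  then show ?thesis by (subst window_empty[OF t]) simp
qed

end

section \<open>The law of the bushes\<close>


lemma measure_replicate_pmf:
  fixes p :: "'a :: countable pmf"
  shows "measure (replicate_pmf n p) {xs. length xs = n \<and> (\<forall>l<n. xs ! l \<in> F l)} = (\<Prod>l<n. measure p (F l))"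
proof (induction n arbitrary: F)
  case (Suc n)
  have eq: "replicate_pmf (Suc n) p = map_pmf (\<lambda>(x, xs). x # xs) (pair_pmf p (replicate_pmf n p))"
    by (simp add: pair_pmf_def map_bind_pmf)
  have "(\<lambda>(x, xs). x # xs) -` {xs. length xs = Suc n \<and> (\<forall>l<Suc n. xs ! l \<in> F l)} =
      F 0 \<times> {xs. length xs = n \<and> (\<forall>l<n. xs ! l \<in> F (Suc l))}"
    by (auto simp: All_less_Suc2)
  then show ?case
    unfolding eq measure_map_pmf
    using Suc[of "\<lambda>l. F (Suc l)"] by (simp add: measure_pmf_prob_product prod.lessThan_Suc_shift del: prod.lessThan_Suc)
qed (auto simp: measure_return_pmf indicator_def)

text \<open>A form free of infima, with countable quantifiers only, from which measurability can be
  read off.\<close>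

lemma record_edges_iff:
  "(i, j) \<in> record_edges x \<longleftrightarrow>
     i < j \<and> walk_sum x i j \<ge> 0 \<and> (\<forall>k. i < k \<and> k < j \<longrightarrow> walk_sum x i k < 0)"
  using record_edgesD[of i j x] record_map_eqI[of i j x] by (auto intro!: record_edgesI)

text \<open>The infimum is attained, because the admissible values are integers bounded below by - 1
  and the start \<open>i - 1\<close> provides one of them; so it can be replaced by countable
  quantifiers.\<close>

lemma type_fun_eq_iff:
  assumes "\<And>l. x l \<ge> - 1"
  shows "type_fun x i = n \<longleftrightarrow> n \<ge> - 1 \<and> (\<exists>m<i. walk_sum x m i = n) \<and>
    (\<forall>m<i. walk_sum x m i \<ge> - 1 \<longrightarrow> n \<le> walk_sum x m i)"
proof -
  define P where "P k \<longleftrightarrow> (\<exists>m<i. walk_sum x m i = int k - 1)" for k :: nat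
  have P: "P (nat (a + 1))" if "a \<ge> - 1" "m < i" "walk_sum x m i = a" for a m
    using that by (auto simp: P_def)
  have "walk_sum x (i - 1) i = x (i - 1)" using walk_sum_last[of "i - 1" i x] by simp
  then have "P (nat (x (i - 1) + 1))" using P[of "x (i - 1)" "i - 1"] assms by simp
  then have least: "P (LEAST k. P k)" by (rule LeastI)
  then obtain m where m: "m < i" "walk_sum x m i = int (LEAST k. P k) - 1" by (auto simp: P_def)
  have "int (LEAST k. P k) - 1 \<le> walk_sum x l i" if "l < i" "walk_sum x l i \<ge> - 1" for l
    using Least_le[of P, OF P[OF that(2,1) refl]] that(2) by linarith
  then have *: "type_fun x i = int (LEAST k. P k) - 1"
    using m by (intro type_fun_eqI[where m = m]) auto
  show ?thesis
  proof
    assume "type_fun x i = n"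
    then show "n \<ge> - 1 \<and> (\<exists>m<i. walk_sum x m i = n) \<and>
        (\<forall>m<i. walk_sum x m i \<ge> - 1 \<longrightarrow> n \<le> walk_sum x m i)"
      using * m \<open>\<And>l. _ \<Longrightarrow> _ \<Longrightarrow> int (LEAST k. P k) - 1 \<le> walk_sum x l i\<close> by auto
  qed (auto intro: type_fun_eqI)
qed

lemma join_bushes_simps:
  "(n, u) \<in> verts (join_bushes b) \<longleftrightarrow> subtree_at (b n) u \<noteq> None"
  "((n, u), (m, w)) \<in> edges (join_bushes b) \<longleftrightarrow>
     n = m \<and> (\<exists>i. u = w @ [i]) \<and> subtree_at (b n) u \<noteq> None \<or> u = [] \<and> w = [] \<and> m = n + 1"
  "((n, u), (m, w)) \<in> sib (join_bushes b) \<longleftrightarrow>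
     n = m \<and> (\<exists>v i j. u = v @ [i] \<and> w = v @ [j] \<and> i < j) \<and> subtree_at (b m) w \<noteq> None \<or>
     m = n + 1 \<and> u = [] \<and> (\<exists>i. w = [i]) \<and> subtree_at (b m) w \<noteq> None"
  "root (join_bushes b) = (0, [])"
  "mark (join_bushes b) (n, u) = root_mark (the (subtree_at (b n) u))"
  by (auto simp: join_bushes_def Let_def simp del: subtree_at.simps)

lemma subtree_at_prefix: "subtree_at t (u @ [i]) \<noteq> None \<Longrightarrow> subtree_at t u \<noteq> None"
  by (auto simp: subtree_at_append split: bind_splits)

lemma subtree_at_smaller_index:
  "subtree_at t (u @ [j]) \<noteq> None \<Longrightarrow> i < j \<Longrightarrow> subtree_at t (u @ [i]) \<noteq> None"
  by (auto simp: subtree_at_append split: bind_splits if_splits)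

lemma wf_join_bushes: "wf_rtree (join_bushes b)"
  unfolding wf_rtree_def
proof (intro conjI subrelI)
  fix U W assume "(U, W) \<in> edges (join_bushes b)"
  then show "(U, W) \<in> verts (join_bushes b) \<times> verts (join_bushes b)"
    using subtree_at_prefix by (cases U; cases W) (fastforce simp: join_bushes_simps simp del: not_None_eq)
next
  fix U W assume "(U, W) \<in> sib (join_bushes b)"
  then show "(U, W) \<in> verts (join_bushes b) \<times> verts (join_bushes b)"
    using subtree_at_smaller_index by (cases U; cases W) (fastforce simp: join_bushes_simps simp del: not_None_eq)
qed (simp add: join_bushes_simps)

lemma measurable_join_bushes:
  "(\<lambda>b. ftree_class (join_bushes b)) \<in> (\<Pi>\<^sub>M i\<in>(UNIV :: int set). measure_pmf \<mu>) \<rightarrow>\<^sub>M borel"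
proof (rule measurable_ftree_class)
  let ?N = "\<Pi>\<^sub>M i\<in>(UNIV :: int set). measure_pmf \<mu>"
  have coord: "Measurable.pred ?N (\<lambda>b. Q (b n))" for Q n
    by (rule measurable_compose[OF measurable_component_singleton[of n UNIV "\<lambda>_. measure_pmf \<mu>"]]) auto
  have [measurable]: "Measurable.pred ?N (\<lambda>b. subtree_at (b n) u \<noteq> None)" for n u by (rule coord)
  show "Measurable.pred ?N (\<lambda>b. v \<in> verts (join_bushes b))" for v
    by (cases v) (simp add: join_bushes_simps del: not_None_eq)
  show "Measurable.pred ?N (\<lambda>b. (u, v) \<in> edges (join_bushes b))" for u v
    by (cases u; cases v) (simp add: join_bushes_simps del: not_None_eq)
  show "Measurable.pred ?N (\<lambda>b. (u, v) \<in> sib (join_bushes b))" for u v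
    by (cases u; cases v) (simp add: join_bushes_simps del: not_None_eq)
  show "Measurable.pred ?N (\<lambda>b. root (join_bushes b) = v)" for v by (simp add: join_bushes_simps)
  show "Measurable.pred ?N (\<lambda>b. mark (join_bushes b) v = n)" for v n
    using coord[of "\<lambda>t. root_mark (the (subtree_at t (snd v))) = n" "fst v"]
    by (cases v) (simp add: join_bushes_simps)
qed (rule wf_join_bushes)

context skip_free_walk
begin

lemma measurable_record_tree: "(\<lambda>\<omega>. ftree_class (record_tree (path \<omega>))) \<in> M \<rightarrow>\<^sub>M borel"
proof (rule measurable_ftree_class)
  let ?R = "\<lambda>\<omega>. record_edges (path \<omega>) \<union> (record_edges (path \<omega>))\<inverse>"
  have e [measurable]: "Measurable.pred M (\<lambda>\<omega>. (i, j) \<in> record_edges (path \<omega>))" for i j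
    unfolding record_edges_iff by measurable
  have uE: "Measurable.pred M (\<lambda>\<omega>. (i, j) \<in> ?R \<omega>)" for i j by simp
  note pred_relpow[where N = M and R = ?R, OF uE, measurable]
  have v [measurable]: "Measurable.pred M (\<lambda>\<omega>. i \<in> verts (record_tree (path \<omega>)))" for i
  proof -
    have eq: "i \<in> verts (record_tree (path \<omega>)) \<longleftrightarrow> (\<exists>k. (0, i) \<in> ?R \<omega> ^^ k)" for \<omega>
      by (simp add: record_tree_def Let_def rtrancl_power)
    show ?thesis unfolding eq by measurable
  qed
  show "Measurable.pred M (\<lambda>\<omega>. i \<in> verts (record_tree (path \<omega>)))" for i by (rule v)
  have "edges (record_tree (path \<omega>)) = Restr (record_edges (path \<omega>)) (verts (record_tree (path \<omega>)))" for \<omega>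
    by (simp add: record_tree_def Let_def)
  then show "Measurable.pred M (\<lambda>\<omega>. (i, j) \<in> edges (record_tree (path \<omega>)))" for i j by simp
  have "(i, j) \<in> sib (record_tree (path \<omega>)) \<longleftrightarrow> i \<in> verts (record_tree (path \<omega>)) \<and> j \<in> verts (record_tree (path \<omega>)) \<and>
      (\<exists>k. (i, k) \<in> record_edges (path \<omega>) \<and> (j, k) \<in> record_edges (path \<omega>)) \<and> i < j" for i j \<omega>
    by (auto simp add: record_tree_def Let_def siblings_def)
  then show "Measurable.pred M (\<lambda>\<omega>. (i, j) \<in> sib (record_tree (path \<omega>)))" for i j by simp
  show "Measurable.pred M (\<lambda>\<omega>. root (record_tree (path \<omega>)) = i)" for i
    by (simp add: record_tree_def Let_def)
  show "Measurable.pred M (\<lambda>\<omega>. mark (record_tree (path \<omega>)) i = n)" for i n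
  proof -
    have eq: "mark (record_tree (path \<omega>)) i = n \<longleftrightarrow> n \<ge> - 1 \<and> (\<exists>m<i. walk_sum (path \<omega>) m i = n) \<and>
        (\<forall>m<i. walk_sum (path \<omega>) m i \<ge> - 1 \<longrightarrow> n \<le> walk_sum (path \<omega>) m i)" if "\<omega> \<in> space M" for \<omega>
      using type_fun_eq_iff[of "path \<omega>" i n] ge[OF that] by (simp add: record_tree_def Let_def)
    show ?thesis by (subst measurable_cong[OF eq]) simp_all
  qed
  show "wf_rtree (record_tree (path \<omega>))" for \<omega> by (auto simp: wf_rtree_def record_tree_def Let_def)
qed

text \<open>Off the spine event the value is an arbitrary default, which makes the map total and
  measurable and is never seen by the conditioned measure.\<close>

definition bushes :: "'a \<Rightarrow> int \<Rightarrow> int ptree" where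
  "bushes \<omega> = (if \<omega> \<in> spine_event then bush_seq (path \<omega>) else (\<lambda>_. Node 0 []))"

lemma measurable_bushes_component: "(\<lambda>\<omega>. bushes \<omega> n) \<in> measurable M (count_space UNIV)"
proof -
  \<comment> \<open>Index \<open>n\<close> is position \<open>l0\<close> in the window of indices
    from \<open>1 - r\<close> to \<open>r\<close>; the event is then a countable union over the
    possible windows.\<close>
  define r where "r = nat \<bar>n\<bar> + 1"
  define l0 where "l0 = nat (n - 1 + int r)"
  have l0: "l0 < 2 * r" "1 - int r + int l0 = n" by (auto simp: l0_def r_def)
  have "(\<lambda>\<omega>. bushes \<omega> n) -` {t} \<inter> space M \<in> sets M" for t
  proof -
    let ?W = "\<lambda>ts. {\<omega> \<in> spine_event. \<forall>l<length ts. bush_seq (path \<omega>) (1 - int r + int l) = ts ! l}"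
    have "{\<omega> \<in> spine_event. bush_seq (path \<omega>) n = t} = (\<Union>ts\<in>{ts. length ts = 2 * r \<and> ts ! l0 = t}. ?W ts)"
    proof (intro equalityI subsetI)
      fix \<omega> assume \<omega>: "\<omega> \<in> {\<omega> \<in> spine_event. bush_seq (path \<omega>) n = t}"
      define ts where "ts = map (\<lambda>l. bush_seq (path \<omega>) (1 - int r + int l)) [0..<2 * r]"
      have "ts \<in> {ts. length ts = 2 * r \<and> ts ! l0 = t}" "\<omega> \<in> ?W ts" using \<omega> l0 by (auto simp: ts_def)
      then show "\<omega> \<in> (\<Union>ts\<in>{ts. length ts = 2 * r \<and> ts ! l0 = t}. ?W ts)" by blast
    qed (use l0 in auto)
    also have "\<dots> \<in> sets M"
    proof (rule sets.countable_UN'')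
      show "?W ts \<in> sets M" if "ts \<in> {ts. length ts = 2 * r \<and> ts ! l0 = t}" for ts
        using that by (intro sets_window) simp
    qed (rule countableI_type)
    finally have "{\<omega> \<in> spine_event. bush_seq (path \<omega>) n = t} \<in> sets M" .
    moreover have "(\<lambda>\<omega>. bushes \<omega> n) -` {t} \<inter> space M = {\<omega> \<in> spine_event. bush_seq (path \<omega>) n = t} \<union>
        (if t = Node 0 [] then space M - spine_event else {})"
      using sets.sets_into_space[OF sets_spine_event] by (auto simp: bushes_def split: if_splits)
    ultimately show ?thesis by auto
  qed
  then show ?thesis by (subst measurable_count_space_eq_countable) auto
qed

lemma measurable_bushes [measurable]: "bushes \<in> M \<rightarrow>\<^sub>M (\<Pi>\<^sub>M i\<in>UNIV. measure_pmf bush)"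
proof (rule measurable_PiM_single')
  show "(\<lambda>\<omega>. bushes \<omega> n) \<in> M \<rightarrow>\<^sub>M measure_pmf bush" for n
    using measurable_bushes_component by (simp cong: measurable_cong_sets)
qed auto

lemma measurable_bush_window:
  "(\<lambda>\<omega>. map (\<lambda>l. bushes \<omega> (1 - int r + int l)) [0..<2 * r]) \<in> measurable M (count_space UNIV)"
  (is "?V \<in> _")
proof -
  have eq: "?V \<omega> = ts \<longleftrightarrow> length ts = 2 * r \<and> (\<forall>l<length ts. bushes \<omega> (1 - int r + int l) = ts ! l)" for \<omega> ts
    by (auto simp: list_eq_iff_nth_eq[of _ ts])
  have [measurable]: "Measurable.pred M (\<lambda>\<omega>. bushes \<omega> n = t)" for n t
    by (rule measurable_compose[OF measurable_bushes_component, of "\<lambda>s. s = t"]) auto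
  have "Measurable.pred M (\<lambda>\<omega>. ?V \<omega> = ts)" for ts unfolding eq by measurable
  then show ?thesis
    by (subst measurable_count_space_eq_countable) (auto simp: pred_def vimage_def Int_def conj_commute)
qed

definition spine_measure :: "'a measure" where
  "spine_measure = uniform_measure M spine_event"

lemma sets_spine_measure [measurable_cong, simp]: "sets spine_measure = sets M"
  by (simp add: spine_measure_def)

lemma space_spine_measure [simp]: "space spine_measure = space M"
  by (simp add: spine_measure_def)

text \<open>Conditioning divides by the probability \<open>1 - c\<close> of the spine event, which
  is the prefactor in \<open>prob_window\<close>; the product law remains.\<close>

lemma distr_bush_window:
  "distr spine_measure (count_space UNIV) (\<lambda>\<omega>. map (\<lambda>l. bushes \<omega> (1 - int r + int l)) [0..<2 * r]) =
     measure_pmf (replicate_pmf (2 * r) bush)" (is "distr _ _ ?V = _")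
proof (rule measure_eqI_countable[of _ UNIV])
  note V = measurable_bush_window[of r]
  fix ts
  have "emeasure (distr spine_measure (count_space UNIV) ?V) {ts} = emeasure spine_measure {\<omega> \<in> space M. ?V \<omega> = ts}"
    using V by (subst emeasure_distr) (auto simp: vimage_def Int_def conj_commute cong: measurable_cong_sets)
  also have "\<dots> = emeasure M (spine_event \<inter> {\<omega> \<in> space M. ?V \<omega> = ts}) / emeasure M spine_event"
    unfolding spine_measure_def by (rule emeasure_uniform_measure) (use V in measurable)
  also have "spine_event \<inter> {\<omega> \<in> space M. ?V \<omega> = ts} =
    (if length ts = 2 * r then {\<omega> \<in> spine_event. \<forall>l<length ts. bush_seq (path \<omega>) (1 - int r + int l) = ts ! l} else {})"
    by (auto simp: bushes_def spine_event_def list_eq_iff_nth_eq[of _ ts])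
  also have "emeasure M \<dots> / emeasure M spine_event = ennreal (pmf (replicate_pmf (2 * r) bush) ts)"
  proof (cases "length ts = 2 * r")
    case True
    have "0 \<le> (\<Prod>t\<leftarrow>ts. pmf bush t)" by (intro prod_list_nonneg) auto
    then show ?thesis using True c prob_window[of r ts]
      by (simp add: emeasure_eq_measure prob_spine_event pmf_replicate_pmf divide_ennreal)
  qed (simp add: pmf_replicate_pmf)
  finally show "emeasure (distr spine_measure (count_space UNIV) ?V) {ts} = emeasure (replicate_pmf (2 * r) bush) {ts}"
    by (simp add: emeasure_pmf_single)
qed auto

text \<open>The product measure is determined by finite cylinders. Every finite set of coordinates
  fits into a window from \<open>1 - r\<close> to \<open>r\<close>, in which \<open>F'\<close>
  leaves the coordinates outside \<open>J\<close> free.\<close>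

lemma distr_bushes:
  "distr spine_measure (\<Pi>\<^sub>M i\<in>UNIV. measure_pmf bush) bushes = (\<Pi>\<^sub>M i\<in>(UNIV :: int set). measure_pmf bush)"
proof -
  interpret P: product_prob_space "\<lambda>_. measure_pmf bush" "UNIV :: int set" ..
  show ?thesis
  proof (rule P.PiM_eq)
    fix J :: "int set" and F :: "int \<Rightarrow> int ptree set"
    assume J: "finite J"
    define r where "r = Suc (nat (\<Sum>j\<in>J. \<bar>j\<bar>))"
    have r: "\<bar>j\<bar> < int r" if "j \<in> J" for j
      using member_le_sum[of j J abs] that J by (simp add: r_def)
    define F' where "F' j = (if j \<in> J then F j else UNIV)" for j
    let ?V = "\<lambda>\<omega>. map (\<lambda>l. bushes \<omega> (1 - int r + int l)) [0..<2 * r]"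
    let ?S = "{ts. length ts = 2 * r \<and> (\<forall>l<2 * r. ts ! l \<in> F' (1 - int r + int l))}"
    have idx: "\<exists>l<2 * r. 1 - int r + int l = j" if "j \<in> J" for j
      using r[OF that] by (intro exI[of _ "nat (j - 1 + int r)"]) auto
    note V = measurable_bush_window[of r]
    have "bushes -` prod_emb UNIV (\<lambda>_. measure_pmf bush) J (Pi\<^sub>E J F) \<inter> space M = ?V -` ?S \<inter> space M"
    proof (intro set_eqI)
      fix \<omega>
      have "(\<forall>j\<in>J. bushes \<omega> j \<in> F j) \<longleftrightarrow> (\<forall>l<2 * r. bushes \<omega> (1 - int r + int l) \<in> F' (1 - int r + int l))"
        using idx unfolding F'_def by (metis UNIV_I)
      then show "\<omega> \<in> bushes -` prod_emb UNIV (\<lambda>_. measure_pmf bush) J (Pi\<^sub>E J F) \<inter> space M \<longleftrightarrow>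
          \<omega> \<in> ?V -` ?S \<inter> space M"
        by (simp add: prod_emb_def space_PiM PiE_iff)
    qed
    then have "emeasure (distr spine_measure (\<Pi>\<^sub>M i\<in>UNIV. measure_pmf bush) bushes)
        (prod_emb UNIV (\<lambda>_. measure_pmf bush) J (Pi\<^sub>E J F)) =
        emeasure (distr spine_measure (count_space UNIV) ?V) ?S"
      using V J by (subst (1 2) emeasure_distr) (auto cong: measurable_cong_sets intro!: sets_PiM_I)
    also have "\<dots> = ennreal (\<Prod>l<2 * r. measure bush (F' (1 - int r + int l)))"
      unfolding distr_bush_window measure_pmf.emeasure_eq_measure measure_replicate_pmf ..
    also have "(\<Prod>l<2 * r. measure bush (F' (1 - int r + int l))) = (\<Prod>j\<in>{1 - int r..int r}. measure bush (F' j))"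
      by (rule prod.reindex_bij_witness[of _ "\<lambda>j. nat (j - 1 + int r)" "\<lambda>l. 1 - int r + int l"]) auto
    also have "\<dots> = (\<Prod>j\<in>J. measure bush (F j))"
      using r by (intro prod.mono_neutral_cong_right) (force simp: F'_def)+
    finally show "emeasure (distr spine_measure (\<Pi>\<^sub>M i\<in>UNIV. measure_pmf bush) bushes)
        (prod_emb UNIV (\<lambda>_. measure_pmf bush) J (Pi\<^sub>E J F)) = (\<Prod>j\<in>J. emeasure (measure_pmf bush) (F j))"
      by (simp add: measure_pmf.emeasure_eq_measure prod_ennreal)
  qed simp
qed

text \<open>On the spine event the record tree is isomorphic to the join of its bushes, so the
  classes agree there, and the law is pushed forward from the i.i.d. bushes.\<close>

lemma distr_record_tree:
  "distr spine_measure borel (\<lambda>\<omega>. ftree_class (record_tree (path \<omega>))) =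
     distr (\<Pi>\<^sub>M i\<in>(UNIV :: int set). measure_pmf bush) borel (\<lambda>b. ftree_class (join_bushes b))"
proof -
  have "distr spine_measure borel (\<lambda>\<omega>. ftree_class (record_tree (path \<omega>))) =
      distr spine_measure borel ((\<lambda>b. ftree_class (join_bushes b)) \<circ> bushes)"
  proof (rule distr_cong_AE)
    have "ftree_class (join_bushes (bush_seq (path \<omega>))) = ftree_class (record_tree (path \<omega>))"
      if "\<omega> \<in> spine_event" for \<omega>
      using that ge wf_join_bushes[of "bush_seq (path \<omega>)"]
      by (intro ftree_class_cong rtree_iso_join_bushes) (auto simp: spine_event_def wf_rtree_def)
    then show "AE \<omega> in spine_measure. ftree_class (record_tree (path \<omega>)) =
        ((\<lambda>b. ftree_class (join_bushes b)) \<circ> bushes) \<omega>"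
      unfolding spine_measure_def by (intro AE_uniform_measureI AE_I2) (auto simp: bushes_def)
    show "(\<lambda>\<omega>. ftree_class (record_tree (path \<omega>))) \<in> spine_measure \<rightarrow>\<^sub>M borel"
      using measurable_record_tree by (simp cong: measurable_cong_sets)
    have "bushes \<in> spine_measure \<rightarrow>\<^sub>M (\<Pi>\<^sub>M i\<in>UNIV. measure_pmf bush)"
      using measurable_bushes by (simp cong: measurable_cong_sets)
    then show "(\<lambda>b. ftree_class (join_bushes b)) \<circ> bushes \<in> spine_measure \<rightarrow>\<^sub>M borel"
      by (rule measurable_comp[OF _ measurable_join_bushes])
  qed auto
  also have "\<dots> = distr (distr spine_measure (\<Pi>\<^sub>M i\<in>UNIV. measure_pmf bush) bushes) borel
      (\<lambda>b. ftree_class (join_bushes b))"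
    using measurable_bushes by (intro distr_distr[symmetric] measurable_join_bushes) (simp cong: measurable_cong_sets)
  finally show ?thesis by (simp only: distr_bushes)
qed

lemma MEKT_spine_measure:
  "MEKT spine_offspring offspring bush (distr spine_measure borel (\<lambda>\<omega>. ftree_class (record_tree (path \<omega>))))"
  unfolding MEKT_def distr_record_tree
  using mean_spine_offspring mean_offspring bush_law_bush measurable_join_bushes by blast

lemma measure_q: "measure (measure_pmf q) S = prob {\<omega> \<in> space M. nat (X 0 \<omega> + 1) \<in> S}"
proof -
  have m: "(\<lambda>\<omega>. nat (X 0 \<omega> + 1)) \<in> measurable M (count_space UNIV)" by measurable
  have "distr M (count_space UNIV) (\<lambda>\<omega>. nat (X 0 \<omega> + 1)) = measure_pmf q"
  proof (rule measure_eqI_countable[of _ UNIV])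
    fix k
    have "{\<omega> \<in> space M. nat (X 0 \<omega> + 1) = k} = {\<omega> \<in> space M. X 0 \<omega> = int k - 1}"
      using ge[of _ 0] by force
    then show "emeasure (distr M (count_space UNIV) (\<lambda>\<omega>. nat (X 0 \<omega> + 1))) {k} = emeasure q {k}"
      using m by (simp add: emeasure_distr vimage_def Int_def conj_commute emeasure_pmf_single pmf_q emeasure_eq_measure)
  qed auto
  then have "measure (measure_pmf q) S = measure (distr M (count_space UNIV) (\<lambda>\<omega>. nat (X 0 \<omega> + 1))) S" by simp
  also have "\<dots> = prob {\<omega> \<in> space M. nat (X 0 \<omega> + 1) \<in> S}"
    using m by (simp add: measure_distr vimage_def Int_def conj_commute)
  finally show ?thesis .
qed

end

theorem theorem55:
  fixes M :: "'a measure" and X :: "int \<Rightarrow> 'a \<Rightarrow> int"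
  defines "T \<equiv> \<lambda>\<omega>. record_tree (\<lambda>n. X n \<omega>)"
    and "c \<equiv> \<P>(\<omega> in M. \<exists>n>0. (\<Sum>k<n. X (int k) \<omega>) = - 1)"
    and "A \<equiv> {\<omega> \<in> space M. \<exists>P. bi_infinite_path (record_tree (\<lambda>n. X n \<omega>)) P \<and>
      root (record_tree (\<lambda>n. X n \<omega>)) \<in> P}"
  assumes "prob_space M"
    and "prob_space.indep_vars M (\<lambda>_. count_space UNIV) X UNIV"
    and "\<And>n. distr M (count_space UNIV) (X n) = distr M (count_space UNIV) (X 0)"
    and "\<And>n \<omega>. \<omega> \<in> space M \<Longrightarrow> X n \<omega> \<ge> - 1"
    and "\<P>(\<omega> in M. X 0 \<omega> = - 1) > 0"
    and "integrable M (\<lambda>\<omega>. real_of_int (X 0 \<omega>))"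
    and "0 < (\<integral>\<omega>. real_of_int (X 0 \<omega>) \<partial>M)"
  shows "(\<lambda>\<omega>. ftree_class (T \<omega>)) \<in> M \<rightarrow>\<^sub>M borel \<and>
    (AE \<omega> in M. \<exists>!P. bi_infinite_path (T \<omega>) P) \<and>
    A \<in> sets M \<and> measure M A > 0 \<and>
    (\<exists>(\<pi>_bar :: nat pmf) (\<pi>_tilde :: nat pmf) (\<mu> :: int ptree pmf).
      (\<forall>k. pmf \<pi>_tilde k = c powi (int k - 1) * \<P>(\<omega> in M. X 0 \<omega> = int k - 1)) \<and>
      (\<forall>k. pmf \<pi>_bar k = c ^ k * \<P>(\<omega> in M. X 0 \<omega> \<ge> int k)) \<and>
      MEKT \<pi>_bar \<pi>_tilde \<mu> (distr (uniform_measure M A) borel (\<lambda>\<omega>. ftree_class (T \<omega>))) \<and>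
      bush_law \<pi>_bar \<pi>_tilde \<mu> \<and>
      (\<forall>t\<in>set_pmf \<mu>. \<forall>s\<in>set (children t). set_ptree s = {- 1}) \<and>
      (\<forall>\<tau> n. \<P>(t in \<mu>. unmark t = \<tau>) > 0 \<longrightarrow>
         \<P>(t in \<mu>. root_mark t = n \<bar> unmark t = \<tau>) =
         \<P>(t in \<mu>. root_mark t = n \<bar> num_children t = num_children \<tau>)) \<and>
      (\<forall>n k. \<P>(t in \<mu>. root_mark t = int n \<and> num_children t = k) =
         \<P>(\<omega> in M. X 0 \<omega> = int (n + k)) * c ^ k))"
proof -
  interpret prob_space M by fact
  interpret W: skip_free_walk M X by unfold_locales (use assms in auto)
  have c: "c = W.c" by (simp add: c_def W.c_def)
  have A: "A = W.spine_event"
    by (simp add: A_def W.spine_event_def root_in_bi_infinite_path_iff)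
  have "AE \<omega> in M. \<exists>!P. bi_infinite_path (T \<omega>) P"
    using W.AE_two_sided_records by eventually_elim (auto simp: T_def bi_infinite_path_record_tree)
  moreover have "pmf W.offspring k = c powi (int k - 1) * prob {\<omega> \<in> space M. X 0 \<omega> = int k - 1}" for k
    using W.c by (simp add: c W.pmf_offspring W.pmf_q power_int_diff)
  moreover have "pmf W.spine_offspring k = c ^ k * prob {\<omega> \<in> space M. X 0 \<omega> \<ge> int k}" for k
  proof -
    have "{\<omega> \<in> space M. nat (X 0 \<omega> + 1) \<in> {k + 1..}} = {\<omega> \<in> space M. X 0 \<omega> \<ge> int k}" by auto
    then show ?thesis by (simp only: c W.pmf_spine_offspring W.measure_q)
  qed
  moreover have "measure W.bush {t. root_mark t = int n \<and> num_children t = k} =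
      prob {\<omega> \<in> space M. X 0 \<omega> = int (n + k)} * c ^ k" for n k
    by (simp add: c W.prob_mark_children W.pmf_q)
  ultimately show ?thesis
    using W.measurable_record_tree W.prob_spine_event W.c W.MEKT_spine_measure W.bush_law_bush
      W.children_bush W.conditional_mark
    by (intro conjI exI[of _ W.spine_offspring] exI[of _ W.offspring] exI[of _ W.bush])
      (auto simp: T_def A cond_prob_def W.spine_measure_def)
qed

end
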